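(* There exists a neighbourhood $U=B_\delta(0)$ of $\eta=0$, not depending on $\rho$, such that for every $\rho>0$ the first Bloch eigenvalue $\lambda_1^\rho(\eta)$ is analytic on $B_\delta(0)$.
   Context: $Y=[0,2\pi)^d$, $Y'=[-\frac12,\frac12)^d$. $A(y)$ is a $d\times d$ matrix with real, bounded, measurable entries on $\mathbb{R}^d$ that is symmetric, $Y$-periodic ($A(y+2\pi p)=A(y)$ for all $p\in\mathbb{Z}^d$, a.e. $y$), and elliptic: there is $\alpha>0$ with $A(y)\xi\cdot\xi\ge\alpha|\xi|^2$ for all $\xi\in\mathbb{R}^d$, a.e. $y$. $H^s_\sharp(Y)$ is the Sobolev space of (complex-valued) $Y$-periodic functions, identified with $H^s$ of the torus $\mathbb{R}^d/2\pi\mathbb{Z}^d$. For $\rho>0$, $\eta\in Y'$, let $\mathcal{A}^\rho(\eta)=\rho^2(\nabla+i\eta)^4-(\nabla+i\eta)\cdot A(y)(\nabla+i\eta)$, acting on $Y$-periodic functions and associated with the form $a^\rho[\eta](u,v)=\int_Y A(\nabla+i\eta)u\cdot\overline{(\nabla+i\eta)v}\,dy+\rho^2\int_Y(\nabla+i\eta)^2u\,\overline{(\nabla+i\eta)^2v}\,dy$ on $H^2_\sharp(Y)$, where $(\nabla+i\eta)^2u=\Delta u+2i\eta\cdot\nabla u-|\eta|^2u$. The Bloch eigenvalues $\lambda_1^\rho(\eta)\le\lambda_2^\rho(\eta)\le\cdots$ are the eigenvalues of $\mathcal{A}^\rho(\eta)$ in $L^2_\sharp(Y)$, repeated with multiplicity.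 $B_\delta(0)=\{\eta\in Y':|\eta|<\delta\}$. *)

theory Defs
  imports "HOL-Analysis.Analysis"
begin

section \<open>Periodic functions on \<open>\<real>\<^sup>d\<close>, with \<open>d = CARD('n)\<close>\<close>

definition cell :: "(real^'n) set" where
  "cell = {y. \<forall>i. 0 \<le> y $ i \<and> y $ i < 2 * pi}"

definition dual_cell :: "(real^'n) set" where
  "dual_cell = {\<eta>. \<forall>i. - (1/2) \<le> \<eta> $ i \<and> \<eta> $ i < 1/2}"

definition int_vecs :: "(real^'n) set" where
  "int_vecs = {p. \<forall>i. p $ i \<in> \<int>}"

definition periodic_ae :: "(real^'n \<Rightarrow> 'b) \<Rightarrow> bool" where
  "periodic_ae u \<longleftrightarrow>
     (\<forall>p\<in>int_vecs. AE y in lebesgue. u (y + (2 * pi) *\<^sub>R p) = u y)"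

text \<open>Elements of the function spaces below are represented by functions on \<open>\<real>\<^sup>d\<close>;
  two representatives of the same element agree almost everywhere.\<close>

definition L2_per :: "(real^'n \<Rightarrow> complex) \<Rightarrow> bool" where
  "L2_per u \<longleftrightarrow> u \<in> borel_measurable lebesgue \<and> periodic_ae u \<and>
     set_integrable lebesgue cell (\<lambda>y. (cmod (u y))\<^sup>2)"

definition L2_inner :: "(real^'n \<Rightarrow> complex) \<Rightarrow> (real^'n \<Rightarrow> complex) \<Rightarrow> complex" where
  "L2_inner u v = set_lebesgue_integral lebesgue cell (\<lambda>y. u y * cnj (v y))"

definition partial_deriv_is ::
    "'n \<Rightarrow> (real^'n \<Rightarrow> complex) \<Rightarrow> (real^'n \<Rightarrow> complex) \<Rightarrow> bool" where
  "partial_deriv_is i \<phi> \<psi> \<longleftrightarrow>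
     (\<forall>y. ((\<lambda>t. \<phi> (y + t *\<^sub>R axis i 1)) has_vector_derivative \<psi> y) (at 0))"

text \<open>\<open>C\<^sup>\<infinity>\<close> functions: \<open>D l\<close> is the iterated partial derivative along the list of
  coordinate directions \<open>l\<close>.\<close>

definition smooth_fun :: "(real^'n \<Rightarrow> complex) \<Rightarrow> bool" where
  "smooth_fun \<phi> \<longleftrightarrow>
     (\<exists>D :: 'n list \<Rightarrow> real^'n \<Rightarrow> complex. D [] = \<phi> \<and>
        (\<forall>l. continuous_on UNIV (D l)) \<and>
        (\<forall>i l. partial_deriv_is i (D l) (D (i # l))))"

definition test_fun :: "(real^'n \<Rightarrow> complex) \<Rightarrow> bool" where
  "test_fun \<phi> \<longleftrightarrow> smooth_fun \<phi> \<and>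
     (\<forall>p\<in>int_vecs. \<forall>y. \<phi> (y + (2 * pi) *\<^sub>R p) = \<phi> y)"

text \<open>Weak derivatives on the torus \<open>\<real>\<^sup>d/2\<pi>\<int>\<^sup>d\<close>: the test functions are the smooth periodic
  functions (not the ones with compact support in the cell), so that no boundary term is lost.\<close>

definition has_weak_deriv ::
    "'n \<Rightarrow> (real^'n \<Rightarrow> complex) \<Rightarrow> (real^'n \<Rightarrow> complex) \<Rightarrow> bool" where
  "has_weak_deriv i u g \<longleftrightarrow> L2_per g \<and>
     (\<forall>\<phi> \<psi>. test_fun \<phi> \<longrightarrow> partial_deriv_is i \<phi> \<psi> \<longrightarrow>
        set_lebesgue_integral lebesgue cell (\<lambda>y. u y * \<psi> y) =
        - set_lebesgue_integral lebesgue cell (\<lambda>y. g y * \<phi> y))"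

text \<open>\<open>H_per s\<close> is the Sobolev space \<open>H\<^sup>s\<close> of the torus, for integer \<open>s\<close>.\<close>

fun H_per :: "nat \<Rightarrow> (real^'n \<Rightarrow> complex) \<Rightarrow> bool" where
  "H_per 0 u \<longleftrightarrow> L2_per u"
| "H_per (Suc s) u \<longleftrightarrow> L2_per u \<and> (\<forall>i. \<exists>g. has_weak_deriv i u g \<and> H_per s g)"

text \<open>The weak derivative is unique up to null sets; one representative is chosen.\<close>

definition weak_deriv :: "'n \<Rightarrow> (real^'n \<Rightarrow> complex) \<Rightarrow> real^'n \<Rightarrow> complex" where
  "weak_deriv i u = (SOME g. has_weak_deriv i u g)"

section \<open>The shifted operator and its eigenvalues\<close>

text \<open>\<open>(\<nabla> + i\<eta>)u\<close> and \<open>(\<nabla> + i\<eta>)\<^sup>2u = \<Delta>u + 2i\<eta>\<cdot>\<nabla>u - |\<eta>|\<^sup>2u\<close>.\<close>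

definition shifted_grad ::
    "real^'n \<Rightarrow> (real^'n \<Rightarrow> complex) \<Rightarrow> real^'n \<Rightarrow> complex^'n" where
  "shifted_grad \<eta> u y = (\<chi> j. weak_deriv j u y + \<i> * complex_of_real (\<eta> $ j) * u y)"

definition shifted_lap ::
    "real^'n \<Rightarrow> (real^'n \<Rightarrow> complex) \<Rightarrow> real^'n \<Rightarrow> complex" where
  "shifted_lap \<eta> u y =
     (\<Sum>j\<in>UNIV. weak_deriv j (weak_deriv j u) y)
     + 2 * \<i> * (\<Sum>j\<in>UNIV. complex_of_real (\<eta> $ j) * weak_deriv j u y)
     - complex_of_real ((norm \<eta>)\<^sup>2) * u y"

definition bloch_form ::
    "(real^'n \<Rightarrow> real^'n^'n) \<Rightarrow> real \<Rightarrow> real^'n \<Rightarrow>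
     (real^'n \<Rightarrow> complex) \<Rightarrow> (real^'n \<Rightarrow> complex) \<Rightarrow> complex" where
  "bloch_form A \<rho> \<eta> u v =
     set_lebesgue_integral lebesgue cell (\<lambda>y. \<Sum>j\<in>UNIV. \<Sum>k\<in>UNIV.
        complex_of_real (A y $ j $ k) * shifted_grad \<eta> u y $ k * cnj (shifted_grad \<eta> v y $ j))
     + complex_of_real (\<rho>\<^sup>2) *
       set_lebesgue_integral lebesgue cell (\<lambda>y. shifted_lap \<eta> u y * cnj (shifted_lap \<eta> v y))"

text \<open>\<open>bloch_operator A \<rho> \<eta> u f\<close>: \<open>u\<close> is in the domain of the operator on \<open>L\<^sup>2\<close> associated
  with the form, and the operator maps \<open>u\<close> to \<open>f\<close>.\<close>

definition bloch_operator ::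
    "(real^'n \<Rightarrow> real^'n^'n) \<Rightarrow> real \<Rightarrow> real^'n \<Rightarrow>
     (real^'n \<Rightarrow> complex) \<Rightarrow> (real^'n \<Rightarrow> complex) \<Rightarrow> bool" where
  "bloch_operator A \<rho> \<eta> u f \<longleftrightarrow> H_per 2 u \<and> L2_per f \<and>
     (\<forall>v. H_per 2 v \<longrightarrow> bloch_form A \<rho> \<eta> u v = L2_inner f v)"

text \<open>The operator is self-adjoint, so only real eigenvalues are considered.\<close>

definition bloch_eigenfunction ::
    "(real^'n \<Rightarrow> real^'n^'n) \<Rightarrow> real \<Rightarrow> real^'n \<Rightarrow> real \<Rightarrow> (real^'n \<Rightarrow> complex) \<Rightarrow> bool" where
  "bloch_eigenfunction A \<rho> \<eta> \<mu> u \<longleftrightarrow>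
     \<not> (AE y in lebesgue. u y = 0) \<and>
     bloch_operator A \<rho> \<eta> u (\<lambda>y. complex_of_real \<mu> * u y)"

definition lin_indep_ae :: "nat \<Rightarrow> (nat \<Rightarrow> real^'n \<Rightarrow> complex) \<Rightarrow> bool" where
  "lin_indep_ae m u \<longleftrightarrow>
     (\<forall>c :: nat \<Rightarrow> complex. (AE y in lebesgue. (\<Sum>l<m. c l * u l y) = 0) \<longrightarrow> (\<forall>l<m. c l = 0))"

text \<open>The \<open>m\<close>-th eigenvalue, \<open>m \<ge> 1\<close>, in the nondecreasing list with multiplicities: the least
  \<open>\<mu>\<close> for which there are \<open>m\<close> linearly independent eigenfunctions with eigenvalues at most
  \<open>\<mu>\<close>. (The value at \<open>m = 0\<close> is meaningless.)\<close>

definition bloch_eigenvalue ::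
    "(real^'n \<Rightarrow> real^'n^'n) \<Rightarrow> real \<Rightarrow> nat \<Rightarrow> real^'n \<Rightarrow> real" where
  "bloch_eigenvalue A \<rho> m \<eta> =
     (LEAST \<mu>. \<exists>\<nu> u. lin_indep_ae m u \<and>
        (\<forall>l<m. \<nu> l \<le> \<mu> \<and> bloch_eigenfunction A \<rho> \<eta> (\<nu> l) (u l)))"

lemma bloch_eigenvalue_1:
  "bloch_eigenvalue A \<rho> 1 \<eta> = (LEAST \<mu>. \<exists>u. bloch_eigenfunction A \<rho> \<eta> \<mu> u)"
proof -
  have indep: "lin_indep_ae 1 u \<longleftrightarrow> \<not> (AE y in lebesgue. u 0 y = 0)"
    for u :: "nat \<Rightarrow> real^'n \<Rightarrow> complex"
  proof
    assume "lin_indep_ae 1 u"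
    from this[unfolded lin_indep_ae_def, rule_format, of "\<lambda>_. 1" 0]
    show "\<not> (AE y in lebesgue. u 0 y = 0)" by auto
  next
    assume *: "\<not> (AE y in lebesgue. u 0 y = 0)"
    show "lin_indep_ae 1 u"
      unfolding lin_indep_ae_def
    proof (intro allI impI)
      fix c :: "nat \<Rightarrow> complex" and l :: nat
      assume ae: "AE y in lebesgue. (\<Sum>l<1. c l * u l y) = 0" and "l < 1"
      show "c l = 0"
      proof (rule ccontr)
        assume "c l \<noteq> 0"
        with ae \<open>l < 1\<close> have "AE y in lebesgue. u 0 y = 0" by simp
        with * show False by simp
      qed
    qed
  qed
  have ex: "(\<exists>\<nu> u. lin_indep_ae 1 u \<and> (\<forall>l<1. \<nu> l \<le> \<mu> \<and> bloch_eigenfunction A \<rho> \<eta> (\<nu> l) (u l)))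
      \<longleftrightarrow> (\<exists>\<nu>\<le>\<mu>. \<exists>u. bloch_eigenfunction A \<rho> \<eta> \<nu> u)" (is "?L \<longleftrightarrow> ?R") for \<mu>
  proof
    assume ?L then show ?R by auto
  next
    assume ?R
    then obtain \<nu> u where "\<nu> \<le> \<mu>" and u: "bloch_eigenfunction A \<rho> \<eta> \<nu> u" by blast
    moreover have "lin_indep_ae 1 (\<lambda>_::nat. u)"
      using u by (simp add: indep[simplified] bloch_eigenfunction_def)
    ultimately show ?L
      by (intro exI[of _ "\<lambda>_. \<nu>"] exI[of _ "\<lambda>_. u"]) auto
  qed
  have least: "(LEAST \<mu>. \<exists>\<nu>\<le>\<mu>. P \<nu>) = (LEAST \<mu>. P \<mu>)" for P :: "real \<Rightarrow> bool"
  proof -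
    have "((\<exists>\<nu>\<le>x. P \<nu>) \<and> (\<forall>y. (\<exists>\<nu>\<le>y. P \<nu>) \<longrightarrow> x \<le> y)) \<longleftrightarrow> (P x \<and> (\<forall>y. P y \<longrightarrow> x \<le> y))" for x
      by (metis order.antisym order.trans order_refl)
    then show ?thesis by (simp add: Least_def)
  qed
  show ?thesis
    unfolding bloch_eigenvalue_def ex least ..
qed

section \<open>Real analyticity in several variables\<close>

text \<open>Local expansion into a power series in \<open>d\<close> variables; the index \<open>\<alpha>\<close> runs over all
  multi-indices, and \<open>has_sum\<close> is unconditional (equivalently, absolute) convergence.\<close>

definition real_analytic_at :: "(real^'n \<Rightarrow> real) \<Rightarrow> real^'n \<Rightarrow> bool" where
  "real_analytic_at f x \<longleftrightarrow>
     (\<exists>r>0. \<exists>c :: ('n \<Rightarrow> nat) \<Rightarrow> real. \<forall>y\<in>ball x r.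
        ((\<lambda>\<alpha>. c \<alpha> * (\<Prod>i\<in>UNIV. (y $ i - x $ i) ^ \<alpha> i)) has_sum f y) UNIV)"

definition real_analytic_on :: "(real^'n \<Rightarrow> real) \<Rightarrow> (real^'n) set \<Rightarrow> bool" where
  "real_analytic_on f S \<longleftrightarrow> (\<forall>x\<in>S. real_analytic_at f x)"

end

theory Submission
  imports Defs
begin

text \<open>The problem is moved to the Hilbert space \<open>H = \<ell>\<^sup>2(\<int>\<^sup>d)\<close>. A periodic function \<open>u\<close> in \<open>H\<^sup>2\<close> is
represented by its Fourier coefficients multiplied by the weight \<open>max 1 \<bar>k\<bar>\<^sup>2\<close>; this makes \<open>H\<^sup>2\<close> all
of \<open>H\<close>, and the eigenvalue problem becomes \<open>B(\<eta>) c = \<mu> N c\<close> with bounded self-adjoint operators, where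
\<open>B(\<eta>)\<close> is a polynomial in \<open>\<eta>\<close> and \<open>N\<close> does not depend on \<open>\<eta>\<close> (\<open>ex_bloch_eigenfunction_iff\<close>).

The neighbourhood is uniform in \<open>\<rho>\<close> because of the following comparison. On functions of mean zero and for
\<open>\<bar>\<eta>\<bar> \<le> 1/3\<close> one has \<open>\<bar>k + \<eta>\<bar> \<ge> 2\<bar>k\<bar>/3\<close> for all frequencies, so ellipticity bounds the form from below by
\<open>\<beta> = 4\<alpha>/9 + 8\<rho>\<^sup>2/81\<close> times the square of the \<open>L\<^sup>2\<close> norm, with a multiple of the square of the \<open>H\<^sup>2\<close> norm to
spare (\<open>bloch_op_gap\<close>). The constant function has Rayleigh quotient at most
\<open>M d\<^sup>2 \<bar>\<eta>\<bar>\<^sup>2 + \<rho>\<^sup>2 \<bar>\<eta>\<bar>\<^sup>4\<close> (\<open>bloch_op_e0\<close>). Both bounds contain \<open>\<rho>\<^sup>2\<close> linearly, and \<open>\<bar>\<eta>\<bar>\<^sup>4 \<le> 1/81\<close>; so the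
second one is below the first as soon as \<open>M d\<^sup>2 \<bar>\<eta>\<bar>\<^sup>2 < 4\<alpha>/9\<close>, whatever \<open>\<rho>\<close> is.

Such a gap isolates the first eigenvalue. There is at most one eigenvalue below \<open>\<beta>\<close>, since two of them
would give two eigenvectors whose difference has mean zero and violates the lower bound (\<open>eigen_le\<close>). There
is one, by the intermediate value theorem applied to the Schur complement with respect to the constants
(\<open>ex_low_eigen\<close>). An eigenvector for it cannot have mean zero; normalized as \<open>1 + w\<close> with \<open>w\<close> of mean
zero, it solves an equation that is quadratic in \<open>w\<close> and has coefficients analytic in \<open>\<eta>\<close>, because the
eigenvalue is itself an affine function of \<open>w\<close>. The linearization at a solution is a rank-one perturbation of
a coercive operator and has an explicit inverse. So the analytic implicit function theorem gives an
analytic branch of eigenvalues below \<open>\<beta>\<close>, which is the first eigenvalue by uniqueness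
(\<open>Least_eigen_analytic\<close>).

The implicit function theorem is proved in the form of a fixed point theorem
(\<open>analytic_quadratic_fixed_point\<close>): the power series of the solution, in all \<open>d\<close> variables at once, is the
fixed point of a contraction in the Banach space of absolutely summable coefficient families.

The passage to \<open>\<ell>\<^sup>2\<close> needs the \<open>L\<^sup>2\<close> theory of Fourier series in \<open>d\<close> variables: the exponentials are
complete (\<open>wave_complete\<close>, from the Stone--Weierstrass theorem on the torus), every square-summable family is
a family of Fourier coefficients (\<open>riesz_fischer\<close>), Parseval's identity holds (\<open>parseval\<close>), and a weak
derivative is multiplication by \<open>i k\<^sub>j\<close> (\<open>has_weak_deriv_coeff\<close>, \<open>has_weak_derivI\<close>).\<close>

section \<open>Absolutely convergent power series with values in a Banach space\<close>

text \<open>A power series in the variables \<open>'i\<close>, given by its coefficients. Summability of the norms means absolute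
convergence on the closed unit cube; a series with another radius is rescaled to this one. The sum of
the norms makes the space complete, which is what the contraction principle needs later.\<close>

typedef (overloaded) ('i, 'a) pseries =
    "{c :: ('i \<Rightarrow> nat) \<Rightarrow> 'a::real_normed_vector. (\<lambda>\<alpha>. norm (c \<alpha>)) summable_on UNIV}"
  morphisms coeff Abs_pseries
  by (rule exI[of _ "\<lambda>_. 0"]) simp

setup_lifting type_definition_pseries

lemma coeff_abs_summable: "(\<lambda>\<alpha>. norm (coeff c \<alpha>)) summable_on UNIV"
  using coeff[of c] by simp

lemma abs_summable_add_fun:
  fixes c d :: "'k \<Rightarrow> 'a::real_normed_vector"
  assumes "(\<lambda>\<alpha>. norm (c \<alpha>)) summable_on UNIV" "(\<lambda>\<alpha>. norm (d \<alpha>)) summable_on UNIV"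
  shows "(\<lambda>\<alpha>. norm (c \<alpha> + d \<alpha>)) summable_on UNIV"
  by (rule summable_on_comparison_test[OF summable_on_add[OF assms]]) (auto intro: norm_triangle_ineq)

instantiation pseries :: (type, real_normed_vector) real_normed_vector
begin

lift_definition zero_pseries :: "('a, 'b) pseries" is "\<lambda>_. 0" by simp
lift_definition plus_pseries :: "('a, 'b) pseries \<Rightarrow> ('a, 'b) pseries \<Rightarrow> ('a, 'b) pseries"
  is "\<lambda>c d \<alpha>. c \<alpha> + d \<alpha>" by (rule abs_summable_add_fun)
lift_definition uminus_pseries :: "('a, 'b) pseries \<Rightarrow> ('a, 'b) pseries"
  is "\<lambda>c \<alpha>. - c \<alpha>" by simp
lift_definition minus_pseries :: "('a, 'b) pseries \<Rightarrow> ('a, 'b) pseries \<Rightarrow> ('a, 'b) pseries"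
  is "\<lambda>c d \<alpha>. c \<alpha> - d \<alpha>"
  using abs_summable_add_fun[of _ "\<lambda>\<alpha>. - d \<alpha>" for d] by fastforce
lift_definition scaleR_pseries :: "real \<Rightarrow> ('a, 'b) pseries \<Rightarrow> ('a, 'b) pseries"
  is "\<lambda>r c \<alpha>. r *\<^sub>R c \<alpha>" by (simp add: summable_on_cmult_right)
definition norm_pseries :: "('a, 'b) pseries \<Rightarrow> real" where
  "norm_pseries c = (\<Sum>\<^sub>\<infinity>\<alpha>. norm (coeff c \<alpha>))"
definition sgn_pseries :: "('a, 'b) pseries \<Rightarrow> ('a, 'b) pseries" where
  "sgn_pseries c = scaleR (inverse (norm c)) c"
definition dist_pseries :: "('a, 'b) pseries \<Rightarrow> ('a, 'b) pseries \<Rightarrow> real" where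
  "dist_pseries c d = norm (c - d)"
definition uniformity_pseries :: "(('a, 'b) pseries \<times> ('a, 'b) pseries) filter" where
  "uniformity_pseries = (INF e\<in>{0<..}. principal {(x, y). dist x y < e})"
definition open_pseries :: "('a, 'b) pseries set \<Rightarrow> bool" where
  "open_pseries U = (\<forall>x\<in>U. eventually (\<lambda>(x', y). x' = x \<longrightarrow> y \<in> U) uniformity)"

instance
proof
  fix x y z :: "('a, 'b) pseries" and r s :: real
  show "x + y + z = x + (y + z)" by transfer (simp add: add.assoc)
  show "x + y = y + x" by transfer (simp add: add.commute)
  show "0 + x = x" by transfer simp
  show "- x + x = 0" by transfer simp
  show "x - y = x + - y" by transfer simp
  show "r *\<^sub>R (x + y) = r *\<^sub>R x + r *\<^sub>R y" by transfer (simp add: scaleR_add_right)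
  show "(r + s) *\<^sub>R x = r *\<^sub>R x + s *\<^sub>R x" by transfer (simp add: scaleR_add_left)
  show "r *\<^sub>R s *\<^sub>R x = (r * s) *\<^sub>R x" by transfer simp
  show "1 *\<^sub>R x = x" by transfer simp
  show "sgn x = scaleR (inverse (norm x)) x" by (rule sgn_pseries_def)
  show "dist x y = norm (x - y)" by (rule dist_pseries_def)
  show "uniformity = (INF e\<in>{0<..}. principal {(x, y :: ('a, 'b) pseries). dist x y < e})"
    by (rule uniformity_pseries_def)
  show "open U = (\<forall>x\<in>U. \<forall>\<^sub>F (x', y) in uniformity. x' = x \<longrightarrow> y \<in> U)" for U :: "('a, 'b) pseries set"
    by (rule open_pseries_def)
  show "norm x = 0 \<longleftrightarrow> x = 0"
  proof
    assume "norm x = 0"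
    then have "norm (coeff x \<alpha>) = 0" for \<alpha>
      unfolding norm_pseries_def
      by (intro nonneg_infsum_le_0D[OF _ coeff_abs_summable]) auto
    then show "x = 0" by transfer auto
  qed (simp add: norm_pseries_def zero_pseries.rep_eq)
  show "norm (x + y) \<le> norm x + norm y"
    unfolding norm_pseries_def plus_pseries.rep_eq
    by (subst infsum_add[symmetric])
      (auto intro!: infsum_mono coeff_abs_summable summable_on_add abs_summable_add_fun norm_triangle_ineq)
  show "norm (r *\<^sub>R x) = \<bar>r\<bar> * norm x"
    unfolding norm_pseries_def scaleR_pseries.rep_eq
    by (simp add: infsum_cmult_right[OF coeff_abs_summable])
qed

end

lemma norm_coeff_le: "norm (coeff c \<alpha>) \<le> norm c"
  unfolding norm_pseries_def
  using finite_sum_le_infsum[OF coeff_abs_summable, of "{\<alpha>}" c] by simp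

lemma sum_norm_coeff_le: "finite F \<Longrightarrow> (\<Sum>\<alpha>\<in>F. norm (coeff c \<alpha>)) \<le> norm c"
  unfolding norm_pseries_def
  by (rule finite_sum_le_infsum[OF coeff_abs_summable]) auto

lemma coeff_Abs:
  "(\<lambda>\<alpha>. norm (c \<alpha>)) summable_on UNIV \<Longrightarrow> coeff (Abs_pseries c) = c"
  by (simp add: Abs_pseries_inverse)

lemma norm_Abs_pseries_le:
  assumes "\<And>F. finite F \<Longrightarrow> (\<Sum>\<alpha>\<in>F. norm (c \<alpha>)) \<le> B"
  shows "(\<lambda>\<alpha>. norm (c \<alpha>)) summable_on UNIV" "norm (Abs_pseries c) \<le> B"
proof -
  show s: "(\<lambda>\<alpha>. norm (c \<alpha>)) summable_on UNIV"
    by (rule nonneg_bdd_above_summable_on) (auto intro!: bdd_aboveI2[of _ _ B] assms)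
  show "norm (Abs_pseries c) \<le> B"
    unfolding norm_pseries_def coeff_Abs[OF s]
    by (rule infsum_le_finite_sums[OF s]) (auto intro: assms)
qed

instance pseries :: (type, banach) banach
proof
  fix X :: "nat \<Rightarrow> ('a, 'b) pseries"
  assume X: "Cauchy X"
  have "Cauchy (\<lambda>n. coeff (X n) \<alpha>)" for \<alpha>
  proof (rule metric_CauchyI)
    fix e :: real assume "e > 0"
    then obtain N where N: "\<And>m n. m \<ge> N \<Longrightarrow> n \<ge> N \<Longrightarrow> dist (X m) (X n) < e"
      using X unfolding Cauchy_def by blast
    have "dist (coeff (X m) \<alpha>) (coeff (X n) \<alpha>) \<le> dist (X m) (X n)" for m n
      using norm_coeff_le[of "X m - X n" \<alpha>] by (simp add: dist_norm minus_pseries.rep_eq)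
    then show "\<exists>N. \<forall>m\<ge>N. \<forall>n\<ge>N. dist (coeff (X m) \<alpha>) (coeff (X n) \<alpha>) < e"
      using N le_less_trans by blast
  qed
  then have "\<forall>\<alpha>. \<exists>l. (\<lambda>n. coeff (X n) \<alpha>) \<longlonglongrightarrow> l"
    by (simp add: Cauchy_convergent_iff convergent_def)
  then obtain c where c: "\<And>\<alpha>. (\<lambda>n. coeff (X n) \<alpha>) \<longlonglongrightarrow> c \<alpha>" by metis
  have near: "(\<Sum>\<alpha>\<in>F. norm (coeff (X m) \<alpha> - c \<alpha>)) \<le> e"
    if "finite F" "\<And>n. n \<ge> N \<Longrightarrow> norm (X m - X n) \<le> e" for F e m N
  proof (rule LIMSEQ_le_const2)
    show "(\<lambda>n. \<Sum>\<alpha>\<in>F. norm (coeff (X m) \<alpha> - coeff (X n) \<alpha>))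
        \<longlonglongrightarrow> (\<Sum>\<alpha>\<in>F. norm (coeff (X m) \<alpha> - c \<alpha>))"
      by (intro tendsto_intros c)
    have "(\<Sum>\<alpha>\<in>F. norm (coeff (X m) \<alpha> - coeff (X n) \<alpha>)) \<le> e" if "n \<ge> N" for n
      using sum_norm_coeff_le[OF \<open>finite F\<close>, of "X m - X n"] \<open>\<And>n. n \<ge> N \<Longrightarrow> _\<close>[OF that]
      by (simp add: minus_pseries.rep_eq)
    then show "\<exists>N. \<forall>n\<ge>N. (\<Sum>\<alpha>\<in>F. norm (coeff (X m) \<alpha> - coeff (X n) \<alpha>)) \<le> e"
      by blast
  qed
  have cau: "\<exists>N. \<forall>m\<ge>N. \<forall>n\<ge>N. norm (X m - X n) \<le> e" if "e > 0" for e
    using X that unfolding Cauchy_def dist_norm by (meson less_imp_le)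
  obtain N where "\<And>m n. m \<ge> N \<Longrightarrow> n \<ge> N \<Longrightarrow> norm (X m - X n) \<le> 1" using cau[of 1] by auto
  then have diff: "(\<lambda>\<alpha>. norm (coeff (X N) \<alpha> - c \<alpha>)) summable_on UNIV"
    using norm_Abs_pseries_le(1)[of "\<lambda>\<alpha>. coeff (X N) \<alpha> - c \<alpha>" 1] near[of _ N N 1] by auto
  then have csum: "(\<lambda>\<alpha>. norm (c \<alpha>)) summable_on UNIV"
    using abs_summable_add_fun[OF _ coeff_abs_summable[of "X N"], of "\<lambda>\<alpha>. c \<alpha> - coeff (X N) \<alpha>"]
    by (simp add: norm_minus_commute)
  have "X \<longlonglongrightarrow> Abs_pseries c"
  proof (rule metric_LIMSEQ_I)
    fix e :: real assume "e > 0"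
    then obtain N where N: "\<And>m n. m \<ge> N \<Longrightarrow> n \<ge> N \<Longrightarrow> norm (X m - X n) \<le> e / 2"
      using cau[of "e/2"] by auto
    have "norm (X m - Abs_pseries c) \<le> e / 2" if "m \<ge> N" for m
    proof -
      have "X m - Abs_pseries c = Abs_pseries (\<lambda>\<alpha>. coeff (X m) \<alpha> - c \<alpha>)"
        by (subst coeff_inverse[symmetric]) (simp add: minus_pseries.rep_eq coeff_Abs[OF csum])
      moreover have "norm (Abs_pseries (\<lambda>\<alpha>. coeff (X m) \<alpha> - c \<alpha>)) \<le> e/2"
        by (rule norm_Abs_pseries_le(2)) (use near[of _ N m "e/2"] N that in auto)
      ultimately show ?thesis by simp
    qed
    then show "\<exists>N. \<forall>n\<ge>N. dist (X n) (Abs_pseries c) < e"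
      unfolding dist_norm using \<open>e > 0\<close> by (intro exI[of _ N]) (smt (verit) field_sum_of_halves)
  qed
  then show "convergent X" by (auto simp: convergent_def)
qed

subsection \<open>Cauchy products\<close>

lemma finite_multiindex_le: "finite {..\<gamma> :: 'i::finite \<Rightarrow> nat}"
proof -
  have "{..\<gamma>} \<subseteq> PiE UNIV (\<lambda>i. {..\<gamma> i})" by (auto simp: le_fun_def PiE_def)
  then show ?thesis by (rule finite_subset) (simp add: finite_PiE)
qed

lemma multiindex_add_diff: "(\<lambda>i. \<alpha> i + \<beta> i) - \<alpha> = (\<beta> :: 'i \<Rightarrow> nat)"
  by (simp add: fun_eq_iff)

text \<open>The double series converges absolutely, hence may be summed along the sets \<open>\<alpha> + \<beta> = \<gamma>\<close>. Applied to the norms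
it bounds the norm of a product, and applied to the terms it evaluates a product at a point.\<close>

lemma has_sum_cauchy_product:
  fixes c :: "('i::finite \<Rightarrow> nat) \<Rightarrow> 'a::banach" and d :: "('i \<Rightarrow> nat) \<Rightarrow> 'b::banach"
    and f :: "'a \<Rightarrow> 'b \<Rightarrow> 'c::banach"
  assumes "bounded_bilinear f"
    and c: "(\<lambda>\<alpha>. norm (c \<alpha>)) summable_on UNIV" and d: "(\<lambda>\<alpha>. norm (d \<alpha>)) summable_on UNIV"
  shows "((\<lambda>\<gamma>. \<Sum>\<alpha>\<in>{..\<gamma>}. f (c \<alpha>) (d (\<gamma> - \<alpha>))) has_sum f (infsum c UNIV) (infsum d UNIV)) UNIV"
proof -
  interpret bounded_bilinear f by fact
  obtain K where K: "K \<ge> 0" "\<And>x y. norm (f x y) \<le> norm x * norm y * K"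
    using nonneg_bounded by blast
  have inner: "((\<lambda>\<beta>. f (c \<alpha>) (d \<beta>)) has_sum f (c \<alpha>) (infsum d UNIV)) UNIV" for \<alpha>
    by (rule has_sum_bounded_linear[OF bounded_linear_right])
      (use abs_summable_summable[OF d] in simp)
  have outer: "((\<lambda>\<alpha>. f (c \<alpha>) (infsum d UNIV)) has_sum f (infsum c UNIV) (infsum d UNIV)) UNIV"
    by (rule has_sum_bounded_linear[OF bounded_linear_left])
      (use abs_summable_summable[OF c] in simp)
  have "(\<lambda>x. norm (case x of (\<alpha>, \<beta>) \<Rightarrow> norm (c \<alpha>) * norm (d \<beta>))) summable_on UNIV \<times> UNIV"
    using Infinite_Sum.abs_summable_on_Sigma_iff[where f = "\<lambda>(\<alpha>, \<beta>). norm (c \<alpha>) * norm (d \<beta>)" and A = UNIV and B = "\<lambda>_. UNIV"]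
    by (simp add: infsum_cmult_right[OF d] summable_on_cmult_right[OF d] summable_on_cmult_left[OF c]
        infsum_nonneg)
  then have "(\<lambda>x. K * (case x of (\<alpha>, \<beta>) \<Rightarrow> norm (c \<alpha>) * norm (d \<beta>))) summable_on UNIV \<times> UNIV"
    by (rule summable_on_cmult_right[OF abs_summable_summable])
  then have "(\<lambda>x. norm (case x of (\<alpha>, \<beta>) \<Rightarrow> f (c \<alpha>) (d \<beta>))) summable_on UNIV \<times> UNIV"
    by (rule summable_on_comparison_test) (use K(2) in \<open>auto simp: algebra_simps\<close>)
  then have "(\<lambda>(\<alpha>, \<beta>). f (c \<alpha>) (d \<beta>)) summable_on UNIV \<times> UNIV"
    by (rule abs_summable_summable)
  then have "((\<lambda>(\<alpha>, \<beta>). f (c \<alpha>) (d \<beta>)) has_sum f (infsum c UNIV) (infsum d UNIV)) (UNIV \<times> UNIV)"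
    using inner outer by (intro has_sum_SigmaI) auto
  also have "?this \<longleftrightarrow> ((\<lambda>(\<gamma>, \<alpha>). f (c \<alpha>) (d (\<gamma> - \<alpha>))) has_sum f (infsum c UNIV) (infsum d UNIV))
      (Sigma UNIV (\<lambda>\<gamma>. {..\<gamma>}))"
    by (rule has_sum_reindex_bij_witness[of _ "\<lambda>(\<gamma>, \<alpha>). (\<alpha>, \<gamma> - \<alpha>)" "\<lambda>(\<alpha>, \<beta>). (\<lambda>i. \<alpha> i + \<beta> i, \<alpha>)"])
      (auto simp: le_fun_def fun_eq_iff multiindex_add_diff)
  finally show ?thesis
    by (rule has_sum_SigmaD) (auto simp: finite_multiindex_le)
qed

definition cauchy_product ::
    "('a \<Rightarrow> 'b \<Rightarrow> 'c) \<Rightarrow> ('i::finite, 'a::banach) pseries \<Rightarrow> ('i, 'b::banach) pseries \<Rightarrow>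
     ('i, 'c::banach) pseries" where
  "cauchy_product f c d = Abs_pseries (\<lambda>\<gamma>. \<Sum>\<alpha>\<in>{..\<gamma>}. f (coeff c \<alpha>) (coeff d (\<gamma> - \<alpha>)))"

lemma
  fixes f :: "'a::banach \<Rightarrow> 'b::banach \<Rightarrow> 'c::banach"
  assumes K: "K \<ge> 0" "\<And>x y. norm (f x y) \<le> K * norm x * norm y"
  shows coeff_cauchy_product:
      "coeff (cauchy_product f c d) \<gamma> = (\<Sum>\<alpha>\<in>{..\<gamma>}. f (coeff c \<alpha>) (coeff d (\<gamma> - \<alpha>)))"
    and norm_cauchy_product_le: "norm (cauchy_product f c d) \<le> K * norm c * norm d"
proof -
  have hs: "((\<lambda>\<gamma>. \<Sum>\<alpha>\<in>{..\<gamma>}. norm (coeff c \<alpha>) * norm (coeff d (\<gamma> - \<alpha>))) has_sum norm c * norm d) UNIV"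
    unfolding norm_pseries_def
    by (rule has_sum_cauchy_product[OF bounded_bilinear_mult]) (auto simp: coeff_abs_summable)
  have hsK: "((\<lambda>\<gamma>. K * (\<Sum>\<alpha>\<in>{..\<gamma>}. norm (coeff c \<alpha>) * norm (coeff d (\<gamma> - \<alpha>)))) has_sum
      K * norm c * norm d) UNIV"
    using has_sum_cmult_right[OF hs, of K] by (simp add: mult.assoc)
  have le: "norm (\<Sum>\<alpha>\<in>{..\<gamma>}. f (coeff c \<alpha>) (coeff d (\<gamma> - \<alpha>)))
      \<le> K * (\<Sum>\<alpha>\<in>{..\<gamma>}. norm (coeff c \<alpha>) * norm (coeff d (\<gamma> - \<alpha>)))" for \<gamma>
    unfolding sum_distrib_left by (rule sum_norm_le) (use K in \<open>auto simp: mult.assoc\<close>)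
  have s: "(\<lambda>\<gamma>. norm (\<Sum>\<alpha>\<in>{..\<gamma>}. f (coeff c \<alpha>) (coeff d (\<gamma> - \<alpha>)))) summable_on UNIV"
    by (rule summable_on_comparison_test[OF has_sum_imp_summable[OF hsK]]) (use le in auto)
  show "coeff (cauchy_product f c d) \<gamma> = (\<Sum>\<alpha>\<in>{..\<gamma>}. f (coeff c \<alpha>) (coeff d (\<gamma> - \<alpha>)))"
    unfolding cauchy_product_def coeff_Abs[OF s] ..
  show "norm (cauchy_product f c d) \<le> K * norm c * norm d"
    unfolding cauchy_product_def norm_pseries_def[of "Abs_pseries _"] coeff_Abs[OF s]
    by (rule has_sum_mono[OF has_sum_infsum[OF s] hsK]) (rule le)
qed

lemma bounded_bilinear_normE:
  assumes "bounded_bilinear f"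
  obtains K where "K \<ge> 0" "\<And>x y. norm (f x y) \<le> K * norm x * norm y"
proof -
  obtain K where "K \<ge> 0" "\<And>x y. norm (f x y) \<le> norm x * norm y * K"
    using bounded_bilinear.nonneg_bounded[OF assms] by blast
  then show ?thesis by (intro that[of K]) (auto simp: algebra_simps)
qed

lemma bounded_bilinear_cauchy_product:
  fixes f :: "'a::banach \<Rightarrow> 'b::banach \<Rightarrow> 'c::banach"
  assumes f: "bounded_bilinear f"
  shows "bounded_bilinear (cauchy_product f :: ('i::finite, 'a) pseries \<Rightarrow> _)"
proof -
  interpret bounded_bilinear f by fact
  obtain K where K: "K \<ge> 0" "\<And>x y. norm (f x y) \<le> K * norm x * norm y"
    using bounded_bilinear_normE[OF f] by blast
  note cf = coeff_cauchy_product[where f = f, OF K]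
  show ?thesis
  proof
    show "cauchy_product f (a + a') b = cauchy_product f a b + cauchy_product f a' b" for a a' b
      by (rule coeff_inject[THEN iffD1])
        (simp add: fun_eq_iff cf plus_pseries.rep_eq add_left sum.distrib)
    show "cauchy_product f a (b + b') = cauchy_product f a b + cauchy_product f a b'" for a b b'
      by (rule coeff_inject[THEN iffD1])
        (simp add: fun_eq_iff cf plus_pseries.rep_eq add_right sum.distrib)
    show "cauchy_product f (r *\<^sub>R a) b = r *\<^sub>R cauchy_product f a b" for r a b
      by (rule coeff_inject[THEN iffD1])
        (simp add: fun_eq_iff cf scaleR_pseries.rep_eq scaleR_left scaleR_sum_right)
    show "cauchy_product f a (r *\<^sub>R b) = r *\<^sub>R cauchy_product f a b" for r a b
      by (rule coeff_inject[THEN iffD1])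
        (simp add: fun_eq_iff cf scaleR_pseries.rep_eq scaleR_right scaleR_sum_right)
    show "\<exists>K. \<forall>a b. norm (cauchy_product f a b) \<le> norm a * norm b * K"
      using norm_cauchy_product_le[where f = f, OF K] by (metis mult.assoc mult.commute)
  qed
qed

subsection \<open>Evaluation on the unit cube\<close>

definition monom_at :: "real^'n \<Rightarrow> ('n \<Rightarrow> nat) \<Rightarrow> real" where
  "monom_at s \<alpha> = (\<Prod>i\<in>UNIV. (s $ i) ^ \<alpha> i)"

abbreviation unit_cube :: "(real^'n) set" where
  "unit_cube \<equiv> {s. \<forall>i. \<bar>s $ i\<bar> \<le> 1}"

lemma abs_monom_at_le: "s \<in> unit_cube \<Longrightarrow> \<bar>monom_at s \<alpha>\<bar> \<le> 1"
  unfolding monom_at_def abs_prod by (intro prod_le_1) (auto simp: power_abs power_le_one)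

lemma monom_at_add: "monom_at s (\<lambda>i. \<alpha> i + \<beta> i) = monom_at s \<alpha> * monom_at s \<beta>"
  by (simp add: monom_at_def power_add prod.distrib)

lemma monom_at_diff: "\<alpha> \<le> \<gamma> \<Longrightarrow> monom_at s \<gamma> = monom_at s \<alpha> * monom_at s (\<gamma> - \<alpha>)"
  unfolding monom_at_add[symmetric] by (simp add: le_fun_def)

lemma monom_at_scaleR: "monom_at (t *\<^sub>R s) \<alpha> = t ^ (\<Sum>i\<in>UNIV. \<alpha> i) * monom_at s \<alpha>"
  by (simp add: monom_at_def power_mult_distrib prod.distrib power_sum)

definition peval :: "('n::finite, 'a::banach) pseries \<Rightarrow> real^'n \<Rightarrow> 'a" where
  "peval c s = (\<Sum>\<^sub>\<infinity>\<alpha>. monom_at s \<alpha> *\<^sub>R coeff c \<alpha>)"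

lemma peval_abs_summable:
  "s \<in> unit_cube \<Longrightarrow> (\<lambda>\<alpha>. norm (monom_at s \<alpha> *\<^sub>R coeff c \<alpha>)) summable_on UNIV"
  by (rule summable_on_comparison_test[OF coeff_abs_summable[of c]])
    (use abs_monom_at_le in \<open>auto intro!: mult_left_le_one_le\<close>)

lemma peval_has_sum:
  "s \<in> unit_cube \<Longrightarrow> ((\<lambda>\<alpha>. monom_at s \<alpha> *\<^sub>R coeff c \<alpha>) has_sum peval c s) UNIV"
  unfolding peval_def by (rule has_sum_infsum[OF abs_summable_summable[OF peval_abs_summable]])

lemma peval_add: "s \<in> unit_cube \<Longrightarrow> peval (c + d) s = peval c s + peval d s"
  using has_sum_add[OF peval_has_sum[of s c] peval_has_sum[of s d]] peval_has_sum[of s "c + d"]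
  by (simp add: plus_pseries.rep_eq scaleR_add_right has_sum_unique)

lemma peval_cauchy_product:
  assumes f: "bounded_bilinear f" and s: "s \<in> unit_cube"
  shows "peval (cauchy_product f c d) s = f (peval c s) (peval d s)"
proof -
  interpret bounded_bilinear f by fact
  obtain K where K: "K \<ge> 0" "\<And>x y. norm (f x y) \<le> K * norm x * norm y"
    using bounded_bilinear_normE[OF f] by blast
  have eq: "(\<Sum>\<alpha>\<in>{..\<gamma>}. f (monom_at s \<alpha> *\<^sub>R coeff c \<alpha>) (monom_at s (\<gamma> - \<alpha>) *\<^sub>R coeff d (\<gamma> - \<alpha>)))
      = monom_at s \<gamma> *\<^sub>R coeff (cauchy_product f c d) \<gamma>" for \<gamma>
    unfolding coeff_cauchy_product[where f = f, OF K] scaleR_sum_right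
    by (rule sum.cong) (auto simp: scaleR_left scaleR_right monom_at_diff[of _ \<gamma>])
  show ?thesis
    using has_sum_cauchy_product[OF f peval_abs_summable[OF s] peval_abs_summable[OF s], of c d]
      has_sum_unique[OF peval_has_sum[OF s]]
    unfolding eq peval_def[symmetric] by blast
qed

lemma norm_peval_le: "s \<in> unit_cube \<Longrightarrow> norm (peval c s) \<le> norm c"
  unfolding peval_def norm_pseries_def
  by (rule order_trans[OF norm_infsum_bound[OF peval_abs_summable] infsum_mono[OF peval_abs_summable coeff_abs_summable]])
    (use abs_monom_at_le in \<open>auto intro!: mult_left_le_one_le\<close>)

lemma has_sum_single:
  fixes x :: "'a::{comm_monoid_add,topological_space}"
  shows "((\<lambda>\<alpha>. if \<alpha> = k then x else 0) has_sum x) UNIV"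
  by (rule has_sum_finite_neutralI[where B = "{k}"]) auto

lemma sum_norm_single_le:
  "finite F \<Longrightarrow> (\<Sum>\<alpha>\<in>F. norm (if \<alpha> = k then x else 0 :: 'a::real_normed_vector)) \<le> norm x"
  by (simp add: if_distrib[of norm] sum.delta' cong: if_cong)

lift_definition pmonom :: "('i \<Rightarrow> nat) \<Rightarrow> 'a \<Rightarrow> ('i, 'a::real_normed_vector) pseries"
  is "\<lambda>k x \<alpha>. if \<alpha> = k then x else 0"
  by (rule norm_Abs_pseries_le(1)[OF sum_norm_single_le])

lemma peval_pmonom: "peval (pmonom k x) s = monom_at s k *\<^sub>R x"
  unfolding peval_def pmonom.rep_eq
  by (rule infsumI) (use has_sum_single[of k "monom_at s k *\<^sub>R x"] in \<open>auto elim!: has_sum_cong[THEN iffD1, rotated]\<close>)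

text \<open>The substitution \<open>s \<mapsto> t s\<close>. The factor is clipped to \<open>[0, 1]\<close> so that the result is summable for
every real \<open>t\<close>.\<close>

lift_definition prescale :: "real \<Rightarrow> ('i::finite, 'a) pseries \<Rightarrow> ('i, 'a::real_normed_vector) pseries"
  is "\<lambda>t c \<alpha>. (max 0 (min 1 t)) ^ (\<Sum>i\<in>UNIV. \<alpha> i) *\<^sub>R c \<alpha>"
  by (rule summable_on_comparison_test, assumption) (auto intro!: mult_left_le_one_le power_le_one)

lemma coeff_prescale:
  "0 \<le> t \<Longrightarrow> t \<le> 1 \<Longrightarrow> coeff (prescale t c) \<alpha> = t ^ (\<Sum>i\<in>UNIV. \<alpha> i) *\<^sub>R coeff c \<alpha>"
  by (simp add: prescale.rep_eq)

lemma peval_prescale: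
  "0 \<le> t \<Longrightarrow> t \<le> 1 \<Longrightarrow> peval (prescale t c) s = peval c (t *\<^sub>R s)"
  by (simp add: peval_def coeff_prescale monom_at_scaleR mult.commute)

lemma norm_prescale_le:
  fixes c :: "('i::finite, 'a::real_normed_vector) pseries"
  assumes "0 \<le> t" "t \<le> 1"
  shows "norm (prescale t c) \<le> norm c"
  unfolding norm_pseries_def
  by (rule infsum_mono[OF coeff_abs_summable coeff_abs_summable])
    (use assms in \<open>auto simp: coeff_prescale intro!: mult_left_le_one_le power_le_one\<close>)

text \<open>Passing to a smaller radius makes a series without constant term small. This is the source of smallness in
the contraction argument.\<close>

lemma norm_prescale_le':
  fixes c :: "('i::finite, 'a::real_normed_vector) pseries"
  assumes "0 \<le> t" "t \<le> 1" "coeff c (\<lambda>_. 0) = 0"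
  shows "norm (prescale t c) \<le> t * norm c"
  unfolding norm_pseries_def infsum_cmult_right[OF coeff_abs_summable, symmetric]
proof (rule infsum_mono[OF coeff_abs_summable summable_on_cmult_right[OF coeff_abs_summable]])
  fix \<alpha> :: "'i \<Rightarrow> nat"
  show "norm (coeff (prescale t c) \<alpha>) \<le> t * norm (coeff c \<alpha>)"
  proof (cases "\<alpha> = (\<lambda>_. 0)")
    case False
    then have "(\<Sum>i\<in>UNIV. \<alpha> i) \<ge> 1" by (auto simp: fun_eq_iff Suc_le_eq sum_eq_0_iff neq0_conv[symmetric] simp del: neq0_conv)
    then have "t ^ (\<Sum>i\<in>UNIV. \<alpha> i) \<le> t ^ 1" using assms by (intro power_decreasing) auto
    then show ?thesis using assms by (simp add: coeff_prescale mult_right_mono)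
  qed (use assms in \<open>simp add: coeff_prescale\<close>)
qed

lemma peval_0: "peval (c :: ('n::finite, 'a::banach) pseries) 0 = coeff c (\<lambda>_. 0)"
proof -
  have "monom_at (0::real^'n) \<alpha> = (if \<alpha> = (\<lambda>_. 0) then 1 else 0)" for \<alpha>
    by (auto simp: monom_at_def fun_eq_iff power_0_left)
  then show ?thesis
    unfolding peval_def
    by (intro infsumI has_sum_finite_neutralI[of "{\<lambda>_. 0}"]) auto
qed

section \<open>Germs of analytic maps into a Banach space\<close>

text \<open>A Banach space valued version of local analyticity, with the cube of side \<open>2 r\<close> around \<open>x\<close> scaled to the unit
cube.\<close>

definition analytic_germ :: "(real^'n \<Rightarrow> 'a::banach) \<Rightarrow> real^'n \<Rightarrow> bool" where
  "analytic_germ f x \<longleftrightarrow>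
     (\<exists>r>0. \<exists>c. \<forall>s\<in>unit_cube. f (x + r *\<^sub>R s) = peval c s)"

text \<open>Two germs are combined on the smaller of their cubes; therefore the elimination rule offers every smaller
radius \<open>t\<close> as well.\<close>

lemma analytic_germE:
  fixes f :: "real^'n \<Rightarrow> 'a::banach"
  assumes "analytic_germ f x"
  obtains r c where "r > 0"
    "\<And>t s. 0 \<le> t \<Longrightarrow> t \<le> r \<Longrightarrow> s \<in> unit_cube \<Longrightarrow> f (x + t *\<^sub>R s) = peval (prescale (t / r) c) s"
proof -
  obtain r c where r: "r > 0" "\<And>s. s \<in> unit_cube \<Longrightarrow> f (x + r *\<^sub>R s) = peval c s"
    using assms by (auto simp: analytic_germ_def)
  show ?thesis
  proof (rule that[OF r(1)])
    fix t and s :: "real^'n" assume "0 \<le> t" "t \<le> r" and s: "s \<in> unit_cube"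
    then have t: "0 \<le> t / r" "t / r \<le> 1" using r by auto
    then have "(t / r) *\<^sub>R s \<in> unit_cube"
      using s mult_le_one[of "\<bar>t / r\<bar>" "\<bar>s $ i\<bar>" for i] by (auto simp: abs_mult)
    from r(2)[OF this] show "f (x + t *\<^sub>R s) = peval (prescale (t / r) c) s"
      using r(1) t by (simp add: peval_prescale)
  qed
qed

lemma analytic_germI:
  "r > 0 \<Longrightarrow> (\<And>s. s \<in> unit_cube \<Longrightarrow> f (x + r *\<^sub>R s) = peval c s) \<Longrightarrow> analytic_germ f x"
  by (auto simp: analytic_germ_def)

lemma analytic_germ_const: "analytic_germ (\<lambda>_. a) x"
  by (rule analytic_germI[of 1 _ _ "pmonom (\<lambda>_. 0) a"]) (auto simp: peval_pmonom monom_at_def)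

lemma analytic_germ_add:
  assumes "analytic_germ f x" "analytic_germ g x"
  shows "analytic_germ (\<lambda>y. f y + g y) x"
proof -
  obtain r c where r: "r > 0"
    "\<And>t s. 0 \<le> t \<Longrightarrow> t \<le> r \<Longrightarrow> s \<in> unit_cube \<Longrightarrow> f (x + t *\<^sub>R s) = peval (prescale (t / r) c) s"
    using analytic_germE[OF assms(1)] by blast
  obtain r' c' where r': "r' > 0"
    "\<And>t s. 0 \<le> t \<Longrightarrow> t \<le> r' \<Longrightarrow> s \<in> unit_cube \<Longrightarrow> g (x + t *\<^sub>R s) = peval (prescale (t / r') c') s"
    using analytic_germE[OF assms(2)] by blast
  define t where "t = min r r'"
  have "t > 0" "t \<le> r" "t \<le> r'" using r r' by (auto simp: t_def)
  then show ?thesis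
    by (intro analytic_germI[of t _ _ "prescale (t / r) c + prescale (t / r') c'"])
      (auto simp: r r' peval_add)
qed

lemma analytic_germ_bilinear:
  assumes "bounded_bilinear B" "analytic_germ f x" "analytic_germ g x"
  shows "analytic_germ (\<lambda>y. B (f y) (g y)) x"
proof -
  obtain r c where r: "r > 0"
    "\<And>t s. 0 \<le> t \<Longrightarrow> t \<le> r \<Longrightarrow> s \<in> unit_cube \<Longrightarrow> f (x + t *\<^sub>R s) = peval (prescale (t / r) c) s"
    using analytic_germE[OF assms(2)] by blast
  obtain r' c' where r': "r' > 0"
    "\<And>t s. 0 \<le> t \<Longrightarrow> t \<le> r' \<Longrightarrow> s \<in> unit_cube \<Longrightarrow> g (x + t *\<^sub>R s) = peval (prescale (t / r') c') s"
    using analytic_germE[OF assms(3)] by blast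
  define t where "t = min r r'"
  have "t > 0" "t \<le> r" "t \<le> r'" using r r' by (auto simp: t_def)
  then show ?thesis
    by (intro analytic_germI[of t _ _ "cauchy_product B (prescale (t / r) c) (prescale (t / r') c')"])
      (auto simp: r r' peval_cauchy_product assms(1))
qed

lemma analytic_germ_linear:
  assumes "bounded_linear L" "analytic_germ f x"
  shows "analytic_germ (\<lambda>y. L (f y)) x"
proof -
  have "bounded_bilinear (\<lambda>(r::real) a. r *\<^sub>R L a)"
    using bounded_bilinear.comp[OF bounded_bilinear_scaleR bounded_linear_ident assms(1)] .
  from analytic_germ_bilinear[OF this analytic_germ_const[of 1] assms(2)] show ?thesis by simp
qed

lemma analytic_germ_sum:
  "(\<And>i. i \<in> I \<Longrightarrow> analytic_germ (f i) x) \<Longrightarrow> analytic_germ (\<lambda>y. \<Sum>i\<in>I. f i y) x"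
  by (induction I rule: infinite_finite_induct) (auto intro: analytic_germ_const analytic_germ_add)

lemma analytic_germ_nth: "analytic_germ (\<lambda>y. y $ j) (x :: real^'n)"
proof -
  have "(x + s :: real^'n) $ j = peval (pmonom (\<lambda>_. 0) (x $ j) + pmonom (\<lambda>i. if i = j then 1 else 0) 1) s"
    if "s \<in> unit_cube" for s :: "real^'n"
    using that by (simp add: peval_add peval_pmonom monom_at_def if_distrib[of "\<lambda>n. _ ^ n"] cong: if_cong)
  then show ?thesis by (intro analytic_germI[of 1]) auto
qed

lemma analytic_germ_minus: "analytic_germ f x \<Longrightarrow> analytic_germ (\<lambda>y. - f y) x"
  by (rule analytic_germ_linear[OF bounded_linear_minus[OF bounded_linear_ident]])

lemma analytic_germ_diff:
  "analytic_germ f x \<Longrightarrow> analytic_germ g x \<Longrightarrow> analytic_germ (\<lambda>y. f y - g y) x"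
  using analytic_germ_add[OF _ analytic_germ_minus] by fastforce

lemma unit_cubeI_norm: "norm s \<le> 1 \<Longrightarrow> s \<in> unit_cube"
  using component_le_norm_cart order_trans by blast

lemma unit_cubeI_scaled:
  assumes "r > 0" "norm v \<le> r"
  shows "v /\<^sub>R r \<in> unit_cube"
proof (rule unit_cubeI_norm)
  have "norm (v /\<^sub>R r) = norm v / r" using assms(1) by (simp add: divide_inverse mult.commute)
  then show "norm (v /\<^sub>R r) \<le> 1" using assms by simp
qed

lemma analytic_germ_cong:
  fixes f :: "real^'n \<Rightarrow> 'a::banach"
  assumes "analytic_germ f x" "e > 0" "\<And>y. norm (y - x) < e \<Longrightarrow> f y = g y"
  shows "analytic_germ g x"
proof -
  obtain r c where r: "r > 0"
    "\<And>t s. 0 \<le> t \<Longrightarrow> t \<le> r \<Longrightarrow> s \<in> unit_cube \<Longrightarrow> f (x + t *\<^sub>R s) = peval (prescale (t / r) c) s"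
    using analytic_germE[OF assms(1)] by blast
  define t where "t = min r (e / (2 * CARD('n)))"
  have card: "real CARD('n) > 0" by simp
  have t: "0 < t" "t \<le> r" "t * CARD('n) < e"
    using r(1) assms(2) card
      mult_right_mono[of t "e / (2 * CARD('n))" "real CARD('n)"] by (auto simp: t_def)
  have "norm (t *\<^sub>R s) < e" if "s \<in> unit_cube" for s :: "real^'n"
  proof -
    have "norm s \<le> (\<Sum>i\<in>UNIV. \<bar>s $ i\<bar>)" by (rule norm_le_l1_cart)
    also have "\<dots> \<le> CARD('n)" using that sum_bounded_above[of UNIV "\<lambda>i. \<bar>s $ i\<bar>" 1] by simp
    finally have "t * norm s \<le> t * CARD('n)" using t by (intro mult_left_mono) auto
    then have "t * norm s < e" using t(3) by (rule le_less_trans)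
    then show ?thesis using t by simp
  qed
  then show ?thesis
    using t by (intro analytic_germI[of t _ _ "prescale (t / r) c"]) (auto simp: assms(3)[symmetric] r(2))
qed

lemma analytic_germ_tendsto:
  assumes "analytic_germ f x" "e > 0"
  shows "\<exists>d>0. \<forall>y. norm (y - x) < d \<longrightarrow> norm (f y - f x) < e"
proof -
  have "analytic_germ (\<lambda>y. f y - f x) x" by (intro analytic_germ_diff analytic_germ_const assms(1))
  then obtain r c where r: "r > 0"
    "\<And>t s. 0 \<le> t \<Longrightarrow> t \<le> r \<Longrightarrow> s \<in> unit_cube \<Longrightarrow> f (x + t *\<^sub>R s) - f x = peval (prescale (t / r) c) s"
    using analytic_germE by blast
  have c0: "coeff c (\<lambda>_. 0) = 0"
    using r(2)[of r 0] r(1) by (simp add: peval_0 coeff_prescale)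
  define t where "t = min r (r * e / (norm c + 1) / 2)"
  have nc: "norm c + 1 > 0" by (simp add: add_nonneg_pos)
  have t: "0 < t" "t \<le> r" using r(1) assms(2) nc by (auto simp: t_def)
  have "t / r * norm c < e"
  proof -
    have "t / r \<le> e / (norm c + 1) / 2"
      using r(1) by (simp add: t_def field_simps min_def)
    then have "t / r * norm c \<le> e / (norm c + 1) / 2 * norm c" by (rule mult_right_mono) simp
    also have "\<dots> < e"
    proof -
      have "norm c / (norm c + 1) < 2" using nc by (subst pos_divide_less_eq) (auto simp: add_nonneg_pos)
      then have "e * (norm c / (norm c + 1)) < e * 2" using assms(2) by (rule mult_strict_left_mono)
      then have "e * (norm c / (norm c + 1)) / 2 < e" by (rule pos_divide_less_eq[THEN iffD2, rotated]) simp
      moreover have "e / (norm c + 1) / 2 * norm c = e * (norm c / (norm c + 1)) / 2" by simp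
      ultimately show ?thesis by (simp only:)
    qed
    finally show ?thesis .
  qed
  moreover have "norm (f y - f x) \<le> t / r * norm c" if "norm (y - x) < t" for y
  proof -
    have s: "(y - x) /\<^sub>R t \<in> unit_cube" using t that by (intro unit_cubeI_scaled) auto
    have "f y - f x = peval (prescale (t / r) c) ((y - x) /\<^sub>R t)"
      using r(2)[OF less_imp_le[OF t(1)] t(2) s] t(1) by simp
    also have "norm \<dots> \<le> t / r * norm c"
      using norm_peval_le[OF s] norm_prescale_le'[OF _ _ c0, of "t / r"] t r(1)
      by (smt (verit) divide_le_eq_1_pos divide_nonneg_pos)
    finally show ?thesis .
  qed
  ultimately show ?thesis using t(1) by (meson le_less_trans)
qed

lemma real_analytic_at_if_germ:
  assumes "analytic_germ f x"
  shows "real_analytic_at f x"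
proof -
  obtain r c where r: "r > 0" "\<And>s. s \<in> unit_cube \<Longrightarrow> f (x + r *\<^sub>R s) = peval c s"
    using assms by (auto simp: analytic_germ_def)
  have "((\<lambda>\<alpha>. (coeff c \<alpha> / r ^ (\<Sum>i\<in>UNIV. \<alpha> i)) * (\<Prod>i\<in>UNIV. (y $ i - x $ i) ^ \<alpha> i)) has_sum f y) UNIV"
    if "y \<in> ball x r" for y
  proof -
    have s: "(y - x) /\<^sub>R r \<in> unit_cube"
      using r(1) that by (intro unit_cubeI_scaled) (auto simp: dist_norm norm_minus_commute)
    have "f y = peval c ((y - x) /\<^sub>R r)" using r(2)[OF s] r(1) by simp
    moreover have "monom_at ((y - x) /\<^sub>R r) \<alpha> *\<^sub>R coeff c \<alpha>
        = (coeff c \<alpha> / r ^ (\<Sum>i\<in>UNIV. \<alpha> i)) * (\<Prod>i\<in>UNIV. (y $ i - x $ i) ^ \<alpha> i)" for \<alpha>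
    proof -
      have "(inverse a * m) * k = k / a * m" for a m k :: real by (simp add: divide_inverse)
      then show ?thesis
        unfolding monom_at_scaleR unfolding power_inverse monom_at_def vector_minus_component real_scaleR_def .
    qed
    ultimately show ?thesis using peval_has_sum[OF s, of c] by (simp only:)
  qed
  then show ?thesis
    unfolding real_analytic_at_def
    by (intro exI[of _ r] conjI r(1) exI[of _ "\<lambda>\<alpha>. coeff c \<alpha> / r ^ (\<Sum>i\<in>UNIV. \<alpha> i)"] ballI)
qed

subsection \<open>Analytic solutions of quadratic equations\<close>

text \<open>The equation is solved for the coefficients. On a small cube the power series of \<open>p\<close> and \<open>P\<close> have small norm,
since their constant terms vanish, and then \<open>c \<mapsto> p + P c + q c c\<close>, with Cauchy products, is a contraction of a
small ball of power series. Evaluation turns Cauchy products into products, so the sum of the fixed point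
solves the equation at every point of the cube.\<close>

theorem analytic_quadratic_fixed_point:
  fixes p :: "real^'n \<Rightarrow> 'a::banach" and P :: "real^'n \<Rightarrow> 'a \<Rightarrow>\<^sub>L 'a" and q :: "real^'n \<Rightarrow> 'a \<Rightarrow>\<^sub>L 'a \<Rightarrow>\<^sub>L 'a"
  assumes p: "analytic_germ p x" "p x = 0" and P: "analytic_germ P x" "P x = 0" and q: "analytic_germ q x"
  obtains h d where "analytic_germ h x" "h x = 0" "d > 0"
    "\<And>y. norm (y - x) < d \<Longrightarrow> h y = p y + P y (h y) + q y (h y) (h y)"
proof -
  obtain r1 c1 where r1: "r1 > 0"
    "\<And>t s. 0 \<le> t \<Longrightarrow> t \<le> r1 \<Longrightarrow> s \<in> unit_cube \<Longrightarrow> p (x + t *\<^sub>R s) = peval (prescale (t / r1) c1) s"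
    using analytic_germE[OF p(1)] by blast
  obtain r2 c2 where r2: "r2 > 0"
    "\<And>t s. 0 \<le> t \<Longrightarrow> t \<le> r2 \<Longrightarrow> s \<in> unit_cube \<Longrightarrow> P (x + t *\<^sub>R s) = peval (prescale (t / r2) c2) s"
    using analytic_germE[OF P(1)] by blast
  obtain r3 c3 where r3: "r3 > 0"
    "\<And>t s. 0 \<le> t \<Longrightarrow> t \<le> r3 \<Longrightarrow> s \<in> unit_cube \<Longrightarrow> q (x + t *\<^sub>R s) = peval (prescale (t / r3) c3) s"
    using analytic_germE[OF q] by blast
  have z1: "coeff c1 (\<lambda>_. 0) = 0" using r1(2)[of r1 0] r1(1) p(2) by (simp add: peval_0 coeff_prescale)
  have z2: "coeff c2 (\<lambda>_. 0) = 0" using r2(2)[of r2 0] r2(1) P(2) by (simp add: peval_0 coeff_prescale)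
  \<comment> \<open>In the ball of radius \<open>R\<close> the quadratic part has Lipschitz constant at most \<open>1/4\<close>.\<close>
  define R where "R = 1 / (8 * (norm c3 + 1))"
  have n3: "norm c3 + 1 > 0" by (simp add: add_nonneg_pos)
  have R: "R > 0" "norm c3 * R \<le> 1/8" using n3 by (auto simp: R_def field_simps)
  define t where "t = min (min r3 (r1 * (R / 2 / (norm c1 + 1)))) (min (min r1 r2) (r2 * (1/4 / (norm c2 + 1))))"
  have n1: "norm c1 + 1 > 0" and n2: "norm c2 + 1 > 0" by (simp_all add: add_nonneg_pos)
  have t: "0 < t" "t \<le> r1" "t \<le> r2" "t \<le> r3"
    using r1(1) r2(1) r3(1) R n1 n2 by (auto simp: t_def)
  define u v w where "u = prescale (t / r1) c1" and "v = prescale (t / r2) c2" and "w = prescale (t / r3) c3"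
  have u: "norm u \<le> R / 2"
  proof -
    have "t / r1 \<le> R / 2 / (norm c1 + 1)"
      using r1(1) by (subst pos_divide_le_eq) (auto simp: t_def mult.commute)
    then have "t / r1 * norm c1 \<le> R / 2 / (norm c1 + 1) * norm c1" by (rule mult_right_mono) simp
    also have "\<dots> \<le> R / 2" using n1 R by (simp add: field_simps)
    finally have "t / r1 * norm c1 \<le> R / 2" .
    moreover have "norm u \<le> t / r1 * norm c1"
      unfolding u_def using t r1(1) by (intro norm_prescale_le'[OF _ _ z1]) auto
    ultimately show ?thesis by linarith
  qed
  have v: "norm v \<le> 1/4"
  proof -
    have "t / r2 \<le> 1/4 / (norm c2 + 1)"
      using r2(1) by (subst pos_divide_le_eq) (auto simp: t_def mult.commute)
    then have "t / r2 * norm c2 \<le> 1/4 / (norm c2 + 1) * norm c2" by (rule mult_right_mono) simp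
    also have "\<dots> \<le> 1/4" using n2 by (simp add: field_simps)
    finally have "t / r2 * norm c2 \<le> 1/4" .
    moreover have "norm v \<le> t / r2 * norm c2"
      unfolding v_def using t r2(1) by (intro norm_prescale_le'[OF _ _ z2]) auto
    ultimately show ?thesis by linarith
  qed
  have w: "norm w * R \<le> 1/8"
  proof -
    have "norm w \<le> norm c3" unfolding w_def using t r3(1) by (intro norm_prescale_le) auto
    then have "norm w * R \<le> norm c3 * R" using R by (intro mult_right_mono) auto
    then show ?thesis using R(2) by linarith
  qed
  let ?cp = "\<lambda>a b. cauchy_product blinfun_apply a b"
  interpret cp1: bounded_bilinear "?cp :: ('n, 'a \<Rightarrow>\<^sub>L 'a) pseries \<Rightarrow> _"
    by (rule bounded_bilinear_cauchy_product) (rule bounded_bilinear_blinfun_apply)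
  interpret cp2: bounded_bilinear "?cp :: ('n, 'a \<Rightarrow>\<^sub>L 'a \<Rightarrow>\<^sub>L 'a) pseries \<Rightarrow> _"
    by (rule bounded_bilinear_cauchy_product) (rule bounded_bilinear_blinfun_apply)
  have ncp1: "norm (?cp a b) \<le> norm a * norm b" for a :: "('n, 'a \<Rightarrow>\<^sub>L 'a) pseries" and b
    using norm_cauchy_product_le[of 1 "blinfun_apply :: ('a \<Rightarrow>\<^sub>L 'a) \<Rightarrow> _" a b] norm_blinfun by auto
  have ncp2: "norm (?cp a b) \<le> norm a * norm b" for a :: "('n, 'a \<Rightarrow>\<^sub>L 'a \<Rightarrow>\<^sub>L 'a) pseries" and b
    using norm_cauchy_product_le[of 1 "blinfun_apply :: ('a \<Rightarrow>\<^sub>L 'a \<Rightarrow>\<^sub>L 'a) \<Rightarrow> _" a b] norm_blinfun by auto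
  define \<Psi> where "\<Psi> c = u + ?cp v c + ?cp (?cp w c) c" for c
  have wc: "norm (?cp w c) \<le> 1/8" if "norm c \<le> R" for c
    using ncp2[of w c] mult_left_mono[OF that, of "norm w"] w by simp
  have "\<exists>!c\<in>cball 0 R. \<Psi> c = c"
  proof (rule Banach_fix[of _ "1/2"])
    show "complete (cball (0 :: ('n, 'a) pseries) R)" by (simp add: complete_eq_closed)
    show "cball (0 :: ('n, 'a) pseries) R \<noteq> {}" using R by simp
    show "\<Psi> ` cball 0 R \<subseteq> cball 0 R"
    proof (clarsimp simp: \<Psi>_def)
      fix c :: "('n, 'a) pseries" assume c: "norm c \<le> R"
      have "norm (?cp v c) \<le> 1/4 * R"
        by (rule order_trans[OF ncp1 mult_mono]) (use v c R in auto)
      moreover have "norm (?cp (?cp w c) c) \<le> 1/8 * R"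
        by (rule order_trans[OF ncp1 mult_mono]) (use wc[OF c] c R in auto)
      ultimately show "norm (u + ?cp v c + ?cp (?cp w c) c) \<le> R"
        using u norm_triangle_ineq[of "u + ?cp v c" "?cp (?cp w c) c"] norm_triangle_ineq[of u "?cp v c"] R
        by linarith
    qed
    fix c c' :: "('n, 'a) pseries" assume c: "c \<in> cball 0 R" "c' \<in> cball 0 R"
    have "\<Psi> c - \<Psi> c' = ?cp v (c - c') + ?cp (?cp w c) (c - c') + ?cp (?cp w (c - c')) c'"
      unfolding \<Psi>_def cp1.diff_right cp2.diff_right cp1.diff_left by simp
    moreover have "norm (?cp v (c - c')) \<le> 1/4 * norm (c - c')"
      by (rule order_trans[OF ncp1 mult_right_mono]) (use v in auto)
    moreover have "norm (?cp (?cp w c) (c - c')) \<le> 1/8 * norm (c - c')"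
      by (rule order_trans[OF ncp1 mult_right_mono]) (use wc c in auto)
    moreover have "norm (?cp (?cp w (c - c')) c') \<le> 1/8 * norm (c - c')"
    proof -
      have "norm (?cp (?cp w (c - c')) c') \<le> (norm w * norm (c - c')) * R"
        by (rule order_trans[OF ncp1 mult_mono]) (use ncp2 c in auto)
      also have "\<dots> = (norm w * R) * norm (c - c')" by simp
      also have "\<dots> \<le> 1/8 * norm (c - c')" by (rule mult_right_mono[OF w]) simp
      finally show ?thesis .
    qed
    ultimately show "dist (\<Psi> c) (\<Psi> c') \<le> 1/2 * dist c c'"
      unfolding dist_norm
      using norm_triangle_ineq[of "?cp v (c - c') + ?cp (?cp w c) (c - c')" "?cp (?cp w (c - c')) c'"]
        norm_triangle_ineq[of "?cp v (c - c')" "?cp (?cp w c) (c - c')"]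
      by (simp only:)
  qed auto
  then obtain c where c: "norm c \<le> R" "\<Psi> c = c" by auto
  define h where "h y = peval c ((y - x) /\<^sub>R t)" for y
  have eq: "h y = p y + P y (h y) + q y (h y) (h y)" if "norm (y - x) \<le> t" for y
  proof -
    define s where "s = (y - x) /\<^sub>R t"
    have s: "s \<in> unit_cube" unfolding s_def using t that by (intro unit_cubeI_scaled) auto
    have y: "y = x + t *\<^sub>R s" using t by (simp add: s_def)
    have "h y = peval (\<Psi> c) s" by (simp add: h_def s_def c)
    also have "\<dots> = peval u s + peval v s (peval c s) + peval w s (peval c s) (peval c s)"
      by (simp add: \<Psi>_def peval_add[OF s] peval_cauchy_product[OF bounded_bilinear_blinfun_apply s])
    also have "\<dots> = p y + P y (h y) + q y (h y) (h y)"
      unfolding u_def v_def w_def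
      using r1(2)[of t s] r2(2)[of t s] r3(2)[of t s] t s
      by (simp add: y[symmetric]) (simp add: h_def s_def)
    finally show ?thesis .
  qed
  have "h x = 0"
  proof -
    have hx: "norm (h x) \<le> R"
      using norm_peval_le[of 0 c] c(1) by (simp add: h_def)
    have "norm (q x) \<le> norm w"
      using r3(2)[of t 0] t norm_peval_le[of 0 w] by (simp add: w_def)
    have "h x = q x (h x) (h x)" using eq[of x] t p P by simp
    then have "norm (h x) \<le> norm (q x (h x)) * norm (h x)" by (metis norm_blinfun)
    also have "\<dots> \<le> 1/8 * norm (h x)"
    proof (rule mult_right_mono)
      have "norm (q x (h x)) \<le> norm w * R"
        by (rule order_trans[OF norm_blinfun mult_mono]) (use \<open>norm (q x) \<le> norm w\<close> hx in auto)
      then show "norm (q x (h x)) \<le> 1/8" using w by simp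
    qed simp
    finally show "h x = 0" by simp
  qed
  moreover have "analytic_germ h x"
    by (rule analytic_germI[of t _ _ c]) (use t in \<open>auto simp: h_def\<close>)
  ultimately show ?thesis using t(1) eq by (intro that[of h t]) auto
qed

section \<open>The Hilbert space of square-summable families\<close>

text \<open>Complex families, but with the structure of a real Hilbert space: the bounded operators, the
coercivity estimates and the analytic maps below are all real. The complex inner product is kept as
\<open>ell2_inner\<close>.\<close>

typedef 'k ell2 = "{c :: 'k \<Rightarrow> complex. (\<lambda>k. (cmod (c k))\<^sup>2) summable_on UNIV}"
  morphisms coord Abs_ell2
  by (rule exI[of _ "\<lambda>_. 0"]) simp

setup_lifting type_definition_ell2

lemma coord_summable: "(\<lambda>k. (cmod (coord c k))\<^sup>2) summable_on UNIV"
  using coord[of c] by simp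

lemma ell2_eqI: "(\<And>k. coord c k = coord d k) \<Longrightarrow> c = d"
  by (simp add: coord_inject[symmetric] fun_eq_iff)

lemma cmod_add_square_le: "(cmod (a + b))\<^sup>2 \<le> 2 * (cmod a)\<^sup>2 + 2 * (cmod b)\<^sup>2"
proof -
  have "(cmod (a + b))\<^sup>2 \<le> (cmod a + cmod b)\<^sup>2"
    by (intro power_mono norm_triangle_ineq) auto
  also have "\<dots> \<le> 2 * (cmod a)\<^sup>2 + 2 * (cmod b)\<^sup>2"
    using zero_le_power2[of "cmod a - cmod b"] by (simp add: power2_sum power2_diff)
  finally show ?thesis .
qed

lemma square_summable_add:
  assumes "(\<lambda>k. (cmod (c k))\<^sup>2) summable_on UNIV" "(\<lambda>k. (cmod (d k))\<^sup>2) summable_on UNIV"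
  shows "(\<lambda>k. (cmod (c k + d k))\<^sup>2) summable_on UNIV"
  by (rule summable_on_comparison_test[where f =
        "\<lambda>k. 2 * (cmod (c k))\<^sup>2 + 2 * (cmod (d k))\<^sup>2"])
    (auto intro!: summable_on_add summable_on_cmult_right assms cmod_add_square_le)

lemma square_summable_mult:
  assumes "(\<lambda>k. (cmod (c k))\<^sup>2) summable_on UNIV" "(\<lambda>k. (cmod (d k))\<^sup>2) summable_on UNIV"
  shows "(\<lambda>k. norm (c k * cnj (d k))) summable_on UNIV"
proof (rule summable_on_comparison_test[where f = "\<lambda>k. (cmod (c k))\<^sup>2 + (cmod (d k))\<^sup>2"])
  show "norm (c k * cnj (d k)) \<le> (cmod (c k))\<^sup>2 + (cmod (d k))\<^sup>2" for k
    using zero_le_power2[of "cmod (c k) - cmod (d k)"] zero_le_power2[of "cmod (c k)"] zero_le_power2[of "cmod (d k)"]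
    unfolding norm_mult complex_mod_cnj power2_diff by linarith
qed (auto intro: summable_on_add assms)

definition ell2_inner :: "'k ell2 \<Rightarrow> 'k ell2 \<Rightarrow> complex" where
  "ell2_inner c d = (\<Sum>\<^sub>\<infinity>k. coord c k * cnj (coord d k))"

lemma ell2_inner_has_sum: "((\<lambda>k. coord c k * cnj (coord d k)) has_sum ell2_inner c d) UNIV"
  unfolding ell2_inner_def
  by (rule has_sum_infsum[OF abs_summable_summable[OF square_summable_mult[OF coord_summable coord_summable]]])

lemma ell2_innerI: "((\<lambda>k. coord c k * cnj (coord d k)) has_sum x) UNIV \<Longrightarrow> ell2_inner c d = x"
  using ell2_inner_has_sum has_sum_unique by blast

lemma ell2_inner_self: "ell2_inner c c = complex_of_real (\<Sum>\<^sub>\<infinity>k. (cmod (coord c k))\<^sup>2)"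
proof (rule ell2_innerI)
  have "((\<lambda>k. complex_of_real ((cmod (coord c k))\<^sup>2)) has_sum complex_of_real (\<Sum>\<^sub>\<infinity>k. (cmod (coord c k))\<^sup>2)) UNIV"
    by (rule has_sum_of_real) (rule has_sum_infsum[OF coord_summable])
  then show "((\<lambda>k. coord c k * cnj (coord c k)) has_sum complex_of_real (\<Sum>\<^sub>\<infinity>k. (cmod (coord c k))\<^sup>2)) UNIV"
    by (simp only: complex_norm_square)
qed

instantiation ell2 :: (type) real_inner
begin

lift_definition zero_ell2 :: "'a ell2" is "\<lambda>_. 0" by simp
lift_definition plus_ell2 :: "'a ell2 \<Rightarrow> 'a ell2 \<Rightarrow> 'a ell2" is "\<lambda>c d k. c k + d k"
  by (rule square_summable_add)
lift_definition uminus_ell2 :: "'a ell2 \<Rightarrow> 'a ell2" is "\<lambda>c k. - c k" by simp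
lift_definition minus_ell2 :: "'a ell2 \<Rightarrow> 'a ell2 \<Rightarrow> 'a ell2" is "\<lambda>c d k. c k - d k"
  using square_summable_add[of _ "\<lambda>k. - d k" for d] by fastforce
lift_definition scaleR_ell2 :: "real \<Rightarrow> 'a ell2 \<Rightarrow> 'a ell2" is "\<lambda>r c k. r *\<^sub>R c k"
  by (simp add: power_mult_distrib summable_on_cmult_right)
definition inner_ell2 :: "'a ell2 \<Rightarrow> 'a ell2 \<Rightarrow> real" where
  "inner_ell2 c d = Re (ell2_inner c d)"
definition norm_ell2 :: "'a ell2 \<Rightarrow> real" where
  "norm_ell2 c = sqrt (inner c c)"
definition sgn_ell2 :: "'a ell2 \<Rightarrow> 'a ell2" where
  "sgn_ell2 c = scaleR (inverse (norm c)) c"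
definition dist_ell2 :: "'a ell2 \<Rightarrow> 'a ell2 \<Rightarrow> real" where
  "dist_ell2 c d = norm (c - d)"
definition uniformity_ell2 :: "('a ell2 \<times> 'a ell2) filter" where
  "uniformity_ell2 = (INF e\<in>{0<..}. principal {(x, y). dist x y < e})"
definition open_ell2 :: "'a ell2 set \<Rightarrow> bool" where
  "open_ell2 U = (\<forall>x\<in>U. eventually (\<lambda>(x', y). x' = x \<longrightarrow> y \<in> U) uniformity)"

instance
proof
  fix x y z :: "'a ell2" and r s :: real
  show "x + y + z = x + (y + z)" by transfer (simp add: add.assoc)
  show "x + y = y + x" by transfer (simp add: add.commute)
  show "0 + x = x" by transfer simp
  show "- x + x = 0" by transfer simp
  show "x - y = x + - y" by transfer simp
  show "r *\<^sub>R (x + y) = r *\<^sub>R x + r *\<^sub>R y" by transfer (simp add: scaleR_add_right)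
  show "(r + s) *\<^sub>R x = r *\<^sub>R x + s *\<^sub>R x" by transfer (simp add: scaleR_add_left)
  show "r *\<^sub>R s *\<^sub>R x = (r * s) *\<^sub>R x" by transfer simp
  show "1 *\<^sub>R x = x" by transfer simp
  show "sgn x = scaleR (inverse (norm x)) x" by (rule sgn_ell2_def)
  show "dist x y = norm (x - y)" by (rule dist_ell2_def)
  show "uniformity = (INF e\<in>{0<..}. principal {(x, y :: 'a ell2). dist x y < e})"
    by (rule uniformity_ell2_def)
  show "open U = (\<forall>x\<in>U. \<forall>\<^sub>F (x', y) in uniformity. x' = x \<longrightarrow> y \<in> U)" for U :: "'a ell2 set"
    by (rule open_ell2_def)
  show "norm x = sqrt (inner x x)" by (rule norm_ell2_def)
  have "ell2_inner y x = cnj (ell2_inner x y)"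
    by (rule ell2_innerI) (use has_sum_cnj_iff[THEN iffD2, OF ell2_inner_has_sum[of x y]] in \<open>simp add: mult.commute\<close>)
  then show "inner x y = inner y x" by (simp add: inner_ell2_def)
  have "ell2_inner (x + y) z = ell2_inner x z + ell2_inner y z"
    by (rule ell2_innerI)
      (use has_sum_add[OF ell2_inner_has_sum[of x z] ell2_inner_has_sum[of y z]] in
        \<open>simp add: plus_ell2.rep_eq algebra_simps\<close>)
  then show "inner (x + y) z = inner x z + inner y z" by (simp add: inner_ell2_def)
  have "ell2_inner (r *\<^sub>R x) y = r * ell2_inner x y"
    by (rule ell2_innerI)
      (use has_sum_cmult_right[OF ell2_inner_has_sum[of x y], of "complex_of_real r"] in
        \<open>simp add: scaleR_ell2.rep_eq scaleR_conv_of_real mult.assoc\<close>)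
  then show "inner (r *\<^sub>R x) y = r * inner x y" by (simp add: inner_ell2_def)
  have self: "inner x x = (\<Sum>\<^sub>\<infinity>k. (cmod (coord x k))\<^sup>2)"
    by (simp add: inner_ell2_def ell2_inner_self)
  show "0 \<le> inner x x" unfolding self by (rule infsum_nonneg) simp
  show "inner x x = 0 \<longleftrightarrow> x = 0"
  proof
    assume "inner x x = 0"
    then have "(cmod (coord x k))\<^sup>2 = 0" for k
      unfolding self by (intro nonneg_infsum_le_0D[OF _ coord_summable]) auto
    then show "x = 0" by (intro ell2_eqI) (simp add: zero_ell2.rep_eq)
  qed (simp add: inner_ell2_def ell2_inner_def zero_ell2.rep_eq)
qed

end

lemmas coord_simps = zero_ell2.rep_eq plus_ell2.rep_eq uminus_ell2.rep_eq minus_ell2.rep_eq scaleR_ell2.rep_eq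

lemma norm_ell2_square: "(norm c)\<^sup>2 = (\<Sum>\<^sub>\<infinity>k. (cmod (coord c k))\<^sup>2)"
  by (simp add: power2_norm_eq_inner inner_ell2_def ell2_inner_self)

lemma norm_ell2_has_sum: "((\<lambda>k. (cmod (coord c k))\<^sup>2) has_sum (norm c)\<^sup>2) UNIV"
  unfolding norm_ell2_square by (rule has_sum_infsum[OF coord_summable])

lemma sum_cmod_square_le: "finite F \<Longrightarrow> (\<Sum>k\<in>F. (cmod (coord c k))\<^sup>2) \<le> (norm c)\<^sup>2"
  unfolding norm_ell2_square by (rule finite_sum_le_infsum[OF coord_summable]) auto

lemma cmod_coord_le: "cmod (coord c k) \<le> norm c"
  using sum_cmod_square_le[of "{k}" c] by (simp add: power2_le_iff_abs_le)

lemma coord_Abs: "(\<lambda>k. (cmod (c k))\<^sup>2) summable_on UNIV \<Longrightarrow> coord (Abs_ell2 c) = c"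
  by (simp add: Abs_ell2_inverse)

lemma Abs_ell2_bounds:
  assumes "\<And>F. finite F \<Longrightarrow> (\<Sum>k\<in>F. (cmod (c k))\<^sup>2) \<le> B\<^sup>2" "B \<ge> 0"
  shows "(\<lambda>k. (cmod (c k))\<^sup>2) summable_on UNIV" "norm (Abs_ell2 c) \<le> B"
proof -
  show s: "(\<lambda>k. (cmod (c k))\<^sup>2) summable_on UNIV"
    by (rule nonneg_bdd_above_summable_on) (auto intro!: bdd_aboveI2[of _ _ "B\<^sup>2"] assms)
  have "(norm (Abs_ell2 c))\<^sup>2 \<le> B\<^sup>2"
    unfolding norm_ell2_square coord_Abs[OF s]
    by (rule infsum_le_finite_sums[OF s]) (auto intro: assms)
  then show "norm (Abs_ell2 c) \<le> B" using assms(2) power2_le_imp_le by blast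
qed

instance ell2 :: (type) banach
proof
  fix X :: "nat \<Rightarrow> 'a ell2"
  assume X: "Cauchy X"
  have "Cauchy (\<lambda>n. coord (X n) k)" for k
  proof (rule metric_CauchyI)
    fix e :: real assume "e > 0"
    then obtain N where N: "\<And>m n. m \<ge> N \<Longrightarrow> n \<ge> N \<Longrightarrow> dist (X m) (X n) < e"
      using X unfolding Cauchy_def by blast
    have "dist (coord (X m) k) (coord (X n) k) \<le> dist (X m) (X n)" for m n
      using cmod_coord_le[of "X m - X n" k] by (simp add: dist_norm minus_ell2.rep_eq)
    then show "\<exists>N. \<forall>m\<ge>N. \<forall>n\<ge>N. dist (coord (X m) k) (coord (X n) k) < e"
      using N le_less_trans by blast
  qed
  then have "\<forall>k. \<exists>l. (\<lambda>n. coord (X n) k) \<longlonglongrightarrow> l"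
    by (simp add: Cauchy_convergent_iff convergent_def)
  then obtain c where c: "\<And>k. (\<lambda>n. coord (X n) k) \<longlonglongrightarrow> c k" by metis
  have near: "(\<Sum>k\<in>F. (cmod (coord (X m) k - c k))\<^sup>2) \<le> e\<^sup>2"
    if "finite F" "\<And>n. n \<ge> N \<Longrightarrow> norm (X m - X n) \<le> e" for F e m N
  proof (rule LIMSEQ_le_const2)
    show "(\<lambda>n. \<Sum>k\<in>F. (cmod (coord (X m) k - coord (X n) k))\<^sup>2)
        \<longlonglongrightarrow> (\<Sum>k\<in>F. (cmod (coord (X m) k - c k))\<^sup>2)"
      by (intro tendsto_intros c)
    have "(\<Sum>k\<in>F. (cmod (coord (X m) k - coord (X n) k))\<^sup>2) \<le> e\<^sup>2" if "n \<ge> N" for n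
      using sum_cmod_square_le[OF \<open>finite F\<close>, of "X m - X n"]
        power_mono[OF \<open>\<And>n. n \<ge> N \<Longrightarrow> _\<close>[OF that] norm_ge_zero, of 2]
      by (simp add: minus_ell2.rep_eq)
    then show "\<exists>N. \<forall>n\<ge>N. (\<Sum>k\<in>F. (cmod (coord (X m) k - coord (X n) k))\<^sup>2) \<le> e\<^sup>2"
      by blast
  qed
  have cau: "\<exists>N. \<forall>m\<ge>N. \<forall>n\<ge>N. norm (X m - X n) \<le> e" if "e > 0" for e
    using X that unfolding Cauchy_def dist_norm by (meson less_imp_le)
  obtain N where "\<And>m n. m \<ge> N \<Longrightarrow> n \<ge> N \<Longrightarrow> norm (X m - X n) \<le> 1" using cau[of 1] by auto
  then have diff: "(\<lambda>k. (cmod (coord (X N) k - c k))\<^sup>2) summable_on UNIV"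
    using Abs_ell2_bounds(1)[of "\<lambda>k. coord (X N) k - c k" 1] near[of _ N N 1] by auto
  then have csum: "(\<lambda>k. (cmod (c k))\<^sup>2) summable_on UNIV"
    using square_summable_add[OF _ coord_summable[of "X N"], of "\<lambda>k. c k - coord (X N) k"]
    by (simp add: norm_minus_commute)
  have "X \<longlonglongrightarrow> Abs_ell2 c"
  proof (rule metric_LIMSEQ_I)
    fix e :: real assume "e > 0"
    then obtain N where N: "\<And>m n. m \<ge> N \<Longrightarrow> n \<ge> N \<Longrightarrow> norm (X m - X n) \<le> e / 2"
      using cau[of "e/2"] by auto
    have "norm (X m - Abs_ell2 c) \<le> e / 2" if "m \<ge> N" for m
    proof -
      have "X m - Abs_ell2 c = Abs_ell2 (\<lambda>k. coord (X m) k - c k)"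
        by (subst coord_inverse[symmetric]) (simp add: minus_ell2.rep_eq coord_Abs[OF csum])
      moreover have "norm (Abs_ell2 (\<lambda>k. coord (X m) k - c k)) \<le> e/2"
        by (rule Abs_ell2_bounds(2)) (use near[of _ N m "e/2"] N that \<open>e > 0\<close> in auto)
      ultimately show ?thesis by simp
    qed
    then show "\<exists>N. \<forall>n\<ge>N. dist (X n) (Abs_ell2 c) < e"
      unfolding dist_norm using \<open>e > 0\<close> by (intro exI[of _ N]) (smt (verit) field_sum_of_halves)
  qed
  then show "convergent X" by (auto simp: convergent_def)
qed

subsection \<open>Multiplication operators\<close>

lemma ell2_inner_add_right: "ell2_inner c (d + d') = ell2_inner c d + ell2_inner c d'"
  by (rule ell2_innerI)
    (use has_sum_add[OF ell2_inner_has_sum[of c d] ell2_inner_has_sum[of c d']] in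
      \<open>simp add: plus_ell2.rep_eq algebra_simps\<close>)

lift_definition ell2_single :: "'k \<Rightarrow> 'k ell2" is "\<lambda>k l. if l = k then 1 else 0"
proof -
  fix k :: 'k
  have "((\<lambda>l. (cmod (if l = k then 1 else 0))\<^sup>2) has_sum 1) UNIV"
    by (rule has_sum_finite_neutralI[where B = "{k}"]) auto
  then show "(\<lambda>l. (cmod (if l = k then 1 else 0))\<^sup>2) summable_on UNIV"
    by (rule has_sum_imp_summable)
qed

lemma coord_single: "coord (ell2_single k) l = (if l = k then 1 else 0)"
  by (simp add: ell2_single.rep_eq)

lemma ell2_inner_single: "ell2_inner c (ell2_single k) = coord c k"
  by (rule ell2_innerI, rule has_sum_finite_neutralI[where B = "{k}"]) (auto simp: coord_single)

definition bounded_fun :: "('k \<Rightarrow> complex) \<Rightarrow> bool" where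
  "bounded_fun m \<longleftrightarrow> (\<exists>B. \<forall>k. cmod (m k) \<le> B)"

definition diag_fun :: "('k \<Rightarrow> complex) \<Rightarrow> 'k ell2 \<Rightarrow> 'k ell2" where
  "diag_fun m c = Abs_ell2 (\<lambda>k. m k * coord c k)"

lemma diag_fun:
  assumes "\<And>k. cmod (m k) \<le> B"
  shows "coord (diag_fun m c) k = m k * coord c k" "norm (diag_fun m c) \<le> B * norm c"
proof -
  have B: "B \<ge> 0" using assms[of k] norm_ge_zero order_trans by blast
  have le: "(\<Sum>k\<in>F. (cmod (m k * coord c k))\<^sup>2) \<le> (B * norm c)\<^sup>2" if "finite F" for F
  proof -
    have "(\<Sum>k\<in>F. (cmod (m k * coord c k))\<^sup>2) \<le> (\<Sum>k\<in>F. B\<^sup>2 * (cmod (coord c k))\<^sup>2)"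
      by (rule sum_mono) (simp add: norm_mult power_mult_distrib mult_right_mono power_mono assms)
    also have "\<dots> \<le> B\<^sup>2 * (norm c)\<^sup>2"
      unfolding sum_distrib_left[symmetric] by (intro mult_left_mono sum_cmod_square_le that) simp
    finally show ?thesis by (simp add: power_mult_distrib)
  qed
  show "coord (diag_fun m c) k = m k * coord c k"
    unfolding diag_fun_def by (subst coord_Abs[OF Abs_ell2_bounds(1)[OF le]]) (use B in auto)
  show "norm (diag_fun m c) \<le> B * norm c"
    unfolding diag_fun_def by (rule Abs_ell2_bounds(2)[OF le]) (use B in auto)
qed

definition diag_op :: "('k \<Rightarrow> complex) \<Rightarrow> 'k ell2 \<Rightarrow>\<^sub>L 'k ell2" where
  "diag_op m = Blinfun (diag_fun m)"

lemma coord_diag_op: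
  assumes "bounded_fun m"
  shows "coord (diag_op m c) k = m k * coord c k"
proof -
  obtain B where B: "\<And>k. cmod (m k) \<le> B" using assms by (auto simp: bounded_fun_def)
  have "bounded_linear (diag_fun m)"
  proof
    show "diag_fun m (c + d) = diag_fun m c + diag_fun m d" for c d
      by (rule ell2_eqI) (simp add: diag_fun[OF B] coord_simps algebra_simps)
    show "diag_fun m (r *\<^sub>R c) = r *\<^sub>R diag_fun m c" for c r
      by (rule ell2_eqI) (simp add: diag_fun[OF B] coord_simps)
    show "\<exists>K. \<forall>x. norm (diag_fun m x) \<le> norm x * K"
      using diag_fun(2)[OF B] by (auto simp: mult.commute intro!: exI[of _ B])
  qed
  then show ?thesis
    by (simp add: diag_op_def bounded_linear_Blinfun_apply diag_fun[OF B])
qed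

lemma ell2_inner_diag_op:
  assumes "bounded_fun m"
  shows "ell2_inner (diag_op m c) d = ell2_inner c (diag_op (\<lambda>k. cnj (m k)) d)"
proof -
  have "bounded_fun (\<lambda>k. cnj (m k))" using assms by (simp add: bounded_fun_def)
  then show ?thesis
    unfolding ell2_inner_def by (simp add: coord_diag_op assms mult_ac)
qed

section \<open>A simple eigenvalue below a gap in a Hilbert space\<close>

text \<open>For small \<open>t\<close> the map \<open>x \<mapsto> x - t (S x - y)\<close> is a contraction:
\<open>\<bar>x - t S x\<bar>\<^sup>2 \<le> (1 - 2 t c + t\<^sup>2 M\<^sup>2) \<bar>x\<bar>\<^sup>2\<close> if \<open>M\<close> bounds \<open>S\<close>, and \<open>t = c / M\<^sup>2\<close> is the best choice.\<close>

theorem lax_milgram: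
  fixes S :: "'h::{real_inner, banach} \<Rightarrow>\<^sub>L 'h"
  assumes c: "c > 0" "\<And>x. c * (x \<bullet> x) \<le> S x \<bullet> x"
  obtains R :: "'h \<Rightarrow>\<^sub>L 'h" where "\<And>x. S (R x) = x" "\<And>x. norm (R x) \<le> norm x / c"
proof -
  have lower: "norm x \<le> norm (S x) / c" for x
  proof (cases "x = 0")
    case False
    have "c * (norm x * norm x) \<le> norm (S x) * norm x"
      using c(2)[of x] norm_cauchy_schwarz[of "S x" x]
      by (simp add: power2_norm_eq_inner[symmetric] power2_eq_square)
    then have "c * norm x \<le> norm (S x)" using False by simp
    then show ?thesis using c(1) by (simp add: field_simps)
  qed simp
  define M where "M = norm S + c"
  have M: "M > 0" "c \<le> M" using c(1) by (auto simp: M_def add_nonneg_pos)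
  define t where "t = c / M\<^sup>2"
  define k where "k = sqrt (1 - c\<^sup>2 / M\<^sup>2)"
  have cM: "c\<^sup>2 / M\<^sup>2 \<le> 1" "c\<^sup>2 / M\<^sup>2 > 0" using M c(1) by (auto simp: power_mono)
  then have k: "0 \<le> k" "k < 1" by (auto simp: k_def)
  have contr: "norm (x - t *\<^sub>R S x) \<le> k * norm x" for x
  proof (rule power2_le_imp_le)
    have "(norm (x - t *\<^sub>R S x))\<^sup>2 = x \<bullet> x - 2 * t * (S x \<bullet> x) + t\<^sup>2 * (S x \<bullet> S x)"
      unfolding power2_norm_eq_inner by (simp add: inner_diff inner_commute power2_eq_square algebra_simps)
    also have "\<dots> \<le> x \<bullet> x - 2 * t * (c * (x \<bullet> x)) + t\<^sup>2 * (M\<^sup>2 * (x \<bullet> x))"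
    proof (intro add_mono diff_mono mult_left_mono order_refl)
      have "norm (S x) \<le> M * norm x"
        by (rule order_trans[OF norm_blinfun]) (use c(1) in \<open>auto simp: M_def mult_right_mono\<close>)
      then have "(norm (S x))\<^sup>2 \<le> (M * norm x)\<^sup>2" by (rule power_mono) simp
      then show "S x \<bullet> S x \<le> M\<^sup>2 * (x \<bullet> x)"
        by (simp add: power2_norm_eq_inner power_mult_distrib)
    qed (use c M in \<open>auto simp: t_def\<close>)
    also have "\<dots> = (1 - c\<^sup>2 / M\<^sup>2) * (x \<bullet> x)"
      using M by (simp add: t_def field_simps power2_eq_square)
    also have "\<dots> = (k * norm x)\<^sup>2"
      using cM by (simp add: k_def power_mult_distrib power2_norm_eq_inner)
    finally show "(norm (x - t *\<^sub>R S x))\<^sup>2 \<le> (k * norm x)\<^sup>2" .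
  qed (use k in simp)
  have ex: "\<exists>x. S x = y" for y
  proof -
    have "\<exists>!x. x - t *\<^sub>R (S x - y) = x"
    proof (rule banach_fix_type[OF k], intro allI)
      fix x x'
      have "(x - t *\<^sub>R (S x - y)) - (x' - t *\<^sub>R (S x' - y)) = (x - x') - t *\<^sub>R S (x - x')"
        by (simp add: blinfun.diff_right algebra_simps)
      then show "dist (x - t *\<^sub>R (S x - y)) (x' - t *\<^sub>R (S x' - y)) \<le> k * dist x x'"
        using contr[of "x - x'"] by (simp only: dist_norm)
    qed
    then obtain x where "x - t *\<^sub>R (S x - y) = x" by blast
    moreover have "t \<noteq> 0" using c(1) M by (simp add: t_def)
    ultimately show ?thesis by (intro exI[of _ x]) simp
  qed
  then obtain r where r: "\<And>y. S (r y) = y" by metis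
  have inj: "x = x'" if "S x = S x'" for x x'
    using lower[of "x - x'"] that by (simp add: blinfun.diff_right)
  have "bounded_linear r"
  proof
    show "r (x + y) = r x + r y" for x y by (rule inj) (simp add: r blinfun.add_right)
    show "r (a *\<^sub>R x) = a *\<^sub>R r x" for a x by (rule inj) (simp add: r blinfun.scaleR_right)
    show "\<exists>K. \<forall>x. norm (r x) \<le> norm x * K"
      using lower[of "r x" for x] by (intro exI[of _ "1 / c"]) (simp add: r)
  qed
  then have "blinfun_apply (Blinfun r) = r" by (rule bounded_linear_Blinfun_apply)
  then show ?thesis using that[of "Blinfun r"] r lower[of "r x" for x] by simp
qed

text \<open>The spectral situation in abstract form. \<open>B\<close> and \<open>N\<close> stand for the form and for the \<open>L\<^sup>2\<close> inner product on a
common Hilbert space, \<open>e\<close> for the constant function 1, and \<open>J\<close> for multiplication by the imaginary unit; a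
complex eigenvalue problem is thus a real one that commutes with \<open>J\<close>. The complement of the complex line
through \<open>e\<close> consists of the functions of mean zero.\<close>

locale simple_low_eigenvalue =
  fixes B :: "real^'n \<Rightarrow> 'h::{real_inner, banach} \<Rightarrow>\<^sub>L 'h"
    and N J :: "'h \<Rightarrow>\<^sub>L 'h"
    and e :: 'h and V :: "(real^'n) set" and \<beta> \<kappa> :: real
  assumes open_V: "open V"
    and B_analytic: "\<eta> \<in> V \<Longrightarrow> analytic_germ B \<eta>"
    and B_sym: "\<eta> \<in> V \<Longrightarrow> B \<eta> x \<bullet> y = x \<bullet> B \<eta> y"
    and B_nonneg: "\<eta> \<in> V \<Longrightarrow> 0 \<le> B \<eta> x \<bullet> x"
    and B_J: "\<eta> \<in> V \<Longrightarrow> B \<eta> (J x) = J (B \<eta> x)"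
    and N_sym: "N x \<bullet> y = x \<bullet> N y"
    and N_nonneg: "0 \<le> N x \<bullet> x"
    and N_J: "N (J x) = J (N x)"
    and J_J: "J (J x) = - x"
    and J_isometry: "J x \<bullet> J y = x \<bullet> y"
    and N_e: "N e = e" and e_unit: "e \<bullet> e = 1"
    and \<kappa>: "\<kappa> > 0"
    and gap: "\<eta> \<in> V \<Longrightarrow> w \<bullet> e = 0 \<Longrightarrow> w \<bullet> J e = 0 \<Longrightarrow>
        \<beta> * (N w \<bullet> w) + \<kappa> * (w \<bullet> w) \<le> B \<eta> w \<bullet> w"
    and low: "\<eta> \<in> V \<Longrightarrow> B \<eta> e \<bullet> e < \<beta>"
begin

lemma J_skew: "J x \<bullet> y = - (x \<bullet> J y)"
  using J_isometry[of x "J y"] by (simp add: J_J)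

lemma e_Je: "e \<bullet> J e = 0" "J e \<bullet> e = 0" "J e \<bullet> J e = 1"
  using J_skew[of e e] e_unit by (auto simp: inner_commute J_isometry)

definition proj :: "'h \<Rightarrow>\<^sub>L 'h" where
  "proj = id_blinfun - (blinfun_scaleR_left e o\<^sub>L blinfun_inner_right e)
      - (blinfun_scaleR_left (J e) o\<^sub>L blinfun_inner_right (J e))"

lemma proj_apply: "proj x = x - (x \<bullet> e) *\<^sub>R e - (x \<bullet> J e) *\<^sub>R J e"
  by (simp add: proj_def blinfun.diff_left blinfun_scaleR_left.rep_eq inner_commute)

lemma proj_perp [simp]: "proj x \<bullet> e = 0" "proj x \<bullet> J e = 0"
  by (auto simp: proj_apply inner_diff_left e_unit e_Je)

lemma proj_fixed: "x \<bullet> e = 0 \<Longrightarrow> x \<bullet> J e = 0 \<Longrightarrow> proj x = x"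
  by (simp add: proj_apply)

lemma proj_proj [simp]: "proj (proj x) = proj x"
  by (rule proj_fixed) auto

lemma proj_e [simp]: "proj e = 0"
  by (simp add: proj_apply e_unit e_Je)

lemma proj_sym: "proj x \<bullet> y = x \<bullet> proj y"
  by (simp add: proj_apply inner_diff inner_commute mult.commute)

lemma N_perp:
  "N x \<bullet> e = x \<bullet> e" "N x \<bullet> J e = x \<bullet> J e"
  by (auto simp: N_sym N_e N_J)

lemma proj_N_proj [simp]: "proj (N (proj x)) = N (proj x)"
  by (rule proj_fixed) (auto simp: N_perp)

lemma sym_J:
  assumes "\<And>x y. (T :: 'h \<Rightarrow>\<^sub>L 'h) x \<bullet> y = x \<bullet> T y" "\<And>x. T (J x) = J (T x)"
  shows "T x \<bullet> J x = 0"
  using assms(1)[of x "J x"] J_skew[of x "T x"] assms(2)[of x] by (simp add: inner_commute)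

text \<open>The two hypotheses say that the residual is orthogonal to the mean-zero vectors and to \<open>e\<close>. The remaining
direction \<open>J e\<close> is automatic: \<open>\<langle>B u, J u\<rangle>\<close> and \<open>\<langle>N u, J u\<rangle>\<close> vanish by symmetry, and \<open>J u\<close> is \<open>J e\<close> plus a
mean-zero vector.\<close>

lemma eigen_if_reduced:
  assumes \<eta>: "\<eta> \<in> V" and w: "proj w = w"
    and red: "proj (B \<eta> (e + w)) = \<nu> *\<^sub>R N w" and lam: "B \<eta> (e + w) \<bullet> e = \<nu>"
  shows "B \<eta> (e + w) = \<nu> *\<^sub>R N (e + w)"
proof -
  define u where "u = e + w"
  define r where "r = B \<eta> u - \<nu> *\<^sub>R N u"
  have we: "w \<bullet> e = 0" "w \<bullet> J e = 0" using proj_perp[of w] w by auto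
  have pr: "proj r = 0"
    using red proj_N_proj[of w]
    by (simp add: r_def u_def blinfun.diff_right blinfun.scaleR_right blinfun.add_right N_e w)
  have re: "r \<bullet> e = 0"
    using lam we by (simp add: r_def u_def inner_diff_left N_perp inner_add_left e_unit)
  have "r \<bullet> J u = 0"
    unfolding r_def inner_diff_left inner_scaleR_left
    using sym_J[of "B \<eta>" u] sym_J[of N u] B_sym[OF \<eta>] B_J[OF \<eta>] N_sym N_J by simp
  moreover have "r \<bullet> J w = proj r \<bullet> J w"
    using we by (simp add: proj_sym proj_fixed J_skew J_J J_isometry)
  ultimately have "r \<bullet> J e = 0" using pr by (simp add: u_def blinfun.add_right inner_add_right)
  then have "r = 0" using pr re by (simp add: proj_apply)
  then show ?thesis by (simp add: r_def u_def)
qed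

definition eigen :: "real^'n \<Rightarrow> real \<Rightarrow> 'h \<Rightarrow> bool" where
  "eigen \<eta> \<mu> u \<longleftrightarrow> u \<noteq> 0 \<and> B \<eta> u = \<mu> *\<^sub>R N u"

text \<open>By the gap an eigenvector with eigenvalue below \<open>\<beta>\<close> is not orthogonal to the complex line through \<open>e\<close>. A
complex multiple of it, written here with \<open>J\<close>, has component exactly \<open>e\<close>.\<close>

lemma eigen_normalize:
  assumes \<eta>: "\<eta> \<in> V" and u: "eigen \<eta> \<mu> u" and \<mu>: "\<mu> < \<beta>"
  obtains w where "w \<bullet> e = 0" "w \<bullet> J e = 0" "B \<eta> (e + w) = \<mu> *\<^sub>R N (e + w)"
proof -
  define p q where "p = u \<bullet> e" and "q = u \<bullet> J e"
  have "p \<noteq> 0 \<or> q \<noteq> 0"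
  proof (rule ccontr)
    assume "\<not> ?thesis"
    then have "\<beta> * (N u \<bullet> u) + \<kappa> * (u \<bullet> u) \<le> B \<eta> u \<bullet> u"
      by (intro gap[OF \<eta>]) (auto simp: p_def q_def)
    also have "\<dots> = \<mu> * (N u \<bullet> u)" using u by (simp add: eigen_def)
    also have "\<dots> \<le> \<beta> * (N u \<bullet> u)" using \<mu> N_nonneg by (intro mult_right_mono) auto
    finally have "u \<bullet> u \<le> 0" using \<kappa> by (simp add: mult_le_0_iff)
    then show False using u by (metis eigen_def inner_gt_zero_iff not_le)
  qed
  then have pq: "p\<^sup>2 + q\<^sup>2 \<noteq> 0" by (simp add: sum_power2_eq_zero_iff)
  define v where "v = (p / (p\<^sup>2 + q\<^sup>2)) *\<^sub>R u - (q / (p\<^sup>2 + q\<^sup>2)) *\<^sub>R J u"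
  have "v \<bullet> e = (p\<^sup>2 + q\<^sup>2) / (p\<^sup>2 + q\<^sup>2)"
    unfolding v_def inner_diff_left inner_scaleR_left J_skew
    by (simp add: p_def[symmetric] q_def[symmetric] power2_eq_square add_divide_distrib[symmetric])
  then have ve: "v \<bullet> e = 1" using pq by simp
  have vJ: "v \<bullet> J e = 0"
    unfolding v_def inner_diff_left inner_scaleR_left J_isometry
    by (simp add: p_def[symmetric] q_def[symmetric])
  have Bu: "B \<eta> u = \<mu> *\<^sub>R N u" using u by (simp add: eigen_def)
  have "B \<eta> v = \<mu> *\<^sub>R N v"
    unfolding v_def blinfun.diff_right blinfun.scaleR_right B_J[OF \<eta>] N_J Bu
    by (simp add: algebra_simps)
  then show ?thesis
    using that[of "v - e"] ve vJ by (simp add: inner_diff_left e_unit e_Je)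
qed

text \<open>Suppose there were an eigenvalue \<open>\<mu>\<close> smaller than \<open>\<nu>\<close>. Normalized eigenvectors \<open>e + w\<close> and \<open>e + z\<close> are
orthogonal for \<open>N\<close> and hence for \<open>B\<close>. Their difference is orthogonal to \<open>e\<close> and \<open>J e\<close>, while its Rayleigh
quotient is an average of \<open>\<mu>\<close> and \<open>\<nu>\<close> and therefore below \<open>\<beta>\<close>: this contradicts the gap.\<close>

lemma eigen_le:
  assumes \<eta>: "\<eta> \<in> V" and u: "eigen \<eta> \<mu> u" and v: "eigen \<eta> \<nu> v" and "\<nu> < \<beta>"
  shows "\<nu> \<le> \<mu>"
proof (rule ccontr)
  assume "\<not> \<nu> \<le> \<mu>"
  then have "\<mu> < \<nu>" by simp
  then have "\<mu> < \<beta>" using \<open>\<nu> < \<beta>\<close> by simp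
  obtain w where w: "w \<bullet> e = 0" "w \<bullet> J e = 0" "B \<eta> (e + w) = \<mu> *\<^sub>R N (e + w)"
    using eigen_normalize[OF \<eta> u \<open>\<mu> < \<beta>\<close>] .
  obtain z where z: "z \<bullet> e = 0" "z \<bullet> J e = 0" "B \<eta> (e + z) = \<nu> *\<^sub>R N (e + z)"
    using eigen_normalize[OF \<eta> v \<open>\<nu> < \<beta>\<close>] .
  let ?u = "e + w" and ?v = "e + z"
  have "\<mu> * (N ?u \<bullet> ?v) = \<nu> * (N ?u \<bullet> ?v)"
    using B_sym[OF \<eta>, of ?u ?v] N_sym[of ?u ?v] w(3) z(3) by simp
  then have orth: "N ?u \<bullet> ?v = 0" using \<open>\<mu> < \<nu>\<close> by simp
  then have orth': "N ?v \<bullet> ?u = 0" using N_sym[of ?v ?u] by (simp add: inner_commute)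
  have "\<beta> * (N (w - z) \<bullet> (w - z)) + \<kappa> * ((w - z) \<bullet> (w - z)) \<le> B \<eta> (w - z) \<bullet> (w - z)"
    using w z by (intro gap[OF \<eta>]) (auto simp: inner_diff_left)
  moreover have d: "w - z = ?u - ?v" by simp
  have cross: "(a - b) \<bullet> (u' - v') = a' + b'"
    if "a \<bullet> v' = 0" "b \<bullet> u' = 0" "a \<bullet> u' = a'" "b \<bullet> v' = b'" for a b u' v' :: 'h and a' b'
    using that by (simp add: inner_diff_left inner_diff_right)
  have "B \<eta> (w - z) \<bullet> (w - z) = \<mu> * (N ?u \<bullet> ?u) + \<nu> * (N ?v \<bullet> ?v)"
    unfolding d blinfun.diff_right w(3) z(3) by (rule cross) (use orth orth' in auto)
  moreover have "N (w - z) \<bullet> (w - z) = N ?u \<bullet> ?u + N ?v \<bullet> ?v"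
    unfolding d blinfun.diff_right by (rule cross) (use orth orth' in auto)
  moreover have "0 \<le> \<kappa> * ((w - z) \<bullet> (w - z))" using \<kappa> by simp
  moreover have pos: "N ?u \<bullet> ?u > 0"
  proof -
    have "N ?u \<bullet> ?u = 1 + N w \<bullet> w"
    proof -
      have "e \<bullet> w = 0" using w(1) by (simp add: inner_commute)
      then show ?thesis
        using w(1) by (simp add: blinfun.add_right N_e inner_add_left inner_add_right e_unit N_perp)
    qed
    then show ?thesis using N_nonneg[of w] by simp
  qed
  moreover have "\<mu> * (N ?u \<bullet> ?u) < \<beta> * (N ?u \<bullet> ?u)" using pos \<open>\<mu> < \<beta>\<close> by (rule mult_strict_right_mono[rotated])
  moreover have "\<nu> * (N ?v \<bullet> ?v) \<le> \<beta> * (N ?v \<bullet> ?v)"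
    using N_nonneg[of ?v] \<open>\<nu> < \<beta>\<close> by (intro mult_right_mono) auto
  ultimately show False by (simp add: distrib_left)
qed

lemma Least_eigen:
  assumes "\<eta> \<in> V" "eigen \<eta> \<nu> v" "\<nu> < \<beta>"
  shows "(LEAST \<mu>. \<exists>u. eigen \<eta> \<mu> u) = \<nu>"
  by (rule Least_equality) (use assms eigen_le in blast)+

text \<open>The compression of \<open>B - \<nu> N\<close> to the mean-zero vectors, extended by the identity on the complex line through
\<open>e\<close> so that it can be inverted on the whole space.\<close>

definition reduced :: "real^'n \<Rightarrow> real \<Rightarrow> 'h \<Rightarrow>\<^sub>L 'h" where
  "reduced \<eta> \<nu> = (proj o\<^sub>L B \<eta> o\<^sub>L proj) - \<nu> *\<^sub>R (N o\<^sub>L proj) + (id_blinfun - proj)"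

lemma reduced_apply:
  "reduced \<eta> \<nu> x = proj (B \<eta> (proj x)) - \<nu> *\<^sub>R N (proj x) + (x - proj x)"
  by (simp add: reduced_def blinfun.diff_left blinfun.add_left blinfun.scaleR_left)

lemma reduced_sym: "\<eta> \<in> V \<Longrightarrow> reduced \<eta> \<nu> x \<bullet> y = x \<bullet> reduced \<eta> \<nu> y"
proof -
  assume \<eta>: "\<eta> \<in> V"
  have "N (proj x) \<bullet> y = proj x \<bullet> N (proj y)"
    by (metis N_sym proj_N_proj proj_sym)
  moreover have "x \<bullet> N (proj y) = proj x \<bullet> N (proj y)"
    by (metis proj_N_proj proj_sym)
  moreover have "proj (B \<eta> (proj x)) \<bullet> y = x \<bullet> proj (B \<eta> (proj y))"
    unfolding proj_sym[of "B \<eta> (proj x)"] B_sym[OF \<eta>, of "proj x"] by (rule proj_sym)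
  moreover have "(x - proj x) \<bullet> y = x \<bullet> (y - proj y)"
    by (simp only: inner_diff_left inner_diff_right proj_sym)
  ultimately show ?thesis
    by (simp only: reduced_apply inner_diff_left[of "proj (B \<eta> (proj x))"] inner_diff_right[of x "proj (B \<eta> (proj y))"]
        inner_add_left inner_add_right inner_scaleR_left inner_scaleR_right)
qed

lemma reduced_coercive:
  assumes \<eta>: "\<eta> \<in> V" and "\<nu> \<le> \<beta>"
  shows "min \<kappa> 1 * (x \<bullet> x) \<le> reduced \<eta> \<nu> x \<bullet> x"
proof -
  have N: "N (proj x) \<bullet> x = N (proj x) \<bullet> proj x" by (metis proj_N_proj proj_sym)
  have o: "proj x \<bullet> (x - proj x) = 0"
    by (simp add: inner_diff_right) (metis proj_proj proj_sym)
  have split: "x \<bullet> x = proj x \<bullet> proj x + (x - proj x) \<bullet> (x - proj x)"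
    using o by (simp add: inner_diff inner_commute)
  have "reduced \<eta> \<nu> x \<bullet> x = B \<eta> (proj x) \<bullet> proj x - \<nu> * (N (proj x) \<bullet> proj x) + (x - proj x) \<bullet> x"
    by (simp add: reduced_apply inner_add_left inner_diff_left proj_sym N)
  also have "(x - proj x) \<bullet> x = (x - proj x) \<bullet> (x - proj x)"
    using o by (simp add: inner_diff inner_commute)
  finally have eq: "reduced \<eta> \<nu> x \<bullet> x =
      B \<eta> (proj x) \<bullet> proj x - \<nu> * (N (proj x) \<bullet> proj x) + (x - proj x) \<bullet> (x - proj x)" .
  have "\<nu> * (N (proj x) \<bullet> proj x) \<le> \<beta> * (N (proj x) \<bullet> proj x)"
    using N_nonneg assms(2) by (intro mult_right_mono) auto
  moreover have "\<beta> * (N (proj x) \<bullet> proj x) + \<kappa> * (proj x \<bullet> proj x) \<le> B \<eta> (proj x) \<bullet> proj x"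
    by (rule gap[OF \<eta>]) auto
  moreover have "min \<kappa> 1 * (proj x \<bullet> proj x) \<le> \<kappa> * (proj x \<bullet> proj x)"
    "min \<kappa> 1 * ((x - proj x) \<bullet> (x - proj x)) \<le> 1 * ((x - proj x) \<bullet> (x - proj x))"
    by (intro mult_right_mono; simp)+
  ultimately show ?thesis unfolding eq split distrib_left by linarith
qed

lemma reduced_proj:
  assumes "proj (reduced \<eta> \<nu> x) = reduced \<eta> \<nu> x"
  shows "proj x = x"
  using assms by (simp add: reduced_apply blinfun.add_right blinfun.diff_right blinfun.scaleR_right)

lemma reduced_inverse:
  assumes "\<eta> \<in> V" "\<nu> \<le> \<beta>"
  obtains R :: "'h \<Rightarrow>\<^sub>L 'h" where "\<And>x. reduced \<eta> \<nu> (R x) = x" "\<And>x. norm (R x) \<le> norm x / min \<kappa> 1"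
  using lax_milgram[of "min \<kappa> 1" "reduced \<eta> \<nu>"] reduced_coercive[OF assms] \<kappa> by auto

text \<open>For \<open>\<nu> \<le> \<langle>B e, e\<rangle>\<close> the mean-zero part \<open>w\<^sub>\<nu>\<close> of the eigenvalue equation has a unique solution, which depends
Lipschitz continuously on \<open>\<nu>\<close>. The remaining scalar equation \<open>\<langle>B (e + w\<^sub>\<nu>), e\<rangle> = \<nu>\<close> is solved by the
intermediate value theorem: at \<open>\<nu> = 0\<close> the left side is \<open>\<langle>B (e + w\<^sub>0), e + w\<^sub>0\<rangle> \<ge> 0\<close>, and at \<open>\<nu> = \<langle>B e, e\<rangle>\<close> the
correction \<open>\<langle>B w\<^sub>\<nu>, e\<rangle>\<close> is minus a coercive form, hence not positive.\<close>

lemma ex_low_eigen: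
  assumes \<eta>: "\<eta> \<in> V"
  obtains \<nu> w where "\<nu> < \<beta>" "proj w = w" "reduced \<eta> \<nu> w = - proj (B \<eta> e)"
    "B \<eta> (e + w) \<bullet> e = \<nu>"
proof -
  define \<Lambda> where "\<Lambda> = B \<eta> e \<bullet> e"
  have \<Lambda>: "0 \<le> \<Lambda>" "\<Lambda> < \<beta>" using B_nonneg[OF \<eta>] low[OF \<eta>] by (auto simp: \<Lambda>_def)
  have "\<exists>w. reduced \<eta> \<nu> w = - proj (B \<eta> e) \<and> norm w \<le> norm (proj (B \<eta> e)) / min \<kappa> 1" if "\<nu> \<le> \<Lambda>" for \<nu>
  proof -
    obtain R where "\<And>x. reduced \<eta> \<nu> (blinfun_apply R x) = x" "\<And>x. norm (blinfun_apply R x) \<le> norm x / min \<kappa> 1"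
      using reduced_inverse[OF \<eta> order_trans[OF \<open>\<nu> \<le> \<Lambda>\<close> less_imp_le[OF \<Lambda>(2)]]] by blast
    from this(1)[of "- proj (B \<eta> e)"] this(2)[of "- proj (B \<eta> e)"] show ?thesis
      unfolding norm_minus_cancel by blast
  qed
  then obtain w where w: "\<And>\<nu>. \<nu> \<le> \<Lambda> \<Longrightarrow> reduced \<eta> \<nu> (w \<nu>) = - proj (B \<eta> e)"
      and nw: "\<And>\<nu>. \<nu> \<le> \<Lambda> \<Longrightarrow> norm (w \<nu>) \<le> norm (proj (B \<eta> e)) / min \<kappa> 1"
    by metis
  have pw: "proj (w \<nu>) = w \<nu>" if "\<nu> \<le> \<Lambda>" for \<nu>
    by (rule reduced_proj[of \<eta> \<nu>]) (simp add: w[OF that] blinfun.minus_right)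
  define F where "F \<nu> = B \<eta> (e + w \<nu>) \<bullet> e - \<nu>" for \<nu>
  have lip: "norm (w \<nu> - w \<mu>) \<le> (norm N * (norm (proj (B \<eta> e)) / min \<kappa> 1) / min \<kappa> 1) * \<bar>\<nu> - \<mu>\<bar>"
    if "\<nu> \<le> \<Lambda>" "\<mu> \<le> \<Lambda>" for \<nu> \<mu>
  proof -
    let ?d = "w \<nu> - w \<mu>"
    have "reduced \<eta> \<nu> ?d = (\<nu> - \<mu>) *\<^sub>R N (w \<mu>)"
    proof -
      have "reduced \<eta> \<nu> (w \<mu>) = reduced \<eta> \<mu> (w \<mu>) - (\<nu> - \<mu>) *\<^sub>R N (w \<mu>)"
        by (simp add: reduced_apply pw[OF that(2)] algebra_simps)
      then show ?thesis by (simp add: blinfun.diff_right w that)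
    qed
    then have "min \<kappa> 1 * (norm ?d)\<^sup>2 \<le> ((\<nu> - \<mu>) *\<^sub>R N (w \<mu>)) \<bullet> ?d"
      using reduced_coercive[OF \<eta>, of \<nu> ?d] that \<Lambda> by (simp add: power2_norm_eq_inner)
    also have "\<dots> \<le> norm ((\<nu> - \<mu>) *\<^sub>R N (w \<mu>)) * norm ?d" by (rule norm_cauchy_schwarz)
    finally have "norm ?d * (min \<kappa> 1 * norm ?d) \<le> norm ?d * norm ((\<nu> - \<mu>) *\<^sub>R N (w \<mu>))"
      by (simp add: power2_eq_square mult_ac)
    then have "min \<kappa> 1 * norm ?d \<le> norm ((\<nu> - \<mu>) *\<^sub>R N (w \<mu>))"
    proof (cases "?d = 0")
      case True
      then have "min \<kappa> 1 * norm ?d = 0" by (simp only: norm_zero mult_zero_right)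
      then show ?thesis by (simp only: norm_ge_zero)
    next
      case False
      then have "norm ?d > 0" by (simp only: zero_less_norm_iff not_False_eq_True)
      then show ?thesis
        using \<open>norm ?d * (min \<kappa> 1 * norm ?d) \<le> _\<close> mult_left_le_imp_le by blast
    qed
    also have "\<dots> \<le> \<bar>\<nu> - \<mu>\<bar> * (norm N * (norm (proj (B \<eta> e)) / min \<kappa> 1))"
      unfolding norm_scaleR using nw[OF that(2)]
      by (intro mult_left_mono order_trans[OF norm_blinfun]) auto
    finally show ?thesis using \<kappa> by (simp add: field_simps)
  qed
  have "continuous_on {0..\<Lambda>} w"
  proof (rule lipschitz_on_continuous_on, rule lipschitz_onI)
    show "dist (w \<nu>) (w \<mu>) \<le> (norm N * (norm (proj (B \<eta> e)) / min \<kappa> 1) / min \<kappa> 1) * dist \<nu> \<mu>"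
      if "\<nu> \<in> {0..\<Lambda>}" "\<mu> \<in> {0..\<Lambda>}" for \<nu> \<mu>
      using lip[of \<nu> \<mu>] that by (simp only: dist_norm atLeastAtMost_iff real_norm_def)
    have "min \<kappa> 1 \<ge> 0" using \<kappa> by simp
    then show "0 \<le> norm N * (norm (proj (B \<eta> e)) / min \<kappa> 1) / min \<kappa> 1"
      by (intro divide_nonneg_nonneg mult_nonneg_nonneg norm_ge_zero)
  qed
  then have "continuous_on {0..\<Lambda>} F"
    unfolding F_def by (intro continuous_intros)
  moreover have "0 \<le> F 0"
  proof -
    have p0: "proj (B \<eta> (e + w 0)) = 0"
      using w[of 0] pw[of 0] \<Lambda> by (simp add: reduced_apply blinfun.add_right)
    have "B \<eta> (e + w 0) \<bullet> w 0 = proj (B \<eta> (e + w 0)) \<bullet> w 0"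
      using pw[of 0] \<Lambda> by (metis proj_sym)
    then have "B \<eta> (e + w 0) \<bullet> e = B \<eta> (e + w 0) \<bullet> (e + w 0)"
      by (simp add: inner_add_right p0)
    then show ?thesis using B_nonneg[OF \<eta>, of "e + w 0"] by (simp add: F_def)
  qed
  moreover have "F \<Lambda> \<le> 0"
  proof -
    have "B \<eta> (w \<Lambda>) \<bullet> e = w \<Lambda> \<bullet> proj (B \<eta> e)"
      using pw[of \<Lambda>] by (metis B_sym[OF \<eta>] order_refl proj_sym)
    also have "\<dots> = - (reduced \<eta> \<Lambda> (w \<Lambda>) \<bullet> w \<Lambda>)"
      by (simp add: w inner_commute)
    also have "\<dots> \<le> 0"
    proof -
      have "0 \<le> min \<kappa> 1 * (w \<Lambda> \<bullet> w \<Lambda>)"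
        using \<kappa> by (intro mult_nonneg_nonneg) auto
      then show ?thesis
        using reduced_coercive[OF \<eta> less_imp_le[OF \<Lambda>(2)], of "w \<Lambda>"] by linarith
    qed
    finally show ?thesis by (simp add: F_def blinfun.add_right inner_add_left \<Lambda>_def)
  qed
  ultimately obtain \<nu> where "0 \<le> \<nu>" "\<nu> \<le> \<Lambda>" "F \<nu> = 0"
    using IVT2'[of F \<Lambda> 0 0] \<Lambda> by auto
  then show ?thesis using that[of \<nu> "w \<nu>"] w pw \<Lambda> by (simp add: F_def)
qed

text \<open>Around an eigenvector \<open>e + w\<^sub>0\<close> put \<open>w = w\<^sub>0 + h\<close>. Replacing the eigenvalue by \<open>\<langle>B (e + w), e\<rangle>\<close>, to which it must
be equal, turns the mean-zero part of the eigenvalue equation into a quadratic equation for \<open>h\<close>. Its linear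
part at \<open>\<eta>\<^sub>0\<close> is invertible, so \<open>h\<close> is a fixed point as in \<open>analytic_quadratic_fixed_point\<close>, and the
eigenvalue is analytic. By continuity it stays below \<open>\<beta>\<close>, so it is the least one.\<close>

theorem Least_eigen_analytic:
  assumes \<eta>0: "\<eta>\<^sub>0 \<in> V"
  shows "analytic_germ (\<lambda>\<eta>. LEAST \<mu>. \<exists>u. eigen \<eta> \<mu> u) \<eta>\<^sub>0"
proof -
  obtain \<nu>\<^sub>0 w\<^sub>0 where l0: "\<nu>\<^sub>0 < \<beta>" and w0: "proj w\<^sub>0 = w\<^sub>0"
    and Sw0: "reduced \<eta>\<^sub>0 \<nu>\<^sub>0 w\<^sub>0 = - proj (B \<eta>\<^sub>0 e)" and lam0: "B \<eta>\<^sub>0 (e + w\<^sub>0) \<bullet> e = \<nu>\<^sub>0"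
    using ex_low_eigen[OF \<eta>0] .
  define S where "S = reduced \<eta>\<^sub>0 \<nu>\<^sub>0"
  obtain R :: "'h \<Rightarrow>\<^sub>L 'h" where R: "\<And>x. S (R x) = x"
    by (rule reduced_inverse[OF \<eta>0 less_imp_le[OF l0]], fold S_def) (rule that)
  have n0: "1 + N w\<^sub>0 \<bullet> w\<^sub>0 > 0" using N_nonneg[of w\<^sub>0] by simp
  define l where "l \<eta> = blinfun_inner_right e o\<^sub>L B \<eta> o\<^sub>L proj" for \<eta>
  have l: "l \<eta> h = B \<eta> (proj h) \<bullet> e" for \<eta> h by (simp add: l_def inner_commute)
  define D where "D \<eta> = (proj o\<^sub>L B \<eta> o\<^sub>L proj) + (id_blinfun - proj)
      - (B \<eta> (e + w\<^sub>0) \<bullet> e) *\<^sub>R (N o\<^sub>L proj) - (blinfun_scaleR_left (N w\<^sub>0) o\<^sub>L l \<eta>)" for \<eta>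
  have D: "D \<eta> h = proj (B \<eta> (proj h)) + (h - proj h) - (B \<eta> (e + w\<^sub>0) \<bullet> e) *\<^sub>R N (proj h)
      - (B \<eta> (proj h) \<bullet> e) *\<^sub>R N w\<^sub>0" for \<eta> h
    by (simp add: D_def blinfun.diff_left blinfun.add_left blinfun.scaleR_left blinfun_scaleR_left.rep_eq l)
  \<comment> \<open>The linearization at the solution is a rank-one perturbation of the coercive operator \<open>S\<close>.\<close>
  have D0: "D \<eta>\<^sub>0 h = S h + (S w\<^sub>0 \<bullet> h) *\<^sub>R N w\<^sub>0" for h
  proof -
    have "B \<eta>\<^sub>0 (proj h) \<bullet> e = - (S w\<^sub>0 \<bullet> h)"
      using Sw0 by (simp add: S_def) (metis B_sym[OF \<eta>0] proj_sym inner_commute)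
    then show ?thesis by (simp add: D lam0) (simp add: S_def reduced_apply)
  qed
  \<comment> \<open>The inverse of the linearization, by the Sherman--Morrison formula.\<close>
  define T where "T = R - (blinfun_scaleR_left (R (N w\<^sub>0)) o\<^sub>L blinfun_inner_right (w\<^sub>0 /\<^sub>R (1 + N w\<^sub>0 \<bullet> w\<^sub>0)))"
  have T: "T r = R r - ((w\<^sub>0 \<bullet> r) / (1 + N w\<^sub>0 \<bullet> w\<^sub>0)) *\<^sub>R R (N w\<^sub>0)" for r
    by (simp add: T_def blinfun.diff_left blinfun_scaleR_left.rep_eq divide_inverse mult.commute)
  have DT: "D \<eta>\<^sub>0 (T r) = r" for r
  proof -
    define s where "s = (w\<^sub>0 \<bullet> r) / (1 + N w\<^sub>0 \<bullet> w\<^sub>0)"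
    have ST: "S (T r) = r - s *\<^sub>R N w\<^sub>0"
      by (simp add: T s_def blinfun.diff_right blinfun.scaleR_right R)
    have "S w\<^sub>0 \<bullet> T r = w\<^sub>0 \<bullet> S (T r)" unfolding S_def by (rule reduced_sym[OF \<eta>0])
    also have "\<dots> = s * (1 + N w\<^sub>0 \<bullet> w\<^sub>0) - s * (N w\<^sub>0 \<bullet> w\<^sub>0)"
      using n0 by (simp add: ST inner_diff_right inner_commute) (simp add: s_def inner_commute)
    also have "\<dots> = s" by (simp add: algebra_simps)
    finally show ?thesis by (simp add: D0 ST)
  qed
  define p where "p \<eta> = - T (proj (B \<eta> (e + w\<^sub>0)) - (B \<eta> (e + w\<^sub>0) \<bullet> e) *\<^sub>R N w\<^sub>0)" for \<eta>
  define P where "P \<eta> = T o\<^sub>L (D \<eta>\<^sub>0 - D \<eta>)" for \<eta>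
  \<comment> \<open>The quadratic term \<open>\<langle>B h, e\<rangle> N h\<close>, with the functional of the first \<open>h\<close> as a scalar factor.\<close>
  define q where "q \<eta> = blinfun_scaleR_left (T o\<^sub>L N o\<^sub>L proj) o\<^sub>L l \<eta>" for \<eta>
  have gB: "analytic_germ B \<eta>\<^sub>0" by (rule B_analytic[OF \<eta>0])
  have comp_left: "analytic_germ (\<lambda>\<eta>. X o\<^sub>L f \<eta>) \<eta>\<^sub>0" if "analytic_germ f \<eta>\<^sub>0"
    for X :: "'b::banach \<Rightarrow>\<^sub>L 'c::banach" and f :: "_ \<Rightarrow> 'a::banach \<Rightarrow>\<^sub>L 'b"
    by (rule analytic_germ_bilinear[OF bounded_bilinear_blinfun_compose analytic_germ_const that])
  have comp_right: "analytic_germ (\<lambda>\<eta>. f \<eta> o\<^sub>L X) \<eta>\<^sub>0" if "analytic_germ f \<eta>\<^sub>0"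
    for X :: "'a::banach \<Rightarrow>\<^sub>L 'b::banach" and f :: "_ \<Rightarrow> 'b::banach \<Rightarrow>\<^sub>L 'c::banach"
    by (rule analytic_germ_bilinear[OF bounded_bilinear_blinfun_compose that analytic_germ_const])
  have app: "analytic_germ (\<lambda>\<eta>. B \<eta> (f \<eta>)) \<eta>\<^sub>0" if "analytic_germ f \<eta>\<^sub>0" for f
    by (rule analytic_germ_bilinear[OF bounded_bilinear_blinfun_apply gB that])
  have capp: "analytic_germ (\<lambda>\<eta>. X (f \<eta>)) \<eta>\<^sub>0" if "analytic_germ f \<eta>\<^sub>0" for X :: "'h \<Rightarrow>\<^sub>L 'h" and f
    by (rule analytic_germ_linear[OF blinfun.bounded_linear_right that])
  have inn: "analytic_germ (\<lambda>\<eta>. f \<eta> \<bullet> e) \<eta>\<^sub>0" if "analytic_germ f \<eta>\<^sub>0" for f :: "_ \<Rightarrow> 'h"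
    by (rule analytic_germ_linear[OF bounded_linear_inner_left that])
  have sc: "analytic_germ (\<lambda>\<eta>. f \<eta> *\<^sub>R y) \<eta>\<^sub>0" if "analytic_germ f \<eta>\<^sub>0" for f and y :: "'a::banach"
    by (rule analytic_germ_linear[OF bounded_linear_scaleR_left that])
  have gl: "analytic_germ l \<eta>\<^sub>0" unfolding l_def by (intro comp_left comp_right gB)
  have gD: "analytic_germ D \<eta>\<^sub>0"
    unfolding D_def
    by (intro analytic_germ_add analytic_germ_diff analytic_germ_const comp_left comp_right sc inn app gB gl)
  have gp: "analytic_germ p \<eta>\<^sub>0"
    unfolding p_def by (intro analytic_germ_minus capp analytic_germ_diff app sc inn analytic_germ_const)
  have gP: "analytic_germ P \<eta>\<^sub>0"
    unfolding P_def by (intro comp_left analytic_germ_diff analytic_germ_const gD)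
  have gq: "analytic_germ q \<eta>\<^sub>0" unfolding q_def by (intro comp_left gl)
  have "proj (B \<eta>\<^sub>0 (e + w\<^sub>0)) = \<nu>\<^sub>0 *\<^sub>R N w\<^sub>0"
    using Sw0 w0 by (simp add: reduced_apply blinfun.add_right algebra_simps)
  then have p0: "p \<eta>\<^sub>0 = 0" by (simp add: p_def lam0)
  have P0: "P \<eta>\<^sub>0 = 0" by (rule blinfun_eqI) (simp add: P_def)
  obtain h d where h: "analytic_germ h \<eta>\<^sub>0" "h \<eta>\<^sub>0 = 0" "d > 0"
    and fix_h: "\<And>\<eta>. norm (\<eta> - \<eta>\<^sub>0) < d \<Longrightarrow> h \<eta> = p \<eta> + P \<eta> (h \<eta>) + q \<eta> (h \<eta>) (h \<eta>)"
    using analytic_quadratic_fixed_point[OF gp p0 gP P0 gq] by blast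
  define w where "w \<eta> = w\<^sub>0 + h \<eta>" for \<eta>
  define \<Lambda> where "\<Lambda> \<eta> = B \<eta> (e + proj (w \<eta>)) \<bullet> e" for \<eta>
  have g\<Lambda>: "analytic_germ \<Lambda> \<eta>\<^sub>0"
    unfolding \<Lambda>_def w_def by (intro inn app analytic_germ_add analytic_germ_const capp h)
  have "\<Lambda> \<eta>\<^sub>0 = \<nu>\<^sub>0" by (simp add: \<Lambda>_def w_def h(2) w0 lam0)
  then obtain d' where d': "d' > 0" "\<And>\<eta>. norm (\<eta> - \<eta>\<^sub>0) < d' \<Longrightarrow> norm (\<Lambda> \<eta> - \<nu>\<^sub>0) < \<beta> - \<nu>\<^sub>0"
    using analytic_germ_tendsto[OF g\<Lambda>, of "\<beta> - \<nu>\<^sub>0"] l0 by auto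
  obtain d'' where d'': "d'' > 0" "ball \<eta>\<^sub>0 d'' \<subseteq> V"
    using open_V \<eta>0 open_contains_ball by metis
  show ?thesis
  proof (rule analytic_germ_cong[OF g\<Lambda>])
    show "min d (min d' d'') > 0" using h d' d'' by simp
    fix \<eta> assume near: "norm (\<eta> - \<eta>\<^sub>0) < min d (min d' d'')"
    then have \<eta>: "\<eta> \<in> V" using d''(2) by (auto simp: dist_norm norm_minus_commute subset_iff)
    have "\<Lambda> \<eta> < \<beta>" using d'(2)[of \<eta>] near by auto
    let ?h = "h \<eta>"
    have "D \<eta>\<^sub>0 ?h = D \<eta>\<^sub>0 (p \<eta> + P \<eta> ?h + q \<eta> ?h ?h)" using fix_h[of \<eta>] near by simp
    also have "\<dots> = - (proj (B \<eta> (e + w\<^sub>0)) - (B \<eta> (e + w\<^sub>0) \<bullet> e) *\<^sub>R N w\<^sub>0)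
        + (D \<eta>\<^sub>0 ?h - D \<eta> ?h) + (B \<eta> (proj ?h) \<bullet> e) *\<^sub>R N (proj ?h)"
    proof -
      have "D \<eta>\<^sub>0 (p \<eta>) = - (proj (B \<eta> (e + w\<^sub>0)) - (B \<eta> (e + w\<^sub>0) \<bullet> e) *\<^sub>R N w\<^sub>0)"
        unfolding p_def blinfun.minus_right[of "D \<eta>\<^sub>0"] DT ..
      moreover have "D \<eta>\<^sub>0 (P \<eta> ?h) = D \<eta>\<^sub>0 ?h - D \<eta> ?h"
        by (simp add: P_def DT blinfun.diff_left)
      moreover have "D \<eta>\<^sub>0 (q \<eta> ?h ?h) = (B \<eta> (proj ?h) \<bullet> e) *\<^sub>R N (proj ?h)"
        by (simp add: q_def DT blinfun.scaleR_left blinfun.scaleR_right l)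
      ultimately show ?thesis by (simp only: blinfun.add_right[of "D \<eta>\<^sub>0"])
    qed
    finally have "(proj (B \<eta> (e + w\<^sub>0)) - (B \<eta> (e + w\<^sub>0) \<bullet> e) *\<^sub>R N w\<^sub>0) + D \<eta> ?h
        - (B \<eta> (proj ?h) \<bullet> e) *\<^sub>R N (proj ?h) = 0"
      by (simp add: algebra_simps)
    \<comment> \<open>The equation for \<open>h\<close>, rewritten as the reduced eigenvalue equation for \<open>w = w\<^sub>0 + h\<close>.\<close>
    then have zero: "proj (B \<eta> (e + proj (w \<eta>))) - \<Lambda> \<eta> *\<^sub>R N (proj (w \<eta>)) + (w \<eta> - proj (w \<eta>)) = 0"
      by (simp add: D \<Lambda>_def w_def blinfun.add_right w0 inner_add_left algebra_simps)
    then have "proj (proj (B \<eta> (e + proj (w \<eta>))) - \<Lambda> \<eta> *\<^sub>R N (proj (w \<eta>)) + (w \<eta> - proj (w \<eta>))) = 0"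
      by simp
    then have red: "proj (B \<eta> (e + proj (w \<eta>))) = \<Lambda> \<eta> *\<^sub>R N (proj (w \<eta>))"
      by (simp add: blinfun.add_right blinfun.diff_right blinfun.scaleR_right)
    have "B \<eta> (e + proj (w \<eta>)) = \<Lambda> \<eta> *\<^sub>R N (e + proj (w \<eta>))"
      by (rule eigen_if_reduced[OF \<eta> _ red]) (auto simp: \<Lambda>_def)
    moreover have "e + proj (w \<eta>) \<noteq> 0"
      using e_unit proj_perp(1)[of "w \<eta>"] by (metis add_cancel_left_left inner_add_left inner_zero_left one_neq_zero)
    ultimately have "eigen \<eta> (\<Lambda> \<eta>) (e + proj (w \<eta>))" by (simp add: eigen_def)
    from Least_eigen[OF \<eta> this \<open>\<Lambda> \<eta> < \<beta>\<close>]
    show "\<Lambda> \<eta> = (LEAST \<mu>. \<exists>u. eigen \<eta> \<mu> u)" by simp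
  qed
qed

end

section \<open>Exponentials and integration over the period cell\<close>

lemma cell_borel: "(cell :: (real^'n) set) \<in> sets borel"
proof -
  have eq: "cell = (\<Inter>i\<in>UNIV. {y::real^'n. 0 \<le> y $ i} \<inter> {y. y $ i < 2 * pi})"
    by (auto simp: cell_def)
  have "closed {y::real^'n. 0 \<le> y $ i}" "open {y::real^'n. y $ i < 2 * pi}" for i
    by (intro closed_Collect_le open_Collect_less continuous_intros)+
  then show ?thesis
    unfolding eq by (intro sets.finite_INT sets.Int borel_open borel_closed) auto
qed

definition closed_cell :: "(real^'n) set" where
  "closed_cell = {y. \<forall>i. 0 \<le> y $ i \<and> y $ i \<le> 2 * pi}"

lemma closed_cell_cbox: "closed_cell = cbox 0 (\<chi> i. 2 * pi)"
  by (auto simp: closed_cell_def cbox_interval less_eq_vec_def)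

lemma compact_closed_cell: "compact closed_cell"
  unfolding closed_cell_cbox by (rule compact_cbox)

lemma cell_subset_closed_cell: "cell \<subseteq> closed_cell"
  by (auto simp: cell_def closed_cell_def less_imp_le)

lemma cell_lmeasurable: "(cell :: (real^'n) set) \<in> lmeasurable"
  by (rule bounded_set_imp_lmeasurable)
    (use cell_borel compact_imp_bounded[OF compact_closed_cell] cell_subset_closed_cell bounded_subset in auto)

lemma cell_lebesgue [simp]: "(cell :: (real^'n) set) \<in> sets lebesgue"
  using cell_borel by auto

abbreviation cell_measure :: "(real^'n) measure" where
  "cell_measure \<equiv> lebesgue_on cell"

lemma finite_cell_measure: "finite_measure cell_measure"
  by (rule finite_measure_lebesgue_on[OF cell_lmeasurable])

lemma set_integral_cell:
  fixes f :: "real^'n \<Rightarrow> 'b::{banach, second_countable_topology}"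
  shows "set_lebesgue_integral lebesgue cell f = integral\<^sup>L cell_measure f"
  unfolding set_lebesgue_integral_def by (subst integral_restrict_space) auto

lemma set_integrable_cell:
  fixes f :: "real^'n \<Rightarrow> 'b::{banach, second_countable_topology}"
  shows "set_integrable lebesgue cell f \<longleftrightarrow> integrable cell_measure f"
  unfolding set_integrable_def by (subst integrable_restrict_space) auto

lemma AE_cell: "(AE y in cell_measure. P y) \<longleftrightarrow> (AE y in lebesgue. y \<in> cell \<longrightarrow> P y)"
  by (rule AE_restrict_space_iff) auto

lemma measurable_cell: "f \<in> borel_measurable lebesgue \<Longrightarrow> f \<in> borel_measurable cell_measure"
  by (rule measurable_restrict_space1)

lemma continuous_measurable_cell:
  "continuous_on UNIV f \<Longrightarrow> f \<in> borel_measurable (cell_measure :: (real^'n) measure)"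
  using borel_measurable_continuous_onI[of f] by (intro measurable_cell measurable_completion) auto

lemma continuous_bounded_cell:
  fixes f :: "real^'n \<Rightarrow> 'b::real_normed_vector"
  assumes "continuous_on UNIV f"
  obtains B where "B \<ge> 0" "\<And>y. y \<in> cell \<Longrightarrow> norm (f y) \<le> B"
proof -
  have "bounded (f ` closed_cell)"
    by (intro compact_imp_bounded compact_continuous_image compact_closed_cell)
      (rule continuous_on_subset[OF assms subset_UNIV])
  then obtain B where "\<And>y. y \<in> closed_cell \<Longrightarrow> norm (f y) \<le> B" by (auto simp: bounded_iff)
  then show ?thesis
    using that[of "max 0 B"] cell_subset_closed_cell by (metis max.cobounded1 max.coboundedI2 subsetD)
qed

lemma continuous_integrable_cell:
  fixes f :: "real^'n \<Rightarrow> 'b::{banach, second_countable_topology}"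
  assumes "continuous_on UNIV f"
  shows "integrable cell_measure f"
proof -
  obtain B where B: "\<And>y. y \<in> cell \<Longrightarrow> norm (f y) \<le> B" using continuous_bounded_cell[OF assms] by blast
  show ?thesis
    by (rule finite_measure.integrable_const_bound[OF finite_cell_measure, of _ B])
      (auto intro!: continuous_measurable_cell assms simp: AE_cell B)
qed

definition vol :: "'n::finite itself \<Rightarrow> real" where
  "vol _ = measure lebesgue (cell :: (real^'n) set)"

lemma vol_pos: "vol TYPE('n::finite) > 0"
proof -
  have sub: "box (0::real^'n) (\<chi> i. 2 * pi) \<subseteq> cell"
    by (auto simp: cell_def less_imp_le mem_box_cart)
  have "measure lebesgue (box (0::real^'n) (\<chi> i. 2 * pi)) \<le> vol TYPE('n)"
    unfolding vol_def by (rule measure_mono_fmeasurable[OF sub _ cell_lmeasurable]) auto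
  moreover have "measure lebesgue (box (0::real^'n) (\<chi> i. 2 * pi)) > 0"
  proof -
    have "box (0::real^'n) (\<chi> i. 2 * pi) \<noteq> {}"
      using pi_gt_zero by (auto simp: box_ne_empty inner_Basis_inf_left Basis_vec_def inner_axis)
    then have "\<not> negligible (box (0::real^'n) (\<chi> i. 2 * pi))"
      using open_not_negligible[OF open_box] by blast
    then show ?thesis by (simp add: negligible_iff_measure less_le)
  qed
  ultimately show ?thesis by simp
qed

lemma integral_const_cell: "integral\<^sup>L (cell_measure :: (real^'n) measure) (\<lambda>_. c) = vol TYPE('n) *\<^sub>R (c::complex)"
proof -
  have "measure (cell_measure :: (real^'n) measure) (space cell_measure) = vol TYPE('n)"
    by (simp add: vol_def measure_restrict_space)
  then show ?thesis by simp
qed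

subsection \<open>Integrals of derivatives of periodic functions vanish\<close>

lemma axis_int_vecs: "axis i 1 \<in> int_vecs"
  by (auto simp: int_vecs_def axis_def)

lemma lborel_integral_shift:
  fixes f :: "'a::euclidean_space \<Rightarrow> 'b::{banach, second_countable_topology}"
  assumes [measurable]: "f \<in> borel_measurable borel"
  shows "integral\<^sup>L lborel (\<lambda>y. f (y + a)) = integral\<^sup>L lborel f"
proof -
  have "integral\<^sup>L lborel f = integral\<^sup>L (distr lborel borel ((+) a)) f" by (simp add: lborel_distr_plus)
  also have "\<dots> = integral\<^sup>L lborel (\<lambda>y. f (a + y))" by (rule integral_distr) auto
  finally show ?thesis by (simp add: add.commute)
qed

lemma integral_cell_lborel:
  fixes f :: "real^'n \<Rightarrow> 'b::{banach, second_countable_topology}"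
  assumes "f \<in> borel_measurable borel"
  shows "integral\<^sup>L cell_measure f = integral\<^sup>L lborel (\<lambda>y. indicator cell y *\<^sub>R f y)"
proof -
  note [measurable] = assms cell_borel
  show ?thesis
    by (subst integral_restrict_space) (auto intro!: integral_completion)
qed

text \<open>A shift by \<open>t\<close> along one coordinate moves a slab of the cell out of it, and the part that is lost is the
part that is gained, shifted by the period.\<close>

lemma integral_cell_shift:
  fixes f :: "real^'n \<Rightarrow> complex"
  assumes f: "continuous_on UNIV f" and per: "\<And>p y. p \<in> int_vecs \<Longrightarrow> f (y + (2 * pi) *\<^sub>R p) = f y"
    and t: "0 \<le> t" "t \<le> 2 * pi"
  shows "integral\<^sup>L cell_measure (\<lambda>y. f (y + t *\<^sub>R axis j 1)) = integral\<^sup>L cell_measure f"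
proof -
  define S1 S2 :: "(real^'n) set" where "S1 = cell \<inter> {y. t \<le> y $ j}" and "S2 = cell \<inter> {y. y $ j < t}"
  have "closed {y::real^'n. t \<le> y $ j}" "open {y::real^'n. y $ j < t}"
    by (intro closed_Collect_le open_Collect_less continuous_intros)+
  then have [measurable]: "S1 \<in> sets borel" "S2 \<in> sets borel" "cell \<in> sets (borel :: (real^'n) measure)"
    using cell_borel by (auto simp: S1_def S2_def)
  have [measurable]: "f \<in> borel_measurable borel" by (rule borel_measurable_continuous_onI[OF f])
  define e :: "real^'n" where "e = axis j 1"
  have cc: "integrable lborel (\<lambda>y. indicator closed_cell y *\<^sub>R f y)"
    by (rule borel_integrable_compact[OF compact_closed_cell continuous_on_subset[OF f]]) simp
  have int: "integrable lborel (\<lambda>y. indicator S y *\<^sub>R f y)" if "S \<in> sets borel" "S \<subseteq> cell" for S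
  proof -
    have "integrable lborel (\<lambda>y. indicator S y *\<^sub>R (indicator closed_cell y *\<^sub>R f y))"
      by (rule integrable_mult_indicator[OF _ cc]) (use that in auto)
    also have "(\<lambda>y. indicator S y *\<^sub>R (indicator closed_cell y *\<^sub>R f y)) = (\<lambda>y. indicator S y *\<^sub>R f y)"
      using that(2) cell_subset_closed_cell by (auto simp: indicator_def fun_eq_iff)
    finally show ?thesis .
  qed
  have i2: "integral\<^sup>L lborel (\<lambda>y. indicator S2 (y - (2 * pi) *\<^sub>R e) *\<^sub>R f y) = integral\<^sup>L lborel (\<lambda>y. indicator S2 y *\<^sub>R f y)"
  proof -
    have "f (y - (2 * pi) *\<^sub>R e) = f y" for y
      using per[OF axis_int_vecs[of j], of "y - (2 * pi) *\<^sub>R e"] by (simp add: e_def)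
    then show ?thesis
      using lborel_integral_shift[of "\<lambda>y. indicator S2 y *\<^sub>R f y" "- ((2 * pi) *\<^sub>R e)"] by simp
  qed
  have int2: "integrable lborel (\<lambda>y. indicator S2 (y - (2 * pi) *\<^sub>R e) *\<^sub>R f y)"
  proof -
    have "integrable (distr lborel borel ((+) (- ((2 * pi) *\<^sub>R e)))) (\<lambda>y. indicator S2 y *\<^sub>R f y)"
      unfolding lborel_distr_plus by (rule int) (auto simp: S2_def)
    then have "integrable lborel (\<lambda>y. indicator S2 (- ((2 * pi) *\<^sub>R e) + y) *\<^sub>R f (- ((2 * pi) *\<^sub>R e) + y))"
      by (subst (asm) integrable_distr_eq) auto
    moreover have "f (- ((2 * pi) *\<^sub>R e) + y) = f y" for y
      using per[OF axis_int_vecs[of j], of "y - (2 * pi) *\<^sub>R e"] by (simp add: e_def)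
    ultimately show ?thesis by simp
  qed
  have ind: "indicator cell (y - t *\<^sub>R e) = (indicator S1 y + indicator S2 (y - (2 * pi) *\<^sub>R e) :: real)" for y
  proof -
    have iff: "y - t *\<^sub>R e \<in> cell \<longleftrightarrow> (\<forall>i. i \<noteq> j \<longrightarrow> 0 \<le> y $ i \<and> y $ i < 2 * pi) \<and> t \<le> y $ j \<and> y $ j < 2 * pi + t" for t
      by (auto simp: cell_def e_def axis_def)
    have iff0: "y \<in> cell \<longleftrightarrow> (\<forall>i. i \<noteq> j \<longrightarrow> 0 \<le> y $ i \<and> y $ i < 2 * pi) \<and> 0 \<le> y $ j \<and> y $ j < 2 * pi"
      by (auto simp: cell_def)
    have S2: "y - (2 * pi) *\<^sub>R e \<in> S2 \<longleftrightarrow> y - (2 * pi) *\<^sub>R e \<in> cell \<and> y $ j < 2 * pi + t"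
      by (auto simp: S2_def e_def axis_def)
    show ?thesis
      unfolding indicator_def S2 S1_def Int_iff iff iff0 using t by auto
  qed
  have "integral\<^sup>L cell_measure (\<lambda>y. f (y + t *\<^sub>R axis j 1))
      = integral\<^sup>L lborel (\<lambda>y. indicator cell ((y + t *\<^sub>R e) - t *\<^sub>R e) *\<^sub>R f (y + t *\<^sub>R e))"
    by (subst integral_cell_lborel) (auto simp: e_def)
  also have "\<dots> = integral\<^sup>L lborel (\<lambda>y. indicator cell (y - t *\<^sub>R e) *\<^sub>R f y)"
    by (rule lborel_integral_shift[of "\<lambda>y. indicator cell (y - t *\<^sub>R e) *\<^sub>R f y"]) measurable
  also have "\<dots> = integral\<^sup>L lborel (\<lambda>y. indicator S1 y *\<^sub>R f y + indicator S2 (y - (2 * pi) *\<^sub>R e) *\<^sub>R f y)"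
    unfolding ind by (simp add: scaleR_add_left)
  also have "\<dots> = integral\<^sup>L lborel (\<lambda>y. indicator S1 y *\<^sub>R f y) + integral\<^sup>L lborel (\<lambda>y. indicator S2 y *\<^sub>R f y)"
    by (subst Bochner_Integration.integral_add) (auto intro!: int int2 simp: i2, auto simp: S1_def)
  also have "\<dots> = integral\<^sup>L lborel (\<lambda>y. indicator S1 y *\<^sub>R f y + indicator S2 y *\<^sub>R f y)"
    by (rule Bochner_Integration.integral_add[symmetric]; rule int) (auto simp: S1_def S2_def)
  also have "(\<lambda>y. indicator S1 y *\<^sub>R f y + indicator S2 y *\<^sub>R f y) = (\<lambda>y. indicator cell y *\<^sub>R f y)"
    by (auto simp: fun_eq_iff indicator_def S1_def S2_def)
  also have "integral\<^sup>L lborel \<dots> = integral\<^sup>L cell_measure f"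
    by (rule integral_cell_lborel[symmetric]) measurable
  finally show ?thesis .
qed

lemma partial_deriv_along:
  assumes "partial_deriv_is j f g"
  shows "((\<lambda>s. f (y + s *\<^sub>R axis j 1)) has_vector_derivative g (y + t *\<^sub>R axis j 1)) (at t)"
proof -
  have "((\<lambda>s. f ((y + t *\<^sub>R axis j 1) + s *\<^sub>R axis j 1)) has_vector_derivative g (y + t *\<^sub>R axis j 1)) (at (t - t))"
    using assms by (simp add: partial_deriv_is_def)
  moreover have "((\<lambda>s. s - t) has_vector_derivative 1) (at t)"
    by (auto intro!: derivative_eq_intros)
  ultimately have "((\<lambda>s. f ((y + t *\<^sub>R axis j 1) + s *\<^sub>R axis j 1)) \<circ> (\<lambda>s. s - t) has_vector_derivative
      1 *\<^sub>R g (y + t *\<^sub>R axis j 1)) (at t)"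
    by (intro vector_diff_chain_at)
  then show ?thesis by (simp add: o_def algebra_simps)
qed

text \<open>The difference quotients have integral zero by the shift invariance, and they converge boundedly to the
derivative. This is integration by parts on the torus without Fubini's theorem.\<close>

lemma integral_partial_deriv_zero:
  fixes f g :: "real^'n \<Rightarrow> complex"
  assumes f: "continuous_on UNIV f" and g: "continuous_on UNIV g"
    and per: "\<And>p y. p \<in> int_vecs \<Longrightarrow> f (y + (2 * pi) *\<^sub>R p) = f y"
    and deriv: "partial_deriv_is j f g"
  shows "integral\<^sup>L cell_measure g = 0"
proof -
  define e :: "real^'n" where "e = axis j 1"
  define s where "s n y = real (Suc n) *\<^sub>R (f (y + (1 / real (Suc n)) *\<^sub>R e) - f y)" for n y
  have "bounded (g ` cbox 0 (\<chi> i. 2 * pi + 1))"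
    by (intro compact_imp_bounded compact_continuous_image compact_cbox continuous_on_subset[OF g]) simp
  then obtain B where B: "\<And>y. y \<in> cbox 0 (\<chi> i. 2 * pi + 1) \<Longrightarrow> norm (g y) \<le> B"
    by (auto simp: bounded_iff)
  have in_box: "y + t *\<^sub>R e \<in> cbox 0 (\<chi> i. 2 * pi + 1)" if "y \<in> cell" "0 \<le> t" "t \<le> 1" for y t
    using that by (auto simp: cell_def mem_box_cart e_def axis_def) (smt (verit))+
  have s_cont: "continuous_on UNIV (s n)" for n
    unfolding s_def by (intro continuous_intros continuous_on_compose2[OF f]) auto
  have shift: "integral\<^sup>L cell_measure (s n) = 0" for n
  proof -
    have "integrable cell_measure (\<lambda>y. f (y + (1 / real (Suc n)) *\<^sub>R e))"
      by (intro continuous_integrable_cell continuous_on_compose2[OF f] continuous_intros) auto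
    moreover have "1 / real (Suc n) \<le> 2 * pi"
    proof -
      have "1 / real (Suc n) \<le> 1" by simp
      then show ?thesis using pi_ge_two by linarith
    qed
    ultimately show ?thesis
      unfolding s_def using integral_cell_shift[OF f per, of "1 / real (Suc n)" j] continuous_integrable_cell[OF f]
      by (simp add: e_def)
  qed
  have lim: "(\<lambda>n. s n y) \<longlonglongrightarrow> g y" for y
  proof -
    have "((\<lambda>t. f (y + t *\<^sub>R e)) has_derivative (\<lambda>h. h *\<^sub>R g y)) (at 0)"
      using deriv by (auto simp: partial_deriv_is_def e_def has_vector_derivative_def)
    then have "((\<lambda>h. norm (f (y + h *\<^sub>R e) - f y - h *\<^sub>R g y) / norm h) \<longlongrightarrow> 0) (at 0)"
      by (simp add: has_derivative_at)
    moreover have "filterlim (\<lambda>n. 1 / real (Suc n)) (at 0) sequentially"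
      unfolding filterlim_at using LIMSEQ_Suc[OF lim_1_over_n] by auto
    ultimately have "(\<lambda>n. norm (f (y + (1 / real (Suc n)) *\<^sub>R e) - f y - (1 / real (Suc n)) *\<^sub>R g y) / norm (1 / real (Suc n))) \<longlonglongrightarrow> 0"
      by (rule filterlim_compose)
    moreover have "norm (f (y + (1 / real (Suc n)) *\<^sub>R e) - f y - (1 / real (Suc n)) *\<^sub>R g y) / norm (1 / real (Suc n))
        = norm (s n y - g y)" for n
    proof -
      have "s n y - g y = real (Suc n) *\<^sub>R (f (y + (1 / real (Suc n)) *\<^sub>R e) - f y - (1 / real (Suc n)) *\<^sub>R g y)"
        by (simp add: s_def scaleR_diff_right del: of_nat_Suc)
      then show ?thesis by (simp only: norm_scaleR) (simp add: field_simps del: of_nat_Suc)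
    qed
    ultimately have "(\<lambda>n. norm (s n y - g y)) \<longlonglongrightarrow> 0" by simp
    then show ?thesis using Lim_null tendsto_norm_zero_iff by blast
  qed
  have bound: "norm (s n y) \<le> B" if y: "y \<in> cell" for n y
  proof -
    have d: "((\<lambda>t. f (y + t *\<^sub>R e)) has_derivative (\<lambda>h. h *\<^sub>R g (y + t *\<^sub>R e))) (at t within {0..1})" for t
      using partial_deriv_along[OF deriv, of y t]
      by (auto simp: e_def has_vector_derivative_def intro: has_derivative_at_withinI)
    have "norm (f (y + (1 / real (Suc n)) *\<^sub>R e) - f (y + 0 *\<^sub>R e)) \<le> B * norm (1 / real (Suc n) - 0)"
    proof (rule differentiable_bound[OF convex_real_interval(5)[of 0 1] d])
      show "onorm (\<lambda>h. h *\<^sub>R g (y + t *\<^sub>R e)) \<le> B" if "t \<in> {0..1}" for t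
        using B[OF in_box[OF y]] that by (subst onorm_scaleR_left) (auto simp: onorm_id bounded_linear_ident)
    qed auto
    then have "real (Suc n) * norm (f (y + (1 / real (Suc n)) *\<^sub>R e) - f y) \<le> real (Suc n) * (B * (1 / real (Suc n)))"
      by (intro mult_left_mono) auto
    then show ?thesis by (simp add: s_def del: of_nat_Suc)
  qed
  have "(\<lambda>n. integral\<^sup>L cell_measure (s n)) \<longlonglongrightarrow> integral\<^sup>L cell_measure g"
  proof (rule integral_dominated_convergence[where w = "\<lambda>_. B"])
    show "integrable (cell_measure :: (real^'n) measure) (\<lambda>_. B)"
      by (rule finite_measure.integrable_const[OF finite_cell_measure])
    show "AE y in cell_measure. (\<lambda>n. s n y) \<longlonglongrightarrow> g y" using lim by simp
    show "AE y in cell_measure. norm (s n y) \<le> B" for n by (simp add: AE_cell bound)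
  qed (auto intro: continuous_measurable_cell s_cont g)
  then show ?thesis using shift LIMSEQ_unique[OF _ tendsto_const] by simp
qed

subsection \<open>Exponentials\<close>

definition wave :: "('n \<Rightarrow> int) \<Rightarrow> real^'n \<Rightarrow> complex" where
  "wave k y = cis (\<Sum>i\<in>UNIV. of_int (k i) * y $ i)"

lemma wave_add: "wave (\<lambda>i. k i + l i) y = wave k y * wave l y"
  by (simp add: wave_def cis_mult sum.distrib distrib_right)

lemma wave_uminus: "wave (\<lambda>i. - k i) y = cnj (wave k y)"
  by (simp add: wave_def cis_cnj sum_negf)

lemma wave_0: "wave (\<lambda>_. 0) y = 1"
  by (simp add: wave_def)

lemma cmod_wave [simp]: "cmod (wave k y) = 1"
  by (simp add: wave_def)

lemma continuous_wave: "continuous_on S (wave k)"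
  unfolding wave_def by (intro continuous_intros)

lemma wave_periodic: "p \<in> int_vecs \<Longrightarrow> wave k (y + (2 * pi) *\<^sub>R p) = wave k y"
proof -
  assume p: "p \<in> int_vecs"
  have "(\<Sum>i\<in>UNIV. of_int (k i) * p $ i) \<in> \<int>"
    using p by (intro Ints_sum Ints_mult) (auto simp: int_vecs_def)
  then have c: "cis (2 * pi * (\<Sum>i\<in>UNIV. of_int (k i) * p $ i)) = 1" by (rule cis_multiple_2pi)
  have "(\<Sum>i\<in>UNIV. of_int (k i) * (y + (2 * pi) *\<^sub>R p) $ i)
      = (\<Sum>i\<in>UNIV. of_int (k i) * y $ i) + 2 * pi * (\<Sum>i\<in>UNIV. of_int (k i) * p $ i)"
    by (simp add: sum.distrib sum_distrib_left algebra_simps)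
  then show ?thesis using c by (simp add: wave_def cis_mult[symmetric])
qed

lemma wave_deriv: "partial_deriv_is j (wave k) (\<lambda>y. (\<i> * of_int (k j)) * wave k y)"
  unfolding partial_deriv_is_def
proof
  fix y :: "real^'a"
  have eq: "wave k (y + t *\<^sub>R axis j 1) = wave k y * exp (\<i> * of_int (k j) * of_real t)" for t
  proof -
    have "(\<Sum>i\<in>UNIV. of_int (k i) * (y + t *\<^sub>R axis j 1) $ i)
        = (\<Sum>i\<in>UNIV. of_int (k i) * y $ i) + of_int (k j) * t"
      unfolding vector_add_component vector_scaleR_component distrib_left sum.distrib
      by (simp add: axis_def if_distrib cong: if_cong)
    then show ?thesis by (simp add: wave_def cis_mult[symmetric]) (simp add: cis_conv_exp mult.assoc)
  qed
  have "((\<lambda>z. wave k y * exp (\<i> * of_int (k j) * z)) has_field_derivative wave k y * (\<i> * of_int (k j))) (at (of_real 0))"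
    by (auto intro!: derivative_eq_intros)
  from has_vector_derivative_real_field[OF this]
  show "((\<lambda>t. wave k (y + t *\<^sub>R axis j 1)) has_vector_derivative \<i> * of_int (k j) * wave k y) (at 0)"
    unfolding eq by (simp add: mult.commute)
qed

lemma partial_deriv_cmult:
  "partial_deriv_is j f g \<Longrightarrow> partial_deriv_is j (\<lambda>y. c * f y) (\<lambda>y. c * g y)"
  unfolding partial_deriv_is_def by (auto intro!: has_vector_derivative_mult_right)

lemma partial_deriv_mult:
  "partial_deriv_is j f g \<Longrightarrow> partial_deriv_is j f' g' \<Longrightarrow>
   partial_deriv_is j (\<lambda>y. f y * f' y) (\<lambda>y. f y * g' y + g y * f' y)"
  unfolding partial_deriv_is_def
proof
  fix y
  assume "\<forall>y. ((\<lambda>t. f (y + t *\<^sub>R axis j 1)) has_vector_derivative g y) (at 0)"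
    "\<forall>y. ((\<lambda>t. f' (y + t *\<^sub>R axis j 1)) has_vector_derivative g' y) (at 0)"
  then have "((\<lambda>t. f (y + t *\<^sub>R axis j 1)) has_vector_derivative g y) (at 0)"
    "((\<lambda>t. f' (y + t *\<^sub>R axis j 1)) has_vector_derivative g' y) (at 0)" by auto
  from has_vector_derivative_mult[OF this]
  show "((\<lambda>t. f (y + t *\<^sub>R axis j 1) * f' (y + t *\<^sub>R axis j 1)) has_vector_derivative f y * g' y + g y * f' y) (at 0)"
    by simp
qed

lemma test_fun_wave: "test_fun (wave k)"
  unfolding test_fun_def smooth_fun_def
proof (intro conjI exI ballI allI)
  let ?D = "\<lambda>l y. prod_list (map (\<lambda>i. \<i> * of_int (k i)) l) * wave k y"
  show "?D [] = wave k" by simp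
  show "continuous_on UNIV (?D l)" for l by (intro continuous_intros continuous_wave)
  show "partial_deriv_is i (?D l) (?D (i # l))" for i l
    using partial_deriv_cmult[OF wave_deriv[of i k], of "prod_list (map (\<lambda>i. \<i> * of_int (k i)) l)"]
    by (simp add: mult_ac)
qed (auto intro: wave_periodic)

lemma integral_wave:
  "integral\<^sup>L (cell_measure :: (real^'n) measure) (wave k) = (if k = (\<lambda>_. 0) then vol TYPE('n) else 0)"
proof (cases "k = (\<lambda>_. 0)")
  case True
  then have "wave k = (\<lambda>_. 1)" by (auto simp: wave_0)
  then show ?thesis using True integral_const_cell[where 'n = 'n, of 1] by (simp add: scaleR_conv_of_real)
next
  case False
  then obtain j where j: "k j \<noteq> 0" by auto
  have "integral\<^sup>L cell_measure (\<lambda>y. (\<i> * of_int (k j)) * wave k y) = 0"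
    by (rule integral_partial_deriv_zero[OF continuous_wave _ _ wave_deriv])
      (auto intro!: continuous_intros continuous_wave wave_periodic)
  then show ?thesis using j False by simp
qed

section \<open>Completeness of the exponentials\<close>

definition torus_map :: "real^'n \<Rightarrow> complex^'n" where
  "torus_map y = (\<chi> i. cis (y $ i))"

lemma continuous_torus_map: "continuous_on S torus_map"
  unfolding torus_map_def by (intro continuous_on_vec_lambda continuous_intros)

text \<open>Interior points of the cell are not identified with any other point of the closed cell.\<close>

lemma torus_map_inj:
  assumes "torus_map y = torus_map z" "z \<in> closed_cell" "\<And>i. 0 < y $ i \<and> y $ i < 2 * pi"
  shows "y = z"
proof -
  have "y $ i = z $ i" for i
  proof -
    have "cis (y $ i) = cis (z $ i)" using assms(1) by (simp add: torus_map_def vec_eq_iff)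
    then have "cos (y $ i) = cos (z $ i)" "sin (y $ i) = sin (z $ i)" by (auto simp: complex_eq_iff)
    then obtain n :: int where n: "y $ i = z $ i + 2 * pi * n"
      using sin_cos_eq_iff by metis
    moreover have "\<bar>y $ i - z $ i\<bar> < 2 * pi"
      using assms(2) assms(3)[of i] by (auto simp: closed_cell_def abs_less_iff) (smt (verit))+
    ultimately have "2 * pi * \<bar>real_of_int n\<bar> < 2 * pi * 1" by (simp add: abs_mult)
    then have "\<bar>real_of_int n\<bar> < 1" using pi_gt_zero by (subst (asm) mult_less_cancel_left_pos) auto
    then have "n = 0" by linarith
    then show ?thesis using n by simp
  qed
  then show ?thesis by (simp add: vec_eq_iff)
qed

inductive trig_poly :: "(real^'n \<Rightarrow> complex) \<Rightarrow> bool" where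
  trig_wave: "trig_poly (\<lambda>y. c * wave k y)"
| trig_add: "trig_poly f \<Longrightarrow> trig_poly g \<Longrightarrow> trig_poly (\<lambda>y. f y + g y)"

lemma trig_poly_mult_wave: "trig_poly f \<Longrightarrow> trig_poly (\<lambda>y. c * wave k y * f y)"
proof (induction rule: trig_poly.induct)
  case (trig_wave c' k')
  have "(\<lambda>y. c * wave k y * (c' * wave k' y)) = (\<lambda>y. (c * c') * wave (\<lambda>i. k i + k' i) y)"
    by (simp add: wave_add mult_ac)
  then show ?case by (simp only: trig_poly.trig_wave)
next
  case (trig_add f g)
  then show ?case by (simp only: distrib_left trig_poly.trig_add)
qed

lemma trig_poly_mult: "trig_poly f \<Longrightarrow> trig_poly g \<Longrightarrow> trig_poly (\<lambda>y. f y * g y)"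
proof (induction rule: trig_poly.induct)
  case (trig_wave c k)
  then show ?case by (rule trig_poly_mult_wave)
next
  case (trig_add f f')
  then show ?case by (simp only: distrib_right trig_poly.trig_add)
qed

lemma trig_poly_const: "trig_poly (\<lambda>_. c)"
  using trig_wave[of c "\<lambda>_. 0"] by (simp add: wave_0)

lemma continuous_trig_poly: "trig_poly f \<Longrightarrow> continuous_on UNIV f"
  by (induction rule: trig_poly.induct) (auto intro!: continuous_intros continuous_wave)

lemma integrable_mult_bounded:
  fixes f g :: "real^'n \<Rightarrow> complex"
  assumes f: "integrable cell_measure f" and g: "g \<in> borel_measurable cell_measure"
    and B: "\<And>y. y \<in> cell \<Longrightarrow> norm (g y) \<le> B"
  shows "integrable cell_measure (\<lambda>y. f y * g y)"
proof (rule Bochner_Integration.integrable_bound)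
  show "integrable cell_measure (\<lambda>y. B * norm (f y))" using f by auto
  show "(\<lambda>y. f y * g y) \<in> borel_measurable cell_measure" using f g by measurable
  show "AE y in cell_measure. norm (f y * g y) \<le> norm (B * norm (f y))"
    unfolding AE_cell
  proof (rule AE_I2, rule impI)
    fix y :: "real^'n" assume y: "y \<in> cell"
    have "norm (f y * g y) \<le> B * norm (f y)"
      unfolding norm_mult mult.commute[of B] by (rule mult_left_mono[OF B[OF y]]) simp
    then show "norm (f y * g y) \<le> norm (B * norm (f y))" by (smt (verit) real_norm_def)
  qed
qed

lemma integrable_mult_continuous:
  fixes f g :: "real^'n \<Rightarrow> complex"
  assumes f: "integrable cell_measure f" and g: "continuous_on UNIV g"
  shows "integrable cell_measure (\<lambda>y. f y * g y)"
proof -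
  obtain B where "\<And>y. y \<in> cell \<Longrightarrow> norm (g y) \<le> B" using continuous_bounded_cell[OF g] by blast
  then show ?thesis by (rule integrable_mult_bounded[OF f continuous_measurable_cell[OF g]])
qed

lemma trig_poly_orthogonal:
  assumes f: "integrable cell_measure f" and orth: "\<And>k. integral\<^sup>L cell_measure (\<lambda>y. f y * wave k y) = 0"
  shows "trig_poly p \<Longrightarrow> integral\<^sup>L cell_measure (\<lambda>y. f y * p y) = 0"
proof (induction rule: trig_poly.induct)
  case (trig_wave c k)
  have "(\<lambda>y. f y * (c * wave k y)) = (\<lambda>y. c * (f y * wave k y))" by (simp add: mult_ac)
  then show ?case by (simp add: orth)
next
  case (trig_add g h)
  then show ?case
    by (simp add: distrib_left integrable_mult_continuous[OF f] continuous_trig_poly)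
qed

lemma wave_unit: "wave (\<lambda>j. if j = i then 1 else 0) y = cis (y $ i)"
proof -
  have "(\<Sum>j\<in>UNIV. of_int (if j = i then 1 else 0) * y $ j) = y $ i"
  proof -
    have "(\<Sum>j\<in>UNIV. of_int (if j = i then 1 else 0) * y $ j) = (\<Sum>j\<in>UNIV. if j = i then y $ j else 0)"
      by (rule sum.cong) auto
    then show ?thesis by simp
  qed
  then show ?thesis by (simp only: wave_def)
qed

text \<open>By the Stone--Weierstrass theorem on the torus, embedded in \<open>\<complex>\<^sup>d\<close>, the function \<open>g\<close> is a uniform limit of
functions that are trigonometric polynomials on the cell. The real and imaginary parts of the coordinates
separate the points.\<close>

lemma continuous_on_torus_orthogonal:
  fixes f :: "real^'n \<Rightarrow> complex" and g :: "complex^'n \<Rightarrow> real"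
  assumes f: "integrable cell_measure f" and orth: "\<And>k. integral\<^sup>L cell_measure (\<lambda>y. f y * wave k y) = 0"
    and g: "continuous_on UNIV g"
  shows "integral\<^sup>L cell_measure (\<lambda>y. f y * complex_of_real (g (torus_map y))) = 0" (is "?I = 0")
proof -
  define T :: "(complex^'n) set" where "T = torus_map ` closed_cell"
  have T: "torus_map y \<in> T" if "y \<in> cell" for y
    using that cell_subset_closed_cell by (auto simp: T_def)
  define P where "P p \<longleftrightarrow> continuous_on T p \<and> trig_poly (\<lambda>y. complex_of_real (p (torus_map y)))"
    for p :: "complex^'n \<Rightarrow> real"
  have approx: "\<exists>p. P p \<and> (\<forall>z\<in>T. \<bar>g z - p z\<bar> < e)" if "e > 0" for e
  proof (rule Stone_Weierstrass_HOL)
    show "compact T" unfolding T_def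
      by (intro compact_continuous_image continuous_torus_map compact_closed_cell)
    show "P (\<lambda>_. c)" for c by (simp add: P_def trig_poly_const)
    show "continuous_on T p" if "P p" for p using that by (simp add: P_def)
    show "P (\<lambda>x. p x + q x)" if "P p \<and> P q" for p q
      using that trig_add by (auto simp: P_def intro!: continuous_intros)
    show "P (\<lambda>x. p x * q x)" if "P p \<and> P q" for p q
      using that trig_poly_mult by (auto simp: P_def intro!: continuous_intros)
    show "\<exists>p. P p \<and> p z \<noteq> p w" if "z \<in> T \<and> w \<in> T \<and> z \<noteq> w" for z w
    proof -
      have "P (\<lambda>z. Re (z $ i))" for i
      proof -
        have "complex_of_real (Re (torus_map y $ i)) = (1/2) * wave (\<lambda>j. if j = i then 1 else 0) y
            + (1/2) * wave (\<lambda>j. - (if j = i then 1 else 0)) y" for y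
          unfolding wave_uminus wave_unit by (simp add: torus_map_def complex_eq_iff)
        then show ?thesis
          unfolding P_def by (simp only: trig_poly.intros simp_thms) (intro continuous_intros)
      qed
      moreover have "P (\<lambda>z. Im (z $ i))" for i
      proof -
        have "complex_of_real (Im (torus_map y $ i)) = (- \<i> / 2) * wave (\<lambda>j. if j = i then 1 else 0) y
            + (\<i> / 2) * wave (\<lambda>j. - (if j = i then 1 else 0)) y" for y
          unfolding wave_uminus wave_unit by (simp add: torus_map_def complex_eq_iff field_simps)
        then show ?thesis
          unfolding P_def by (simp only: trig_poly.intros simp_thms) (intro continuous_intros)
      qed
      ultimately show ?thesis using that by (metis complex_eq_iff vec_eq_iff)
    qed
    show "continuous_on T g" by (rule continuous_on_subset[OF g]) simp
  qed (use that in auto)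
  have gE: "continuous_on UNIV (\<lambda>y. complex_of_real (g (torus_map y)))"
    by (intro continuous_intros continuous_on_compose2[OF g continuous_torus_map]) auto
  have le: "norm ?I \<le> e * integral\<^sup>L cell_measure (\<lambda>y. norm (f y))" if "e > 0" for e
  proof -
    obtain p where p: "P p" "\<And>z. z \<in> T \<Longrightarrow> \<bar>g z - p z\<bar> < e" using approx[OF \<open>e > 0\<close>] by blast
    let ?p = "\<lambda>y. complex_of_real (p (torus_map y))"
    have tp: "trig_poly ?p" using p(1) by (simp add: P_def)
    have "?I = integral\<^sup>L cell_measure (\<lambda>y. f y * complex_of_real (g (torus_map y)))
        - integral\<^sup>L cell_measure (\<lambda>y. f y * ?p y)"
      using trig_poly_orthogonal[OF f orth tp] by simp
    also have "\<dots> = integral\<^sup>L cell_measure (\<lambda>y. f y * (complex_of_real (g (torus_map y)) - ?p y))"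
      unfolding right_diff_distrib
      by (rule Bochner_Integration.integral_diff[symmetric]; rule integrable_mult_continuous[OF f])
        (rule gE, rule continuous_trig_poly[OF tp])
    also have "norm \<dots> \<le> integral\<^sup>L cell_measure (\<lambda>y. norm (f y * (complex_of_real (g (torus_map y)) - ?p y)))"
      by (rule integral_norm_bound)
    also have "\<dots> \<le> integral\<^sup>L cell_measure (\<lambda>y. e * norm (f y))"
    proof (rule integral_mono_AE)
      show "integrable cell_measure (\<lambda>y. norm (f y * (complex_of_real (g (torus_map y)) - ?p y)))"
        by (intro integrable_norm integrable_mult_continuous[OF f] continuous_intros gE continuous_trig_poly tp)
      show "integrable cell_measure (\<lambda>y. e * norm (f y))" using f by auto
      show "AE y in cell_measure. norm (f y * (complex_of_real (g (torus_map y)) - ?p y)) \<le> e * norm (f y)"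
        unfolding AE_cell
      proof (rule AE_I2, rule impI)
        fix y :: "real^'n" assume "y \<in> cell"
        then have "\<bar>g (torus_map y) - p (torus_map y)\<bar> \<le> e" using p(2)[OF T] by (simp add: less_imp_le)
        then have "norm (complex_of_real (g (torus_map y)) - ?p y) \<le> e"
          by (simp only: of_real_diff[symmetric] norm_of_real)
        then show "norm (f y * (complex_of_real (g (torus_map y)) - ?p y)) \<le> e * norm (f y)"
          unfolding norm_mult mult.commute[of e] by (rule mult_left_mono) simp
      qed
    qed
    finally show ?thesis by simp
  qed
  define m where "m = integral\<^sup>L cell_measure (\<lambda>y. norm (f y))"
  have "m \<ge> 0" by (simp add: m_def)
  have "norm ?I \<le> e" if "e > 0" for e
  proof -
    have "norm ?I \<le> (e / (m + 1)) * m"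
    proof -
      have "e / (m + 1) > 0" using that \<open>m \<ge> 0\<close> by simp
      from le[OF this] show ?thesis by (simp only: m_def)
    qed
    also have "\<dots> = e * (m / (m + 1))" by simp
    also have "\<dots> \<le> e * 1" using that \<open>m \<ge> 0\<close> by (intro mult_left_mono) auto
    finally show ?thesis by simp
  qed
  then have "norm ?I \<le> 0" using field_le_epsilon[of "norm ?I" 0] by simp
  then show ?thesis by simp
qed

text \<open>The indicator of an open subset of the interior of the cell is a bounded limit of continuous functions on the
torus: the image of the complement is compact, and one takes multiples of the distance from it, cut off at 1.
So the integral of \<open>f\<close> vanishes over open sets, then over Borel sets and over Lebesgue sets.\<close>

theorem wave_complete:
  fixes f :: "real^'n \<Rightarrow> complex"
  assumes f: "integrable cell_measure f" and orth: "\<And>k. integral\<^sup>L cell_measure (\<lambda>y. f y * wave k y) = 0"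
  shows "AE y in cell_measure. f y = 0"
proof -
  define U :: "(real^'n) set" where "U = box 0 (\<chi> i. 2 * pi)"
  have U: "y \<in> U \<longleftrightarrow> (\<forall>i. 0 < y $ i \<and> y $ i < 2 * pi)" for y by (auto simp: U_def mem_box_cart)
  have Ucell: "U \<subseteq> cell" by (auto simp: U cell_def less_imp_le)
  have [measurable]: "U \<in> sets borel" by (simp add: U_def)
  have openU: "integral\<^sup>L cell_measure (\<lambda>y. f y * complex_of_real (indicator G y)) = 0" if G: "open G" "G \<subseteq> U" for G
  proof -
    define K :: "(complex^'n) set" where "K = torus_map ` (closed_cell - G)"
    have "0 \<in> closed_cell - G"
    proof -
      have "(0::real^'n) \<notin> U" by (auto simp: U)
      then show ?thesis using G by (auto simp: closed_cell_def)
    qed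
    then have "K \<noteq> {}" by (auto simp: K_def)
    have "compact K" unfolding K_def
      by (intro compact_continuous_image continuous_torus_map compact_diff compact_closed_cell G)
    then have "closed K" by (rule compact_imp_closed)
    define g where "g n z = min 1 (real n * infdist z K)" for n z
    have gc: "continuous_on UNIV (g n)" for n
      unfolding g_def by (intro continuous_intros)
    have g01: "0 \<le> g n z" "g n z \<le> 1" for n z by (auto simp: g_def infdist_nonneg)
    have conv: "(\<lambda>n. g n (torus_map y)) \<longlonglongrightarrow> indicator G y" if y: "y \<in> cell" for y
    proof (cases "y \<in> G")
      case False
      then have "torus_map y \<in> K" using y cell_subset_closed_cell by (auto simp: K_def)
      then show ?thesis using False by (simp add: g_def)
    next
      case True
      have "torus_map y \<notin> K"
      proof
        assume "torus_map y \<in> K"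
        then obtain z where z: "torus_map y = torus_map z" "z \<in> closed_cell" "z \<notin> G" by (auto simp: K_def)
        have "y \<in> U" using True G by auto
        then have "y = z" using torus_map_inj[OF z(1,2)] U by blast
        then show False using z True by simp
      qed
      then have pos: "infdist (torus_map y) K > 0"
        by (rule infdist_pos_not_in_closed[OF \<open>closed K\<close> \<open>K \<noteq> {}\<close>])
      obtain n0 :: nat where n0: "1 / infdist (torus_map y) K \<le> real n0" using real_arch_simple by blast
      have "g n (torus_map y) = 1" if "n \<ge> n0" for n
      proof -
        have "1 / infdist (torus_map y) K \<le> real n" using n0 that by linarith
        then show ?thesis using pos by (simp add: g_def field_simps)
      qed
      then have "eventually (\<lambda>n. g n (torus_map y) = 1) sequentially" by (auto simp: eventually_sequentially)
      then show ?thesis using True tendsto_eventually by auto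
    qed
    have Gb: "G \<in> sets borel" using G by auto
    have "(\<lambda>n. integral\<^sup>L cell_measure (\<lambda>y. f y * complex_of_real (g n (torus_map y))))
        \<longlonglongrightarrow> integral\<^sup>L cell_measure (\<lambda>y. f y * complex_of_real (indicator G y))"
    proof (rule integral_dominated_convergence[where w = "\<lambda>y. norm (f y)"])
      have "(\<lambda>y. indicat_real G y) \<in> borel_measurable lebesgue" using Gb by (intro borel_measurable_indicator) auto
      then have "(\<lambda>y. complex_of_real (indicat_real G y)) \<in> borel_measurable cell_measure"
        by (rule measurable_compose[OF measurable_cell borel_measurable_of_real])
      then show "(\<lambda>y. f y * complex_of_real (indicator G y)) \<in> borel_measurable cell_measure"
        using f by measurable
      show "(\<lambda>y. f y * complex_of_real (g n (torus_map y))) \<in> borel_measurable cell_measure" for n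
        using integrable_mult_continuous[OF f, of "\<lambda>y. complex_of_real (g n (torus_map y))"]
        by (intro borel_measurable_integrable)
          (auto intro!: continuous_intros continuous_on_compose2[OF gc continuous_torus_map])
      show "integrable cell_measure (\<lambda>y. norm (f y))" using f by auto
      show "AE y in cell_measure. (\<lambda>n. f y * complex_of_real (g n (torus_map y))) \<longlonglongrightarrow> f y * complex_of_real (indicator G y)"
        unfolding AE_cell using conv by (intro AE_I2 impI tendsto_intros) auto
      show "AE y in cell_measure. norm (f y * complex_of_real (g n (torus_map y))) \<le> norm (f y)" for n
        using g01[of n] by (auto simp: norm_mult intro!: AE_I2 mult_right_le_one_le)
    qed
    moreover have "integral\<^sup>L cell_measure (\<lambda>y. f y * complex_of_real (g n (torus_map y))) = 0" for n
      by (rule continuous_on_torus_orthogonal[OF f orth gc])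
    ultimately show ?thesis using LIMSEQ_unique[OF _ tendsto_const] by simp
  qed
  define h where "h y = indicator U y *\<^sub>R f y" for y
  have h: "integrable lebesgue h"
  proof -
    have "integrable lebesgue (\<lambda>y. indicator cell y *\<^sub>R f y)"
      using f integrable_restrict_space[of cell lebesgue f] by simp
    then have "integrable lebesgue (\<lambda>y. indicator U y *\<^sub>R (indicator cell y *\<^sub>R f y))"
      by (rule integrable_mult_indicator[rotated]) auto
    also have "(\<lambda>y. indicator U y *\<^sub>R (indicator cell y *\<^sub>R f y)) = h"
      using Ucell by (auto simp: h_def indicator_def fun_eq_iff)
    finally show ?thesis .
  qed
  have seth: "set_integrable lebesgue A h" if "A \<in> sets lebesgue" for A
    unfolding set_integrable_def by (rule integrable_mult_indicator[OF that h])
  have open_zero: "set_lebesgue_integral lebesgue G h = 0" if "open G" for G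
  proof -
    have "integral\<^sup>L cell_measure (\<lambda>y. f y * complex_of_real (indicator (G \<inter> U) y)) = 0"
      by (rule openU) (use that in \<open>auto simp: U_def\<close>)
    also have "integral\<^sup>L cell_measure (\<lambda>y. f y * complex_of_real (indicator (G \<inter> U) y))
        = integral\<^sup>L lebesgue (\<lambda>y. indicator cell y *\<^sub>R (f y * complex_of_real (indicator (G \<inter> U) y)))"
      by (rule integral_restrict_space) auto
    also have "(\<lambda>y. indicator cell y *\<^sub>R (f y * complex_of_real (indicator (G \<inter> U) y))) = (\<lambda>y. indicator G y *\<^sub>R h y)"
      using Ucell by (auto simp: h_def indicator_def fun_eq_iff)
    finally show ?thesis by (simp add: set_lebesgue_integral_def)
  qed
  have open_stable: "Int_stable {S :: (real^'n) set. open S}"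
    by (auto simp: Int_stable_def)
  have subset_Pow: "{S :: (real^'n) set. open S} \<subseteq> Pow UNIV" by simp
  have borel_zero: "set_lebesgue_integral lebesgue A h = 0" if "A \<in> sets borel" for A
  proof -
    have "A \<in> sigma_sets UNIV {S. open S}" using that by (simp add: sets_borel)
    then show ?thesis
    proof (induction rule: sigma_sets_induct_disjoint[OF open_stable subset_Pow,
          consumes 1, case_names basic empty compl union])
      case (compl A)
      then have A: "A \<in> sets lebesgue" by (simp add: sets_borel[symmetric])
      have "set_lebesgue_integral lebesgue (A \<union> (UNIV - A)) h = set_lebesgue_integral lebesgue A h
          + set_lebesgue_integral lebesgue (UNIV - A) h"
        by (rule set_integral_Un) (use A in \<open>auto intro!: seth\<close>)
      then show ?case using compl open_zero[of UNIV] by simp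
    next
      case (union A)
      then have A: "A i \<in> sets lebesgue" for i using sets_borel by (metis rangeI sets_completionI_sets sets_lborel subsetD)
      have "set_lebesgue_integral lebesgue (\<Union>i. A i) h = (\<Sum>i. set_lebesgue_integral lebesgue (A i) h)"
        by (rule lebesgue_integral_countable_add)
          (use A union in \<open>auto intro!: seth simp: disjoint_family_on_def\<close>)
      then show ?case using union by simp
    next
      case (basic A)
      then show ?case by (simp add: open_zero)
    next
      case empty
      then show ?case by (simp add: set_lebesgue_integral_def)
    qed
  qed
  have "AE y in cell_measure. h y = 0"
  proof (rule sigma_finite_measure.density_zero)
    show "sigma_finite_measure (cell_measure :: (real^'n) measure)"
      by (rule finite_measure.axioms(1)[OF finite_cell_measure])
    show "integrable cell_measure h"
      using integrable_mult_indicator[OF cell_lebesgue h] by (subst integrable_restrict_space) auto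
    fix A :: "(real^'n) set" assume "A \<in> sets cell_measure"
    then have "A \<in> sets lebesgue" "A \<subseteq> cell" by (auto simp: sets_restrict_space_iff)
    then obtain S N N' where A: "A = S \<union> N" and S: "S \<in> sets borel" and N: "N \<subseteq> N'" "N' \<in> null_sets lborel"
      by (auto elim: sets_completionE)
    have "AE y in lebesgue. y \<notin> N"
      using N by (intro AE_not_in) (auto intro: null_sets_completionI null_sets_completion_subset)
    then have "integral\<^sup>L lebesgue (\<lambda>y. indicator A y *\<^sub>R h y) = integral\<^sup>L lebesgue (\<lambda>y. indicator S y *\<^sub>R h y)"
      by (intro integral_cong_AE borel_measurable_integrable integrable_mult_indicator[OF _ h])
        (use \<open>A \<in> sets lebesgue\<close> S A in \<open>auto simp: indicator_def\<close>)
    then have "integral\<^sup>L lebesgue (\<lambda>y. indicator A y *\<^sub>R h y) = 0"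
      using borel_zero[OF S] by (simp add: set_lebesgue_integral_def)
    also have "(\<lambda>y. indicator A y *\<^sub>R h y) = (\<lambda>y. indicator cell y *\<^sub>R (indicator A y *\<^sub>R h y))"
      using \<open>A \<subseteq> cell\<close> by (auto simp: indicator_def fun_eq_iff)
    finally show "set_lebesgue_integral cell_measure A h = 0"
      unfolding set_lebesgue_integral_def by (subst integral_restrict_space) auto
  qed
  moreover have "AE y in lebesgue. y \<in> cell \<longrightarrow> y \<in> U"
  proof -
    have "negligible (\<Union>i\<in>UNIV. {y::real^'n. axis i 1 \<bullet> y = 0})"
      by (rule negligible_Union) (auto intro!: negligible_hyperplane simp: axis_eq_0_iff)
    then have "AE y in lebesgue. y \<notin> (\<Union>i\<in>UNIV. {y::real^'n. axis i 1 \<bullet> y = 0})"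
      by (intro AE_not_in) (simp add: negligible_iff_null_sets)
    then show ?thesis
      by eventually_elim (auto simp: U cell_def inner_axis' order_less_le)
  qed
  ultimately have "AE y in lebesgue. y \<in> cell \<longrightarrow> f y = 0"
    unfolding AE_cell by eventually_elim (auto simp: h_def)
  then show ?thesis by (simp add: AE_cell)
qed

section \<open>Fourier series of square-integrable functions\<close>

lemma mult_cnj_self: "z * cnj z = (complex_of_real (cmod z))\<^sup>2"
  using complex_norm_square[of z] by simp

lemma measurable_cnj [measurable (raw)]:
  "f \<in> borel_measurable M \<Longrightarrow> (\<lambda>x. cnj (f x)) \<in> borel_measurable M"
  by (rule measurable_compose[OF _ borel_measurable_continuous_onI]) (auto intro: continuous_intros)

definition square_integrable :: "(real^'n \<Rightarrow> complex) \<Rightarrow> bool" where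
  "square_integrable u \<longleftrightarrow> u \<in> borel_measurable cell_measure \<and> integrable cell_measure (\<lambda>y. (cmod (u y))\<^sup>2)"

lemma square_integrableD [dest]:
  "square_integrable u \<Longrightarrow> u \<in> borel_measurable cell_measure"
  "square_integrable u \<Longrightarrow> integrable cell_measure (\<lambda>y. (cmod (u y))\<^sup>2)"
  by (auto simp: square_integrable_def)

lemma square_integrable_add:
  assumes "square_integrable u" "square_integrable v"
  shows "square_integrable (\<lambda>y. u y + v y)"
proof -
  note [measurable] = square_integrableD(1)[OF assms(1)] square_integrableD(1)[OF assms(2)]
  have "integrable cell_measure (\<lambda>y. 2 * (cmod (u y))\<^sup>2 + 2 * (cmod (v y))\<^sup>2)"
    using assms by (auto simp: square_integrable_def)
  then have "integrable cell_measure (\<lambda>y. (cmod (u y + v y))\<^sup>2)"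
    by (rule Bochner_Integration.integrable_bound) (auto intro!: AE_I2 cmod_add_square_le)
  then show ?thesis by (simp add: square_integrable_def)
qed

lemma square_integrable_cmult: "square_integrable u \<Longrightarrow> square_integrable (\<lambda>y. c * u y)"
  by (auto simp: square_integrable_def norm_mult power_mult_distrib)

lemma square_integrable_zero: "square_integrable (\<lambda>_. 0)"
  by (simp add: square_integrable_def)

lemma square_integrable_sum:
  "(\<And>i. i \<in> I \<Longrightarrow> square_integrable (f i)) \<Longrightarrow> square_integrable (\<lambda>y. \<Sum>i\<in>I. f i y)"
  by (induction I rule: infinite_finite_induct) (auto intro: square_integrable_zero square_integrable_add)

lemma square_integrable_cnj: "square_integrable u \<Longrightarrow> square_integrable (\<lambda>y. cnj (u y))"
  unfolding square_integrable_def by (auto intro: measurable_cnj)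

lemma continuous_square_integrable: "continuous_on UNIV u \<Longrightarrow> square_integrable u"
  unfolding square_integrable_def
  by (auto intro!: continuous_measurable_cell continuous_integrable_cell continuous_intros)

lemma square_integrable_bounded_mult:
  assumes u: "square_integrable u" and m: "m \<in> borel_measurable cell_measure"
    and B: "AE y in cell_measure. cmod (m y) \<le> B"
  shows "square_integrable (\<lambda>y. m y * u y)"
proof -
  note [measurable] = square_integrableD(1)[OF u] m
  have "integrable cell_measure (\<lambda>y. B\<^sup>2 * (cmod (u y))\<^sup>2)" using u by auto
  then have "integrable cell_measure (\<lambda>y. (cmod (m y * u y))\<^sup>2)"
  proof (rule Bochner_Integration.integrable_bound)
    show "AE y in cell_measure. norm ((cmod (m y * u y))\<^sup>2) \<le> norm (B\<^sup>2 * (cmod (u y))\<^sup>2)"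
      using B by eventually_elim (auto simp: norm_mult power_mult_distrib intro!: mult_right_mono power_mono)
  qed simp
  then show ?thesis by (simp add: square_integrable_def)
qed

lemma integrable_mult_cnj:
  assumes "square_integrable u" "square_integrable v"
  shows "integrable cell_measure (\<lambda>y. u y * cnj (v y))"
proof -
  note [measurable] = square_integrableD(1)[OF assms(1)] square_integrableD(1)[OF assms(2)]
  have "integrable cell_measure (\<lambda>y. (cmod (u y))\<^sup>2 + (cmod (v y))\<^sup>2)"
    using assms by (auto simp: square_integrable_def)
  then show ?thesis
  proof (rule Bochner_Integration.integrable_bound)
    have "cmod (u y) * cmod (v y) \<le> (cmod (u y))\<^sup>2 + (cmod (v y))\<^sup>2" for y
      using zero_le_power2[of "cmod (u y) - cmod (v y)"] zero_le_power2[of "cmod (u y)"] zero_le_power2[of "cmod (v y)"]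
      unfolding power2_diff by linarith
    then show "AE y in cell_measure. norm (u y * cnj (v y)) \<le> norm ((cmod (u y))\<^sup>2 + (cmod (v y))\<^sup>2)"
      by (auto simp: norm_mult intro!: AE_I2)
  qed simp
qed

lemma square_integrable_integrable: "square_integrable u \<Longrightarrow> integrable cell_measure u"
  using integrable_mult_cnj[of u "\<lambda>_. 1"] continuous_square_integrable[of "\<lambda>_. 1"] by simp

text \<open>Normalized so that the exponentials are orthonormal.\<close>

definition mean_inner :: "(real^'n \<Rightarrow> complex) \<Rightarrow> (real^'n \<Rightarrow> complex) \<Rightarrow> complex" where
  "mean_inner u v = integral\<^sup>L cell_measure (\<lambda>y. u y * cnj (v y)) / vol TYPE('n)"

lemma mean_inner_add_left:
  "square_integrable u \<Longrightarrow> square_integrable v \<Longrightarrow> square_integrable w \<Longrightarrow>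
   mean_inner (\<lambda>y. u y + v y) w = mean_inner u w + mean_inner v w"
  by (simp add: mean_inner_def distrib_right integrable_mult_cnj add_divide_distrib)

lemma mean_inner_cmult_left: "mean_inner (\<lambda>y. c * u y) w = c * mean_inner u w"
  by (simp add: mean_inner_def mult.assoc)

lemma mean_inner_cnj: "mean_inner u v = cnj (mean_inner v u)"
proof -
  have "(\<lambda>y. u y * cnj (v y)) = (\<lambda>y. cnj (v y * cnj (u y)))" by (simp add: mult.commute)
  then have "integral\<^sup>L cell_measure (\<lambda>y. u y * cnj (v y)) = cnj (integral\<^sup>L cell_measure (\<lambda>y. v y * cnj (u y)))"
    by (simp only: Bochner_Integration.integral_cnj)
  then show ?thesis by (simp add: mean_inner_def)
qed

lemma mean_inner_add_right:
  "square_integrable u \<Longrightarrow> square_integrable v \<Longrightarrow> square_integrable w \<Longrightarrow>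
   mean_inner w (\<lambda>y. u y + v y) = mean_inner w u + mean_inner w v"
  by (subst (1 2 3) mean_inner_cnj) (simp add: mean_inner_add_left)

lemma mean_inner_cmult_right: "mean_inner w (\<lambda>y. c * u y) = cnj c * mean_inner w u"
  by (subst (1 2) mean_inner_cnj) (simp add: mean_inner_cmult_left)

lemma mean_inner_sum_left:
  assumes "\<And>i. i \<in> I \<Longrightarrow> square_integrable (f i)" "square_integrable w"
  shows "mean_inner (\<lambda>y. \<Sum>i\<in>I. f i y) w = (\<Sum>i\<in>I. mean_inner (f i) w)"
  using assms(1)
proof (induction I rule: infinite_finite_induct)
  case (insert i I)
  then show ?case
    by (simp add: mean_inner_add_left square_integrable_sum assms(2))
qed (auto simp: mean_inner_def)

lemma mean_inner_sum_right:
  assumes "\<And>i. i \<in> I \<Longrightarrow> square_integrable (f i)" "square_integrable w"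
  shows "mean_inner w (\<lambda>y. \<Sum>i\<in>I. f i y) = (\<Sum>i\<in>I. mean_inner w (f i))"
  by (subst mean_inner_cnj) (simp add: mean_inner_sum_left assms mean_inner_cnj[of w])

definition mean_square :: "(real^'n \<Rightarrow> complex) \<Rightarrow> real" where
  "mean_square u = integral\<^sup>L cell_measure (\<lambda>y. (cmod (u y))\<^sup>2) / vol TYPE('n)"

lemma mean_inner_self: "mean_inner u u = complex_of_real (mean_square u)"
proof -
  have "(\<lambda>y. u y * cnj (u y)) = (\<lambda>y. complex_of_real ((cmod (u y))\<^sup>2))"
    by (simp only: complex_norm_square)
  then show ?thesis by (simp only: mean_inner_def mean_square_def integral_complex_of_real of_real_divide)
qed

lemma mean_square_nonneg: "mean_square u \<ge> 0"
  using vol_pos[where 'n = 'a] by (simp add: mean_square_def)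

definition fourier_coeff :: "(real^'n \<Rightarrow> complex) \<Rightarrow> ('n \<Rightarrow> int) \<Rightarrow> complex" where
  "fourier_coeff u k = mean_inner u (wave k)"

lemma square_integrable_wave: "square_integrable (wave k)"
  by (rule continuous_square_integrable[OF continuous_wave])

lemma fourier_coeff_wave: "fourier_coeff (wave l) k = (if k = l then 1 else 0)"
proof -
  have "(\<lambda>y. wave l y * cnj (wave k y)) = wave (\<lambda>i. l i + - k i)"
    by (rule ext) (simp only: wave_add wave_uminus)
  moreover have "(\<lambda>i. l i + - k i) = (\<lambda>_. 0) \<longleftrightarrow> k = l"
    by (auto simp: fun_eq_iff)
  ultimately show ?thesis
    using vol_pos[where 'n = 'a] by (simp only: fourier_coeff_def mean_inner_def integral_wave) auto
qed

definition trig_sum :: "('n \<Rightarrow> int) set \<Rightarrow> (('n \<Rightarrow> int) \<Rightarrow> complex) \<Rightarrow> real^'n \<Rightarrow> complex" where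
  "trig_sum F c y = (\<Sum>k\<in>F. c k * wave k y)"

lemma continuous_trig_sum: "continuous_on S (trig_sum F c)"
  unfolding trig_sum_def by (intro continuous_intros continuous_wave)

lemma square_integrable_trig_sum: "square_integrable (trig_sum F c)"
  by (rule continuous_square_integrable[OF continuous_trig_sum])

lemma fourier_coeff_trig_sum:
  "finite F \<Longrightarrow> fourier_coeff (trig_sum F c) k = (if k \<in> F then c k else 0)"
proof -
  assume F: "finite F"
  have "fourier_coeff (trig_sum F c) k = (\<Sum>l\<in>F. c l * fourier_coeff (wave l) k)"
    unfolding fourier_coeff_def trig_sum_def
    by (simp add: mean_inner_sum_left square_integrable_cmult square_integrable_wave mean_inner_cmult_left)
  also have "\<dots> = (\<Sum>l\<in>F. if k = l then c l else 0)"
    by (rule sum.cong) (auto simp: fourier_coeff_wave)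
  finally show ?thesis using F by simp
qed

lemma mean_inner_trig_sum_right:
  assumes "square_integrable u"
  shows "mean_inner u (trig_sum F c) = (\<Sum>k\<in>F. cnj (c k) * fourier_coeff u k)"
  unfolding fourier_coeff_def trig_sum_def
  by (simp add: mean_inner_sum_right square_integrable_cmult square_integrable_wave mean_inner_cmult_right assms)

lemma mean_square_trig_sum: "finite F \<Longrightarrow> mean_square (trig_sum F c) = (\<Sum>k\<in>F. (cmod (c k))\<^sup>2)"
proof -
  assume F: "finite F"
  have "complex_of_real (mean_square (trig_sum F c)) = (\<Sum>k\<in>F. complex_of_real ((cmod (c k))\<^sup>2))"
    unfolding mean_inner_self[symmetric] mean_inner_trig_sum_right[OF square_integrable_trig_sum]
    by (rule sum.cong) (auto simp: fourier_coeff_trig_sum F mult_cnj_self mult.commute[of "cnj _"])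
  also have "\<dots> = complex_of_real (\<Sum>k\<in>F. (cmod (c k))\<^sup>2)" by simp
  finally show ?thesis by (simp only: of_real_eq_iff)
qed

text \<open>The difference of the two sides is the mean square of \<open>u\<close> minus its partial Fourier sum.\<close>

lemma bessel_inequality:
  assumes u: "square_integrable u" and F: "finite F"
  shows "(\<Sum>k\<in>F. (cmod (fourier_coeff u k))\<^sup>2) \<le> mean_square u"
proof -
  define s where "s = trig_sum F (fourier_coeff u)"
  have s: "square_integrable s" unfolding s_def by (rule square_integrable_trig_sum)
  define S where "S = (\<Sum>k\<in>F. (cmod (fourier_coeff u k))\<^sup>2)"
  have us: "mean_inner u s = complex_of_real S"
    unfolding s_def S_def mean_inner_trig_sum_right[OF u] of_real_sum
    by (rule sum.cong) (auto simp: mult_cnj_self mult.commute[of "cnj _"])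
  have su: "mean_inner s u = complex_of_real S"
    by (subst mean_inner_cnj) (simp add: us)
  have ss: "mean_inner s s = complex_of_real S"
    unfolding mean_inner_self by (simp add: s_def S_def mean_square_trig_sum F)
  define m where "m = (\<lambda>y. (-1) * s y)"
  have m: "square_integrable m" unfolding m_def by (rule square_integrable_cmult[OF s])
  have um: "mean_inner u m = - complex_of_real S" "mean_inner m u = - complex_of_real S"
    "mean_inner m m = complex_of_real S"
    unfolding m_def mean_inner_cmult_left mean_inner_cmult_right us su ss by simp_all
  have "mean_inner (\<lambda>y. u y + m y) (\<lambda>y. u y + m y)
      = mean_inner u u + mean_inner u m + (mean_inner m u + mean_inner m m)"
    by (simp only: mean_inner_add_left mean_inner_add_right u m square_integrable_add)
  also have "\<dots> = complex_of_real (mean_square u - S)"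
    unfolding um by (simp add: mean_inner_self)
  finally have "complex_of_real (mean_square (\<lambda>y. u y + (-1) * s y)) = complex_of_real (mean_square u - S)"
    unfolding mean_inner_self m_def .
  then have "mean_square (\<lambda>y. u y + (-1) * s y) = mean_square u - S" by (simp only: of_real_eq_iff)
  then show ?thesis using mean_square_nonneg[of "\<lambda>y. u y + (-1) * s y"] by (simp add: S_def)
qed

definition fourier :: "(real^'n \<Rightarrow> complex) \<Rightarrow> ('n \<Rightarrow> int) ell2" where
  "fourier u = Abs_ell2 (fourier_coeff u)"

lemma
  assumes "square_integrable u"
  shows coord_fourier: "coord (fourier u) k = fourier_coeff u k"
    and norm_fourier_le: "(norm (fourier u))\<^sup>2 \<le> mean_square u"
proof -
  have b: "(\<Sum>k\<in>F. (cmod (fourier_coeff u k))\<^sup>2) \<le> (sqrt (mean_square u))\<^sup>2" if "finite F" for F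
    using bessel_inequality[OF assms that] mean_square_nonneg[of u] by simp
  note B = Abs_ell2_bounds[of "fourier_coeff u" "sqrt (mean_square u)", OF b]
  show "coord (fourier u) k = fourier_coeff u k"
    unfolding fourier_def by (subst coord_Abs[OF B(1)]) (auto simp: mean_square_nonneg)
  have "norm (fourier u) \<le> sqrt (mean_square u)"
    unfolding fourier_def by (rule B(2)) (auto simp: mean_square_nonneg)
  from power_mono[OF this, of 2] show "(norm (fourier u))\<^sup>2 \<le> mean_square u"
    by (simp add: mean_square_nonneg)
qed

lemma fourier_add:
  "square_integrable u \<Longrightarrow> square_integrable v \<Longrightarrow> fourier (\<lambda>y. u y + v y) = fourier u + fourier v"
  by (rule ell2_eqI)
    (simp add: coord_fourier square_integrable_add coord_simps fourier_coeff_def mean_inner_add_left square_integrable_wave)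

lemma coord_fourier_cmult: "square_integrable u \<Longrightarrow> coord (fourier (\<lambda>y. c * u y)) k = c * coord (fourier u) k"
  by (simp add: coord_fourier square_integrable_cmult fourier_coeff_def mean_inner_cmult_left)

lemma fourier_scaleR:
  "square_integrable u \<Longrightarrow> fourier (\<lambda>y. complex_of_real r * u y) = r *\<^sub>R fourier u"
  by (rule ell2_eqI) (simp add: coord_fourier_cmult coord_simps scaleR_conv_of_real)

lemma mean_inner_cong_AE:
  assumes "square_integrable u" "square_integrable u'" "square_integrable v"
    "AE y in cell_measure. u y = u' y"
  shows "mean_inner u v = mean_inner u' v"
proof -
  note [measurable] = square_integrableD(1)[OF assms(1)] square_integrableD(1)[OF assms(2)] square_integrableD(1)[OF assms(3)]
  have "integral\<^sup>L cell_measure (\<lambda>y. u y * cnj (v y)) = integral\<^sup>L cell_measure (\<lambda>y. u' y * cnj (v y))"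
    by (rule integral_cong_AE) (use assms(4) in auto)
  then show ?thesis by (simp add: mean_inner_def)
qed

lemma fourier_cong_AE:
  assumes "square_integrable u" "square_integrable u'" "AE y in cell_measure. u y = u' y"
  shows "fourier u = fourier u'"
  by (rule ell2_eqI)
    (simp only: coord_fourier[OF assms(1)] coord_fourier[OF assms(2)] fourier_coeff_def
      mean_inner_cong_AE[OF assms(1,2) square_integrable_wave assms(3)])

lemma fourier_eq_0:
  assumes u: "square_integrable u" and "fourier u = 0"
  shows "AE y in cell_measure. u y = 0"
proof (rule wave_complete[OF square_integrable_integrable[OF u]])
  fix k
  have "fourier_coeff u (\<lambda>i. - k i) = 0"
    using assms by (metis coord_fourier zero_ell2.rep_eq)
  then show "integral\<^sup>L cell_measure (\<lambda>y. u y * wave k y) = 0"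
    using vol_pos[where 'n = 'a] wave_uminus[of k] by (simp add: fourier_coeff_def mean_inner_def wave_uminus)
qed

subsection \<open>The Riesz--Fischer theorem\<close>

lemma AE_summable_if_summable_integrals:
  fixes g :: "nat \<Rightarrow> 'a \<Rightarrow> complex"
  assumes g: "\<And>n. integrable M (g n)" and s: "summable (\<lambda>n. integral\<^sup>L M (\<lambda>y. norm (g n y)))"
  shows "AE y in M. summable (\<lambda>n. norm (g n y))"
proof -
  have [measurable]: "g n \<in> borel_measurable M" for n using g by auto
  have "(\<integral>\<^sup>+y. (\<Sum>n. ennreal (norm (g n y))) \<partial>M) = (\<Sum>n. \<integral>\<^sup>+y. ennreal (norm (g n y)) \<partial>M)"
    by (rule nn_integral_suminf) auto
  also have "\<dots> = (\<Sum>n. ennreal (integral\<^sup>L M (\<lambda>y. norm (g n y))))"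
    by (intro suminf_cong nn_integral_eq_integral) (auto intro: g)
  also have "\<dots> \<noteq> \<infinity>"
    unfolding infinity_ennreal_def by (rule ennreal_suminf_neq_top[OF s]) simp
  finally have "AE y in M. (\<Sum>n. ennreal (norm (g n y))) \<noteq> \<infinity>"
    by (intro nn_integral_PInf_AE) auto
  then show ?thesis
  proof eventually_elim
    case (elim y)
    then show ?case by (intro summable_suminf_not_top) auto
  qed
qed

text \<open>Partial Fourier sums over such sets form a fast Cauchy sequence in \<open>L\<^sup>2\<close>, so that they converge almost
everywhere as they stand, without passing to a subsequence.\<close>

lemma exhausting_finite_sets:
  fixes c :: "'k ell2"
  obtains F :: "nat \<Rightarrow> 'k set" where "\<And>n. finite (F n)" "\<And>n. F n \<subseteq> F (Suc n)"
    "\<And>n G. finite G \<Longrightarrow> G \<inter> F n = {} \<Longrightarrow> (\<Sum>k\<in>G. (cmod (coord c k))\<^sup>2) \<le> (1/4) ^ n"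
proof -
  have "\<exists>F. finite F \<and> (\<forall>G. finite G \<longrightarrow> G \<inter> F = {} \<longrightarrow> (\<Sum>k\<in>G. (cmod (coord c k))\<^sup>2) \<le> (1/4) ^ n)" for n
  proof -
    obtain F where F: "finite F" "dist (\<Sum>k\<in>F. (cmod (coord c k))\<^sup>2) ((norm c)\<^sup>2) \<le> (1/4) ^ n"
      using has_sum_finite_approximation[OF norm_ell2_has_sum[of c], of "(1/4)^n"] by auto
    have "(\<Sum>k\<in>G. (cmod (coord c k))\<^sup>2) \<le> (1/4) ^ n" if G: "finite G" "G \<inter> F = {}" for G
    proof -
      have "(\<Sum>k\<in>G \<union> F. (cmod (coord c k))\<^sup>2) \<le> (norm c)\<^sup>2"
        by (rule sum_cmod_square_le) (use F G in auto)
      then show ?thesis using F G by (simp add: sum.union_disjoint dist_real_def)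
    qed
    then show ?thesis using F by blast
  qed
  then obtain F' where F': "\<And>n. finite (F' n)"
    "\<And>n G. finite G \<Longrightarrow> G \<inter> F' n = {} \<Longrightarrow> (\<Sum>k\<in>G. (cmod (coord c k))\<^sup>2) \<le> (1/4) ^ n" by metis
  show ?thesis
  proof (rule that[of "\<lambda>n. \<Union>i\<le>n. F' i"])
    show "finite (\<Union>i\<le>n. F' i)" for n using F'(1) by simp
    show "(\<Union>i\<le>n. F' i) \<subseteq> (\<Union>i\<le>Suc n. F' i)" for n by (auto intro: le_SucI)
    show "(\<Sum>k\<in>G. (cmod (coord c k))\<^sup>2) \<le> (1/4) ^ n" if "finite G" "G \<inter> (\<Union>i\<le>n. F' i) = {}" for n G
    proof (rule F'(2)[OF that(1)])
      show "G \<inter> F' n = {}" using that(2) by blast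
    qed
  qed
qed

text \<open>The partial sums \<open>s\<^sub>n\<close> over an exhausting sequence of finite sets have increments whose \<open>L\<^sup>1\<close> norms decay
geometrically. Hence they converge almost everywhere, dominated by an integrable function, and the
Fourier coefficients pass to the limit. Fatou's lemma bounds the mean square of the limit. The limit is
periodic everywhere because it is defined pointwise from periodic functions.\<close>

theorem riesz_fischer:
  fixes c :: "('n::finite \<Rightarrow> int) ell2"
  obtains u :: "real^'n \<Rightarrow> complex" where
    "u \<in> borel_measurable borel" "\<And>p y. p \<in> int_vecs \<Longrightarrow> u (y + (2 * pi) *\<^sub>R p) = u y"
    "square_integrable u" "fourier u = c" "mean_square u \<le> (norm c)\<^sup>2"
proof -
  obtain F :: "nat \<Rightarrow> ('n \<Rightarrow> int) set" where F: "\<And>n. finite (F n)" "\<And>n. F n \<subseteq> F (Suc n)"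
    and tail: "\<And>n G. finite G \<Longrightarrow> G \<inter> F n = {} \<Longrightarrow> (\<Sum>k\<in>G. (cmod (coord c k))\<^sup>2) \<le> (1/4) ^ n"
    using exhausting_finite_sets[of c] by metis
  define s where "s n = trig_sum (F n) (coord c)" for n
  define g where "g n = (case n of 0 \<Rightarrow> s 0 | Suc m \<Rightarrow> trig_sum (F (Suc m) - F m) (coord c))" for n
  have sum_g: "(\<Sum>i<Suc n. g i y) = s n y" for n y
  proof (induction n)
    case 0
    then show ?case by (simp add: g_def)
  next
    case (Suc n)
    have "trig_sum (F (Suc n) - F n) (coord c) y + s n y = s (Suc n) y"
      unfolding s_def trig_sum_def by (subst sum.subset_diff[OF F(2)[of n]]) (auto simp: F)
    moreover have "g (Suc n) y = trig_sum (F (Suc n) - F n) (coord c) y" by (simp add: g_def)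
    moreover have "(\<Sum>i<Suc (Suc n). g i y) = s n y + g (Suc n) y" using Suc by (simp only: sum.lessThan_Suc)
    ultimately show ?case by (simp only: add.commute)
  qed
  have contg: "continuous_on UNIV (g n)" for n
    by (cases n) (auto simp: g_def s_def continuous_trig_sum)
  have intg: "integrable cell_measure (g n)" for n by (rule continuous_integrable_cell[OF contg])
  let ?v = "vol TYPE('n)"
  have v: "?v > 0" by (rule vol_pos)
  have gle: "integral\<^sup>L cell_measure (\<lambda>y. norm (g (Suc n) y)) \<le> ?v * (1/2) ^ n" for n
  proof -
    \<comment> \<open>The \<open>L\<^sup>1\<close> norm is estimated by \<open>\<bar>g\<bar> \<le> (\<epsilon> + \<bar>g\<bar>\<^sup>2/\<epsilon>)/2\<close> with \<open>\<epsilon> = 2\<^sup>-\<^sup>n\<close>, the size of the \<open>L\<^sup>2\<close> norm.\<close>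
    define e :: real where "e = (1/2) ^ n"
    have e: "e > 0" "e * e = (1/4) ^ n" by (simp_all add: e_def power_mult_distrib[symmetric])
    have int2: "integrable cell_measure (\<lambda>y. (cmod (g (Suc n) y))\<^sup>2)"
      by (intro continuous_integrable_cell continuous_intros contg)
    have m2: "integral\<^sup>L cell_measure (\<lambda>y. (cmod (g (Suc n) y))\<^sup>2) \<le> ?v * (e * e)"
    proof -
      have "mean_square (g (Suc n)) \<le> (1/4) ^ n"
        unfolding g_def by (simp add: mean_square_trig_sum F) (rule tail, auto simp: F)
      then show ?thesis using v unfolding e(2) mean_square_def by (simp add: pos_divide_le_eq mult.commute)
    qed
    have cm: "integral\<^sup>L (cell_measure :: (real^'n) measure) (\<lambda>_. e) = ?v * e"
      by (simp add: vol_def measure_restrict_space)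
    have "integral\<^sup>L cell_measure (\<lambda>y. norm (g (Suc n) y))
        \<le> integral\<^sup>L cell_measure (\<lambda>y. (e + (1/e) * (cmod (g (Suc n) y))\<^sup>2) / 2)"
    proof (rule integral_mono)
      show "integrable cell_measure (\<lambda>y. (e + (1/e) * (cmod (g (Suc n) y))\<^sup>2) / 2)"
        by (intro integrable_divide_zero Bochner_Integration.integrable_add
            Bochner_Integration.integrable_mult_right impI int2
            finite_measure.integrable_const[OF finite_cell_measure])
      show "norm (g (Suc n) y) \<le> (e + (1/e) * (cmod (g (Suc n) y))\<^sup>2) / 2" for y
        using zero_le_power2[of "e - cmod (g (Suc n) y)"] e(1)
        by (simp add: field_simps power2_eq_square)
    qed (auto intro: intg)
    also have "\<dots> = (?v * e + (1/e) * integral\<^sup>L cell_measure (\<lambda>y. (cmod (g (Suc n) y))\<^sup>2)) / 2"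
    proof -
      have "integral\<^sup>L cell_measure (\<lambda>y. e + (1/e) * (cmod (g (Suc n) y))\<^sup>2)
          = integral\<^sup>L cell_measure (\<lambda>_ :: real^'n. e) + integral\<^sup>L cell_measure (\<lambda>y. (1/e) * (cmod (g (Suc n) y))\<^sup>2)"
        by (intro Bochner_Integration.integral_add Bochner_Integration.integrable_mult_right impI int2
            finite_measure.integrable_const[OF finite_cell_measure])
      also have "\<dots> = ?v * e + (1/e) * integral\<^sup>L cell_measure (\<lambda>y. (cmod (g (Suc n) y))\<^sup>2)"
        by (simp only: cm integral_mult_right_zero)
      finally show ?thesis by (simp only: integral_divide_zero)
    qed
    also have "\<dots> \<le> (?v * e + (1/e) * (?v * (e * e))) / 2"
      using m2 e(1) by (intro divide_right_mono add_left_mono mult_left_mono) auto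
    also have "\<dots> = ?v * e" using e(1) by simp
    finally show ?thesis by (simp add: e_def)
  qed
  have summ: "summable (\<lambda>n. integral\<^sup>L cell_measure (\<lambda>y. norm (g n y)))"
  proof (subst summable_Suc_iff[symmetric], rule summable_comparison_test')
    show "summable (\<lambda>n. ?v * (1/2) ^ n)" by (intro summable_mult summable_geometric) simp
    show "norm (integral\<^sup>L cell_measure (\<lambda>y. norm (g (Suc n) y))) \<le> ?v * (1/2) ^ n" if "n \<ge> 0" for n
      using gle[of n] by simp
  qed
  have AEs: "AE y in cell_measure. summable (\<lambda>n. norm (g n y))"
    by (rule AE_summable_if_summable_integrals[OF intg summ])
  define u where "u y = lim (\<lambda>n. s n y)" for y
  have s_meas: "s n \<in> borel_measurable borel" for n
    unfolding s_def by (rule borel_measurable_continuous_onI[OF continuous_trig_sum])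
  have u_meas: "u \<in> borel_measurable borel"
    unfolding u_def by (rule borel_measurable_lim_metric[OF s_meas])
  have u_per: "u (y + (2 * pi) *\<^sub>R p) = u y" if "p \<in> int_vecs" for p y
    by (simp add: u_def s_def trig_sum_def wave_periodic that)
  have lim_u: "AE y in cell_measure. (\<lambda>n. s n y) \<longlonglongrightarrow> u y"
    using AEs
  proof eventually_elim
    case (elim y)
    then have "summable (\<lambda>n. g n y)" by (rule summable_norm_cancel)
    then have "(\<lambda>n. \<Sum>i<Suc n. g i y) \<longlonglongrightarrow> (\<Sum>n. g n y)"
      by (intro LIMSEQ_Suc summable_LIMSEQ)
    then have "(\<lambda>n. s n y) \<longlonglongrightarrow> (\<Sum>n. g n y)" by (simp only: sum_g)
    then show ?case by (simp add: u_def limI)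
  qed
  have u_meas': "u \<in> borel_measurable cell_measure"
    using u_meas by (intro measurable_cell measurable_completion) auto
  define w where "w y = (\<Sum>n. norm (g n y))" for y
  have w: "integrable cell_measure w"
    unfolding w_def
    by (rule integrable_suminf[where f = "\<lambda>n y. norm (g n y)"]) (use intg AEs summ in auto)
  have dom: "AE y in cell_measure. \<forall>n. norm (s n y) \<le> w y"
    using AEs
  proof eventually_elim
    case (elim y)
    show ?case
    proof
      fix n
      have "norm (s n y) \<le> (\<Sum>i<Suc n. norm (g i y))" unfolding sum_g[symmetric] by (rule norm_sum)
      also have "\<dots> \<le> w y" unfolding w_def by (rule sum_le_suminf[OF elim]) auto
      finally show "norm (s n y) \<le> w y" .
    qed
  qed
  have coeff: "fourier_coeff u k = coord c k" for k
  proof -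
    have "(\<lambda>n. integral\<^sup>L cell_measure (\<lambda>y. s n y * cnj (wave k y))) \<longlonglongrightarrow> integral\<^sup>L cell_measure (\<lambda>y. u y * cnj (wave k y))"
    proof (rule integral_dominated_convergence[OF _ _ w])
      show "(\<lambda>y. u y * cnj (wave k y)) \<in> borel_measurable cell_measure"
        using u_meas' square_integrableD(1)[OF square_integrable_wave[of k]] by measurable
      show "(\<lambda>y. s n y * cnj (wave k y)) \<in> borel_measurable cell_measure" for n
        unfolding s_def
        by (intro continuous_measurable_cell continuous_intros continuous_trig_sum continuous_wave)
      show "AE y in cell_measure. (\<lambda>n. s n y * cnj (wave k y)) \<longlonglongrightarrow> u y * cnj (wave k y)"
        using lim_u by eventually_elim (intro tendsto_intros)
      show "AE y in cell_measure. norm (s n y * cnj (wave k y)) \<le> w y" for n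
        using dom by eventually_elim (simp add: norm_mult)
    qed
    then have "(\<lambda>n. fourier_coeff (s n) k) \<longlonglongrightarrow> fourier_coeff u k"
      unfolding fourier_coeff_def mean_inner_def using v by (intro tendsto_divide tendsto_const) auto
    moreover have "(\<lambda>n. fourier_coeff (s n) k) \<longlonglongrightarrow> coord c k"
    proof (rule Lim_null[THEN iffD2], rule Lim_null_comparison)
      show "eventually (\<lambda>n. norm (fourier_coeff (s n) k - coord c k) \<le> (1/2) ^ n) sequentially"
      proof (rule always_eventually, rule allI)
        fix n
        show "norm (fourier_coeff (s n) k - coord c k) \<le> (1/2) ^ n"
        proof (cases "k \<in> F n")
          case False
          then have "(cmod (coord c k))\<^sup>2 \<le> (1/4) ^ n" using tail[of "{k}" n] by simp
          also have "(1/4 :: real) ^ n = ((1/2) ^ n)\<^sup>2"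
            by (simp add: power2_eq_square power_mult_distrib[symmetric])
          finally have "cmod (coord c k) \<le> (1/2) ^ n" by (rule power2_le_imp_le) simp
          then show ?thesis using False by (simp add: s_def fourier_coeff_trig_sum F)
        qed (simp add: s_def fourier_coeff_trig_sum F)
      qed
      show "(\<lambda>n. (1/2 :: real) ^ n) \<longlonglongrightarrow> 0" by (rule LIMSEQ_realpow_zero) auto
    qed
    ultimately show ?thesis by (rule LIMSEQ_unique)
  qed
  have nn: "(\<integral>\<^sup>+y. ennreal ((cmod (u y))\<^sup>2) \<partial>cell_measure) \<le> ennreal (?v * (norm c)\<^sup>2)"
  proof -
    have [measurable]: "s n \<in> borel_measurable cell_measure" for n
      unfolding s_def by (rule continuous_measurable_cell[OF continuous_trig_sum])
    have "(\<integral>\<^sup>+y. ennreal ((cmod (u y))\<^sup>2) \<partial>cell_measure)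
        = (\<integral>\<^sup>+y. liminf (\<lambda>n. ennreal ((cmod (s n y))\<^sup>2)) \<partial>cell_measure)"
    proof (rule nn_integral_cong_AE)
      show "AE y in cell_measure. ennreal ((cmod (u y))\<^sup>2) = liminf (\<lambda>n. ennreal ((cmod (s n y))\<^sup>2))"
        using lim_u
      proof eventually_elim
        case (elim y)
        then have "(\<lambda>n. ennreal ((cmod (s n y))\<^sup>2)) \<longlonglongrightarrow> ennreal ((cmod (u y))\<^sup>2)"
          by (intro tendsto_intros)
        then show ?case by (intro lim_imp_Liminf[symmetric]) auto
      qed
    qed
    also have "\<dots> \<le> liminf (\<lambda>n. \<integral>\<^sup>+y. ennreal ((cmod (s n y))\<^sup>2) \<partial>cell_measure)"
      by (rule nn_integral_liminf) auto
    also have "\<dots> \<le> liminf (\<lambda>n. ennreal (?v * (norm c)\<^sup>2))"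
    proof (rule Liminf_mono, rule always_eventually, rule allI)
      fix n
      have "(\<integral>\<^sup>+y. ennreal ((cmod (s n y))\<^sup>2) \<partial>cell_measure) = ennreal (integral\<^sup>L cell_measure (\<lambda>y. (cmod (s n y))\<^sup>2))"
        by (rule nn_integral_eq_integral) (auto simp: s_def square_integrable_trig_sum square_integrableD(2))
      also have "integral\<^sup>L cell_measure (\<lambda>y. (cmod (s n y))\<^sup>2) = ?v * (\<Sum>k\<in>F n. (cmod (coord c k))\<^sup>2)"
        using mean_square_trig_sum[OF F(1)[of n], of "coord c"] v by (simp add: mean_square_def s_def field_simps)
      also have "ennreal (?v * (\<Sum>k\<in>F n. (cmod (coord c k))\<^sup>2)) \<le> ennreal (?v * (norm c)\<^sup>2)"
        using v by (intro ennreal_leI mult_left_mono sum_cmod_square_le F) auto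
      finally show "(\<integral>\<^sup>+y. ennreal ((cmod (s n y))\<^sup>2) \<partial>cell_measure) \<le> ennreal (?v * (norm c)\<^sup>2)" .
    qed
    also have "\<dots> = ennreal (?v * (norm c)\<^sup>2)" by (simp add: Liminf_const)
    finally show ?thesis .
  qed
  have int_u: "integrable cell_measure (\<lambda>y. (cmod (u y))\<^sup>2)"
  proof (rule integrableI_nonneg)
    show "(\<lambda>y. (cmod (u y))\<^sup>2) \<in> borel_measurable cell_measure" using u_meas' by measurable
    show "(\<integral>\<^sup>+y. ennreal ((cmod (u y))\<^sup>2) \<partial>cell_measure) < \<infinity>"
      using nn le_less_trans[OF nn ennreal_less_top] by simp
  qed auto
  then have sq: "square_integrable u" using u_meas' by (simp add: square_integrable_def)
  have "integral\<^sup>L cell_measure (\<lambda>y. (cmod (u y))\<^sup>2) \<le> ?v * (norm c)\<^sup>2"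
    using nn v by (subst (asm) nn_integral_eq_integral[OF int_u]) (auto simp: ennreal_le_iff)
  then have "mean_square u \<le> (norm c)\<^sup>2" using v by (simp add: mean_square_def field_simps)
  moreover have "fourier u = c" by (rule ell2_eqI) (simp add: coord_fourier sq coeff)
  ultimately show ?thesis using that[of u] u_meas u_per sq by blast
qed

subsection \<open>Parseval's identity\<close>

text \<open>One inequality is Bessel's. For the other, the function that the Riesz--Fischer theorem makes from the
coefficients of \<open>u\<close> satisfies it, and equals \<open>u\<close> almost everywhere by completeness.\<close>

lemma mean_square_fourier:
  assumes u: "square_integrable u"
  shows "mean_square u = (norm (fourier u))\<^sup>2"
proof (rule antisym)
  obtain u' where u': "square_integrable u'" "fourier u' = fourier u" "mean_square u' \<le> (norm (fourier u))\<^sup>2"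
    using riesz_fischer[of "fourier u"] by metis
  have "fourier (\<lambda>y. u y + complex_of_real (-1) * u' y) = 0"
    by (simp only: fourier_add[OF u square_integrable_cmult[OF u'(1)]] fourier_scaleR[OF u'(1)] u'(2)) simp
  then have "AE y in cell_measure. u y + complex_of_real (-1) * u' y = 0"
    by (intro fourier_eq_0 square_integrable_add square_integrable_cmult u u'(1))
  then have ae: "AE y in cell_measure. u y = u' y" by eventually_elim simp
  note [measurable] = square_integrableD(1)[OF u] square_integrableD(1)[OF u'(1)]
  have "integral\<^sup>L cell_measure (\<lambda>y. (cmod (u y))\<^sup>2) = integral\<^sup>L cell_measure (\<lambda>y. (cmod (u' y))\<^sup>2)"
    by (rule integral_cong_AE) (use ae in auto)
  then have "mean_square u = mean_square u'" by (simp add: mean_square_def)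
  then show "mean_square u \<le> (norm (fourier u))\<^sup>2" using u' by simp
qed (rule norm_fourier_le[OF u])

lemma parseval_real:
  assumes u: "square_integrable u" and v: "square_integrable v"
  shows "Re (mean_inner u v) = fourier u \<bullet> fourier v"
proof -
  have "complex_of_real (mean_square (\<lambda>y. u y + v y)) = complex_of_real (mean_square u) + mean_inner u v
      + (mean_inner v u + complex_of_real (mean_square v))"
    unfolding mean_inner_self[symmetric]
    by (simp add: mean_inner_add_left mean_inner_add_right u v square_integrable_add)
  also have "mean_inner v u = cnj (mean_inner u v)" by (rule mean_inner_cnj)
  finally have "mean_square (\<lambda>y. u y + v y) = mean_square u + 2 * Re (mean_inner u v) + mean_square v"
    by (simp add: complex_eq_iff)
  then have "(norm (fourier u + fourier v))\<^sup>2 = (norm (fourier u))\<^sup>2 + 2 * Re (mean_inner u v) + (norm (fourier v))\<^sup>2"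
    by (simp only: mean_square_fourier square_integrable_add u v fourier_add)
  then show ?thesis
    by (simp add: power2_norm_eq_inner inner_add_left inner_add_right inner_commute)
qed

theorem parseval:
  assumes u: "square_integrable u" and v: "square_integrable v"
  shows "mean_inner u v = ell2_inner (fourier u) (fourier v)"
proof -
  have iv: "square_integrable (\<lambda>y. \<i> * v y)" by (rule square_integrable_cmult[OF v])
  have "ell2_inner (fourier u) (fourier (\<lambda>y. \<i> * v y)) = - \<i> * ell2_inner (fourier u) (fourier v)"
    by (rule ell2_innerI)
      (use has_sum_cmult_right[OF ell2_inner_has_sum[of "fourier u" "fourier v"], of "- \<i>"] in
        \<open>simp add: coord_fourier_cmult[OF v] mult_ac\<close>)
  then have "Im (mean_inner u v) = Im (ell2_inner (fourier u) (fourier v))"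
    using parseval_real[OF u iv] by (simp add: mean_inner_cmult_right inner_ell2_def)
  then show ?thesis
    using parseval_real[OF u v] by (simp add: complex_eq_iff inner_ell2_def)
qed

section \<open>Sobolev spaces on the torus in Fourier coordinates\<close>

lemma L2_per_square_integrable: "L2_per u \<Longrightarrow> square_integrable u"
  by (auto simp: L2_per_def square_integrable_def set_integrable_cell intro: measurable_cell)

lemma square_integrable_eq_AE:
  assumes u: "square_integrable u" and v: "square_integrable v" and "fourier u = fourier v"
  shows "AE y in cell_measure. u y = v y"
proof -
  have "fourier (\<lambda>y. u y + complex_of_real (-1) * v y) = 0"
    by (simp only: fourier_add[OF u square_integrable_cmult[OF v]] fourier_scaleR[OF v] assms(3)) simp
  then have "AE y in cell_measure. u y + complex_of_real (-1) * v y = 0"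
    by (intro fourier_eq_0 square_integrable_add square_integrable_cmult u v)
  then show ?thesis by eventually_elim simp
qed

text \<open>Such a function exists by the Riesz--Fischer theorem and is unique up to null sets.\<close>

definition synth :: "('n::finite \<Rightarrow> int) ell2 \<Rightarrow> real^'n \<Rightarrow> complex" where
  "synth c = (SOME u. L2_per u \<and> fourier u = c)"

lemma
  shows L2_per_synth: "L2_per (synth c)" and fourier_synth [simp]: "fourier (synth c) = c"
proof -
  obtain u where u: "u \<in> borel_measurable borel" "\<And>p y. p \<in> int_vecs \<Longrightarrow> u (y + (2 * pi) *\<^sub>R p) = u y"
    "square_integrable u" "fourier u = c"
    using riesz_fischer[of c] by metis
  have "u \<in> borel_measurable lebesgue" using u(1) by (intro measurable_completion) auto
  then have "L2_per u"
    using u(2,3) by (auto simp: L2_per_def periodic_ae_def set_integrable_cell square_integrable_def)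
  then have "\<exists>u. L2_per u \<and> fourier u = c" using u(4) by blast
  from someI_ex[OF this] show "L2_per (synth c)" "fourier (synth c) = c" by (auto simp: synth_def)
qed

lemma square_integrable_synth [simp]: "square_integrable (synth c)"
  by (rule L2_per_square_integrable[OF L2_per_synth])

subsection \<open>Weak derivatives\<close>

text \<open>The exponentials are test functions, and testing with them gives the coefficients.\<close>

lemma has_weak_deriv_coeff:
  assumes "L2_per u" "has_weak_deriv j u g"
  shows "coord (fourier g) k = \<i> * of_int (k j) * coord (fourier u) k"
proof -
  have sq: "square_integrable u" "square_integrable g"
    using assms by (auto simp: has_weak_deriv_def intro: L2_per_square_integrable)
  have w: "wave (\<lambda>i. - k i) = (\<lambda>y. cnj (wave k y))" by (rule ext) (rule wave_uminus)
  have "integral\<^sup>L cell_measure (\<lambda>y. u y * (\<i> * of_int (- k j) * wave (\<lambda>i. - k i) y))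
      = - integral\<^sup>L cell_measure (\<lambda>y. g y * wave (\<lambda>i. - k i) y)"
    using assms(2) test_fun_wave[of "\<lambda>i. - k i"] wave_deriv[of j "\<lambda>i. - k i"]
    unfolding has_weak_deriv_def set_integral_cell by blast
  also have "(\<lambda>y. u y * (\<i> * of_int (- k j) * wave (\<lambda>i. - k i) y)) = (\<lambda>y. (- (\<i> * of_int (k j))) * (u y * cnj (wave k y)))"
    by (simp add: w mult_ac)
  finally have "\<i> * of_int (k j) * integral\<^sup>L cell_measure (\<lambda>y. u y * cnj (wave k y))
      = integral\<^sup>L cell_measure (\<lambda>y. g y * cnj (wave k y))"
    unfolding integral_mult_right_zero w by simp
  then show ?thesis
    using vol_pos[where 'n = 'a] by (simp add: coord_fourier sq fourier_coeff_def mean_inner_def)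
qed

lemma partial_deriv_unique:
  "partial_deriv_is j f g \<Longrightarrow> partial_deriv_is j f h \<Longrightarrow> g = h"
  unfolding partial_deriv_is_def by (auto intro!: ext vector_derivative_unique_at)

text \<open>Integration by parts against an exponential. The conjugates appear because the integrals in the definition
of the weak derivative carry no conjugation, while the inner product does.\<close>

lemma test_fun_deriv_coeff:
  fixes \<phi> :: "real^'n \<Rightarrow> complex"
  assumes \<phi>: "test_fun \<phi>" and d: "partial_deriv_is j \<phi> \<psi>"
  shows "square_integrable \<phi>" "square_integrable \<psi>"
    "fourier_coeff (\<lambda>y. cnj (\<psi> y)) k = \<i> * of_int (k j) * fourier_coeff (\<lambda>y. cnj (\<phi> y)) k"
proof -
  obtain D :: "'n list \<Rightarrow> real^'n \<Rightarrow> complex" where D: "D [] = \<phi>" "\<And>l. continuous_on UNIV (D l)"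
    "\<And>i l. partial_deriv_is i (D l) (D (i # l))"
    using \<phi> unfolding test_fun_def smooth_fun_def by blast
  have per: "\<phi> (y + (2 * pi) *\<^sub>R p) = \<phi> y" if "p \<in> int_vecs" for p y
    using \<phi> that by (simp add: test_fun_def)
  have "\<psi> = D [j]" using partial_deriv_unique[OF d] D(3)[of j "[]"] D(1) by simp
  then have c\<psi>: "continuous_on UNIV \<psi>" using D(2) by simp
  have c\<phi>: "continuous_on UNIV \<phi>" using D(2)[of "[]"] D(1) by simp
  show "square_integrable \<phi>" "square_integrable \<psi>"
    using c\<phi> c\<psi> by (auto intro: continuous_square_integrable)
  have dc: "partial_deriv_is j (\<lambda>y. cnj (\<phi> y)) (\<lambda>y. cnj (\<psi> y))"
    using d unfolding partial_deriv_is_def by (auto intro: has_vector_derivative_cnj)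
  let ?k = "\<lambda>i. - k i"
  have "integral\<^sup>L cell_measure (\<lambda>y. cnj (\<phi> y) * (\<i> * of_int (?k j) * wave ?k y) + cnj (\<psi> y) * wave ?k y) = 0"
    by (rule integral_partial_deriv_zero[OF _ _ _ partial_deriv_mult[OF dc wave_deriv]])
      (auto intro!: continuous_intros continuous_wave c\<phi> c\<psi> simp: per wave_periodic)
  also have "(\<lambda>y. cnj (\<phi> y) * (\<i> * of_int (?k j) * wave ?k y) + cnj (\<psi> y) * wave ?k y)
      = (\<lambda>y. (- (\<i> * of_int (k j))) * (cnj (\<phi> y) * cnj (wave k y)) + cnj (\<psi> y) * cnj (wave k y))"
    by (simp add: wave_uminus mult_ac)
  finally have "- (\<i> * of_int (k j)) * integral\<^sup>L cell_measure (\<lambda>y. cnj (\<phi> y) * cnj (wave k y))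
      + integral\<^sup>L cell_measure (\<lambda>y. cnj (\<psi> y) * cnj (wave k y)) = 0"
    by (subst (asm) Bochner_Integration.integral_add)
      (auto intro!: continuous_integrable_cell continuous_intros continuous_wave c\<phi> c\<psi> simp del: complex_cnj_mult)
  then show "fourier_coeff (\<lambda>y. cnj (\<psi> y)) k = \<i> * of_int (k j) * fourier_coeff (\<lambda>y. cnj (\<phi> y)) k"
    using vol_pos[where 'n = 'n] unfolding fourier_coeff_def mean_inner_def
    by (simp add: add_eq_0_iff del: complex_cnj_mult)
qed

text \<open>By Parseval's identity both sides of the defining identity are sums over the frequencies, and they agree
term by term.\<close>

lemma has_weak_derivI:
  fixes u g :: "real^'n \<Rightarrow> complex"
  assumes u: "L2_per u" and g: "L2_per g"
    and coeff: "\<And>k. coord (fourier g) k = \<i> * of_int (k j) * coord (fourier u) k"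
  shows "has_weak_deriv j u g"
  unfolding has_weak_deriv_def
proof (intro conjI allI impI g)
  fix \<phi> \<psi> :: "real^'n \<Rightarrow> complex"
  assume "test_fun \<phi>" "partial_deriv_is j \<phi> \<psi>"
  note t = test_fun_deriv_coeff[OF this]
  have squ: "square_integrable u" "square_integrable g" using u g by (auto intro: L2_per_square_integrable)
  have sqt: "square_integrable (\<lambda>y. cnj (\<phi> y))" "square_integrable (\<lambda>y. cnj (\<psi> y))"
    using t by (auto intro: square_integrable_cnj)
  have "ell2_inner (fourier u) (fourier (\<lambda>y. cnj (\<psi> y))) = - ell2_inner (fourier g) (fourier (\<lambda>y. cnj (\<phi> y)))"
  proof (rule ell2_innerI)
    have "coord (fourier u) k * cnj (coord (fourier (\<lambda>y. cnj (\<psi> y))) k)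
        = - (coord (fourier g) k * cnj (coord (fourier (\<lambda>y. cnj (\<phi> y))) k))" for k
      by (simp add: coord_fourier[OF sqt(1)] coord_fourier[OF sqt(2)] t(3) coeff)
    then show "((\<lambda>k. coord (fourier u) k * cnj (coord (fourier (\<lambda>y. cnj (\<psi> y))) k)) has_sum
        - ell2_inner (fourier g) (fourier (\<lambda>y. cnj (\<phi> y)))) UNIV"
      using has_sum_uminusI[OF ell2_inner_has_sum[of "fourier g" "fourier (\<lambda>y. cnj (\<phi> y))"]]
      by (simp only:)
  qed
  then have "mean_inner u (\<lambda>y. cnj (\<psi> y)) = - mean_inner g (\<lambda>y. cnj (\<phi> y))"
    by (simp only: parseval squ sqt)
  then show "set_lebesgue_integral lebesgue cell (\<lambda>y. u y * \<psi> y)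
      = - set_lebesgue_integral lebesgue cell (\<lambda>y. g y * \<phi> y)"
  proof -
    assume *: "mean_inner u (\<lambda>y. cnj (\<psi> y)) = - mean_inner g (\<lambda>y. cnj (\<phi> y))"
    have v: "complex_of_real (vol TYPE('n)) \<noteq> 0" using vol_pos[where 'n = 'n] by simp
    have "integral\<^sup>L cell_measure (\<lambda>y. u y * \<psi> y) / complex_of_real (vol TYPE('n))
        = (- integral\<^sup>L cell_measure (\<lambda>y. g y * \<phi> y)) / complex_of_real (vol TYPE('n))"
      using * by (simp add: mean_inner_def)
    then show ?thesis using v unfolding set_integral_cell divide_cancel_right by blast
  qed
qed

lemma has_weak_deriv_synth:
  assumes "\<And>k. coord d k = \<i> * of_int (k j) * coord c k"
  shows "has_weak_deriv j (synth c) (synth d)"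
  by (rule has_weak_derivI[OF L2_per_synth L2_per_synth]) (simp add: assms)

lemma H_per_2_iff:
  "H_per 2 u \<longleftrightarrow> L2_per u \<and> (\<forall>i. \<exists>g. has_weak_deriv i u g \<and> (\<forall>j. \<exists>h. has_weak_deriv j g h))"
proof -
  have "has_weak_deriv i v g \<Longrightarrow> L2_per g" for i v and g :: "real^'a \<Rightarrow> complex"
    by (simp add: has_weak_deriv_def)
  then have "has_weak_deriv i v g \<and> L2_per g \<longleftrightarrow> has_weak_deriv i v g"
    "has_weak_deriv i v g \<and> L2_per g \<and> P \<longleftrightarrow> has_weak_deriv i v g \<and> P" for i v P and g :: "real^'a \<Rightarrow> complex"
    by blast+
  then show ?thesis unfolding numeral_2_eq_2 H_per.simps by (simp only:)
qed

text \<open>The definition provides some first derivative that has weak derivatives; the representative chosen by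
\<open>weak_deriv\<close> has the same Fourier coefficients and hence the same weak derivatives.\<close>

lemma H_per_2_weak_deriv:
  assumes "H_per 2 u"
  shows "has_weak_deriv j u (weak_deriv j u)"
    and "has_weak_deriv l (weak_deriv j u) (weak_deriv l (weak_deriv j u))"
proof -
  obtain g where g: "has_weak_deriv j u g" and h: "\<And>l. \<exists>h. has_weak_deriv l g h"
    using assms unfolding H_per_2_iff by blast
  have u: "L2_per u" using assms by (simp add: H_per_2_iff)
  show d: "has_weak_deriv j u (weak_deriv j u)"
    unfolding weak_deriv_def by (rule someI[of "has_weak_deriv j u", OF g])
  have "has_weak_deriv l (weak_deriv j u) h" if "has_weak_deriv l g h" for h
  proof (rule has_weak_derivI)
    show "L2_per (weak_deriv j u)" "L2_per h" using d that by (auto simp: has_weak_deriv_def)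
    have "L2_per g" using g by (auto simp: has_weak_deriv_def)
    then show "coord (fourier h) k = \<i> * of_int (k l) * coord (fourier (weak_deriv j u)) k" for k
      using has_weak_deriv_coeff[OF _ that] has_weak_deriv_coeff[OF u g] has_weak_deriv_coeff[OF u d] by simp
  qed
  then have "\<exists>h. has_weak_deriv l (weak_deriv j u) h" using h by blast
  then show "has_weak_deriv l (weak_deriv j u) (weak_deriv l (weak_deriv j u))"
    unfolding weak_deriv_def[of l] by (rule someI_ex)
qed

subsection \<open>Fourier multipliers\<close>

definition freq :: "('n::finite \<Rightarrow> int) \<Rightarrow> real^'n" where
  "freq k = (\<chi> j. of_int (k j))"

lemma norm_vec_square: "(norm (v :: real^'n))\<^sup>2 = (\<Sum>j\<in>UNIV. (v $ j)\<^sup>2)"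
  unfolding power2_norm_eq_inner inner_vec_def by (simp add: power2_eq_square)

text \<open>The weight describes the \<open>H\<^sup>2\<close> norm. It is \<open>1\<close> at frequency zero, so that the constant function has norm one
and is an eigenvector of the mass operator, and \<open>\<bar>k\<bar>\<^sup>2\<close> elsewhere, which is comparable to \<open>1 + \<bar>k\<bar>\<^sup>2\<close>
because nonzero frequencies have length at least one.\<close>

definition weight :: "('n::finite \<Rightarrow> int) \<Rightarrow> real" where
  "weight k = max 1 ((norm (freq k))\<^sup>2)"

lemma weight_ge: "1 \<le> weight k" "(norm (freq k))\<^sup>2 \<le> weight k" "norm (freq k) \<le> weight k" "weight k > 0"
proof -
  show a: "1 \<le> weight k" "(norm (freq k))\<^sup>2 \<le> weight k" by (auto simp: weight_def)
  then show "weight k > 0" by simp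
  show "norm (freq k) \<le> weight k"
  proof (cases "norm (freq k) \<le> 1")
    case False
    then have "norm (freq k) * 1 \<le> norm (freq k) * norm (freq k)" by (intro mult_left_mono) auto
    then show ?thesis using a(2) by (simp add: power2_eq_square)
  qed (use a in simp)
qed

lemma freq_nth: "freq k $ j = of_int (k j)"
  by (simp add: freq_def)

lemma norm_freq_ge_1: "k \<noteq> (\<lambda>_. 0) \<Longrightarrow> 1 \<le> norm (freq k)"
proof -
  assume "k \<noteq> (\<lambda>_. 0)"
  then obtain j where "k j \<noteq> 0" by auto
  then have "1 \<le> \<bar>freq k $ j\<bar>" by (simp add: freq_nth)
  then show ?thesis using component_le_norm_cart[of "freq k" j] by linarith
qed

lemma bounded_funI: "(\<And>k. cmod (m k) \<le> B) \<Longrightarrow> bounded_fun m"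
  by (auto simp: bounded_fun_def)

lemma bounded_fun_div_weight:
  assumes "\<And>k. cmod (m k) \<le> B * weight k"
  shows "bounded_fun (\<lambda>k. m k / complex_of_real (weight k))"
  by (rule bounded_funI[of _ B])
    (use assms in \<open>simp add: norm_divide pos_divide_le_eq[OF weight_ge(4)] abs_of_pos[OF weight_ge(4)]\<close>)

lemma bounded_fun_add: "bounded_fun a \<Longrightarrow> bounded_fun b \<Longrightarrow> bounded_fun (\<lambda>k. a k + b k)"
  unfolding bounded_fun_def by (meson add_mono norm_triangle_le)

lemma bounded_fun_scale: "bounded_fun a \<Longrightarrow> bounded_fun (\<lambda>k. c * a k)"
  unfolding bounded_fun_def norm_mult by (meson mult_left_mono norm_ge_zero)

lemma bounded_fun_sum: "(\<And>i. i \<in> I \<Longrightarrow> bounded_fun (a i)) \<Longrightarrow> bounded_fun (\<lambda>k. \<Sum>i\<in>I. a i k)"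
  by (induction I rule: infinite_finite_induct)
    (auto intro: bounded_fun_add bounded_funI[of "\<lambda>_. 0" 0])

lemma bounded_fun_cnj: "bounded_fun a \<Longrightarrow> bounded_fun (\<lambda>k. cnj (a k))"
  by (simp add: bounded_fun_def)

lemma diag_op_add:
  "bounded_fun a \<Longrightarrow> bounded_fun b \<Longrightarrow> diag_op (\<lambda>k. a k + b k) = diag_op a + diag_op b"
  by (rule blinfun_eqI, rule ell2_eqI)
    (simp add: coord_diag_op bounded_fun_add blinfun.add_left coord_simps distrib_right)

lemma diag_op_scaleR:
  "bounded_fun a \<Longrightarrow> diag_op (\<lambda>k. complex_of_real r * a k) = r *\<^sub>R diag_op a"
  by (rule blinfun_eqI, rule ell2_eqI)
    (simp add: coord_diag_op bounded_fun_scale blinfun.scaleR_left coord_simps scaleR_conv_of_real mult.assoc)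

lemma diag_op_zero: "diag_op (\<lambda>_. 0) = 0"
  by (rule blinfun_eqI, rule ell2_eqI) (simp add: coord_diag_op bounded_funI[of _ 0] coord_simps)

lemma diag_op_sum:
  "(\<And>i. i \<in> I \<Longrightarrow> bounded_fun (a i)) \<Longrightarrow> diag_op (\<lambda>k. \<Sum>i\<in>I. a i k) = (\<Sum>i\<in>I. diag_op (a i))"
  by (induction I rule: infinite_finite_induct) (auto simp: diag_op_add bounded_fun_sum diag_op_zero)

text \<open>The symbols of \<open>\<partial>\<^sub>j + i\<eta>\<^sub>j\<close> and of \<open>(\<nabla> + i\<eta>)\<^sup>2\<close>, divided by the weight: they act on weighted coordinates, and
they are bounded.\<close>

definition grad_symbol :: "'n \<Rightarrow> real^'n \<Rightarrow> ('n::finite \<Rightarrow> int) \<Rightarrow> complex" where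
  "grad_symbol j \<eta> k = \<i> * complex_of_real ((freq k + \<eta>) $ j) / complex_of_real (weight k)"

definition lap_symbol :: "real^'n \<Rightarrow> ('n::finite \<Rightarrow> int) \<Rightarrow> complex" where
  "lap_symbol \<eta> k = - complex_of_real ((norm (freq k + \<eta>))\<^sup>2) / complex_of_real (weight k)"

lemma grad_symbol_split:
  "grad_symbol j \<eta> k = \<i> * complex_of_real (freq k $ j) / complex_of_real (weight k)
     + complex_of_real (\<eta> $ j) * (\<i> / complex_of_real (weight k))"
  by (simp add: grad_symbol_def add_divide_distrib distrib_left)

lemma bounded_freq_nth: "bounded_fun (\<lambda>k. c * complex_of_real (freq k $ j) / complex_of_real (weight k))"
proof (rule bounded_fun_div_weight)
  show "cmod (c * complex_of_real (freq k $ j)) \<le> cmod c * weight k" for k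
    unfolding norm_mult norm_of_real
    using component_le_norm_cart[of "freq k" j] weight_ge(3)[of k] by (intro mult_left_mono) auto
qed

lemma bounded_inv_weight: "bounded_fun (\<lambda>k. c / complex_of_real (weight k))"
proof (rule bounded_fun_div_weight)
  show "cmod c \<le> cmod c * weight k" for k
    using mult_left_mono[OF weight_ge(1)[of k], of "cmod c"] by simp
qed

lemma bounded_grad_symbol: "bounded_fun (grad_symbol j \<eta>)"
  unfolding grad_symbol_split by (intro bounded_fun_add bounded_fun_scale bounded_freq_nth bounded_inv_weight)

lemma lap_symbol_split:
  "lap_symbol \<eta> k = - complex_of_real ((norm (freq k))\<^sup>2) / complex_of_real (weight k)
     + (\<Sum>j\<in>UNIV. complex_of_real (\<eta> $ j) * (- 2 * complex_of_real (freq k $ j) / complex_of_real (weight k)))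
     + (\<Sum>j\<in>UNIV. complex_of_real ((\<eta> $ j)\<^sup>2) * (- 1 / complex_of_real (weight k)))"
proof -
  have "(norm (freq k + \<eta>))\<^sup>2 = (norm (freq k))\<^sup>2 + 2 * (\<Sum>j\<in>UNIV. \<eta> $ j * freq k $ j) + (\<Sum>j\<in>UNIV. (\<eta> $ j)\<^sup>2)"
  proof -
    have "(norm (freq k + \<eta>))\<^sup>2 = (norm (freq k))\<^sup>2 + 2 * (\<eta> \<bullet> freq k) + (norm \<eta>)\<^sup>2"
      by (simp add: power2_norm_eq_inner inner_add_left inner_add_right inner_commute)
    moreover have "(norm \<eta>)\<^sup>2 = (\<Sum>j\<in>UNIV. (\<eta> $ j)\<^sup>2)"
      by (rule norm_vec_square)
    moreover have "\<eta> \<bullet> freq k = (\<Sum>j\<in>UNIV. \<eta> $ j * freq k $ j)" by (simp add: inner_vec_def)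
    ultimately show ?thesis by simp
  qed
  then show ?thesis
    by (simp add: lap_symbol_def sum_distrib_left sum_distrib_right sum_divide_distrib sum_negf
        add_divide_distrib diff_divide_distrib mult_ac)
qed

lemma bounded_norm_freq: "bounded_fun (\<lambda>k. - complex_of_real ((norm (freq k))\<^sup>2) / complex_of_real (weight k))"
  by (rule bounded_fun_div_weight[of _ 1])
    (use weight_ge(2) in \<open>simp only: norm_minus_cancel norm_of_real abs_power2 mult_1\<close>)

lemmas bounded_lap_symbol_intros = bounded_fun_add bounded_fun_sum bounded_fun_scale bounded_freq_nth
  bounded_inv_weight bounded_norm_freq

lemma bounded_lap_symbol: "bounded_fun (lap_symbol \<eta>)"
  unfolding lap_symbol_split by (intro bounded_lap_symbol_intros)

definition grad_op :: "'n \<Rightarrow> real^'n \<Rightarrow> ('n::finite \<Rightarrow> int) ell2 \<Rightarrow>\<^sub>L ('n \<Rightarrow> int) ell2" where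
  "grad_op j \<eta> = diag_op (grad_symbol j \<eta>)"

definition grad_adj :: "'n \<Rightarrow> real^'n \<Rightarrow> ('n::finite \<Rightarrow> int) ell2 \<Rightarrow>\<^sub>L ('n \<Rightarrow> int) ell2" where
  "grad_adj j \<eta> = diag_op (\<lambda>k. cnj (grad_symbol j \<eta> k))"

definition lap_op :: "real^'n \<Rightarrow> ('n::finite \<Rightarrow> int) ell2 \<Rightarrow>\<^sub>L ('n \<Rightarrow> int) ell2" where
  "lap_op \<eta> = diag_op (lap_symbol \<eta>)"

lemma analytic_germ_scaleR:
  "analytic_germ f x \<Longrightarrow> analytic_germ g x \<Longrightarrow> analytic_germ (\<lambda>y. f y *\<^sub>R g y) x"
  by (rule analytic_germ_bilinear[OF bounded_bilinear_scaleR])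

lemma analytic_grad_op: "analytic_germ (grad_op j) \<eta>"
proof -
  have "grad_op j = (\<lambda>\<eta>. diag_op (\<lambda>k. \<i> * complex_of_real (freq k $ j) / complex_of_real (weight k))
      + (\<eta> $ j) *\<^sub>R diag_op (\<lambda>k. \<i> / complex_of_real (weight k)))"
    unfolding grad_op_def grad_symbol_split
    by (intro ext) (simp only: diag_op_add[OF bounded_freq_nth bounded_fun_scale[OF bounded_inv_weight]]
          diag_op_scaleR[OF bounded_inv_weight])
  then show ?thesis
    by (simp only:) (intro analytic_germ_add analytic_germ_const analytic_germ_scaleR analytic_germ_nth)
qed

lemma analytic_grad_adj: "analytic_germ (grad_adj j) \<eta>"
proof -
  have "grad_adj j = (\<lambda>\<eta>. diag_op (\<lambda>k. - \<i> * complex_of_real (freq k $ j) / complex_of_real (weight k))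
      + (\<eta> $ j) *\<^sub>R diag_op (\<lambda>k. - \<i> / complex_of_real (weight k)))"
  proof
    fix \<eta>
    have "(\<lambda>k. cnj (grad_symbol j \<eta> k)) = (\<lambda>k. - \<i> * complex_of_real (freq k $ j) / complex_of_real (weight k)
        + complex_of_real (\<eta> $ j) * (- \<i> / complex_of_real (weight k)))"
      by (simp add: grad_symbol_split)
    then show "grad_adj j \<eta> = diag_op (\<lambda>k. - \<i> * complex_of_real (freq k $ j) / complex_of_real (weight k))
        + (\<eta> $ j) *\<^sub>R diag_op (\<lambda>k. - \<i> / complex_of_real (weight k))"
      unfolding grad_adj_def
      by (simp only: diag_op_add[OF bounded_freq_nth bounded_fun_scale[OF bounded_inv_weight]]
          diag_op_scaleR[OF bounded_inv_weight])
  qed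
  then show ?thesis
    by (simp only:) (intro analytic_germ_add analytic_germ_const analytic_germ_scaleR analytic_germ_nth)
qed

lemma analytic_lap_op: "analytic_germ lap_op (\<eta> :: real^'n)"
proof -
  have "lap_op = (\<lambda>\<eta> :: real^'n. diag_op (\<lambda>k. - complex_of_real ((norm (freq k))\<^sup>2) / complex_of_real (weight k))
      + (\<Sum>j\<in>UNIV. (\<eta> $ j) *\<^sub>R diag_op (\<lambda>k. - 2 * complex_of_real (freq k $ j) / complex_of_real (weight k)))
      + (\<Sum>j\<in>UNIV. (\<eta> $ j)\<^sup>2 *\<^sub>R diag_op (\<lambda>k. - 1 / complex_of_real (weight k))))"
  proof
    fix \<eta> :: "real^'n"
    show "lap_op \<eta> = diag_op (\<lambda>k. - complex_of_real ((norm (freq k))\<^sup>2) / complex_of_real (weight k))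
      + (\<Sum>j\<in>UNIV. (\<eta> $ j) *\<^sub>R diag_op (\<lambda>k. - 2 * complex_of_real (freq k $ j) / complex_of_real (weight k)))
      + (\<Sum>j\<in>UNIV. (\<eta> $ j)\<^sup>2 *\<^sub>R diag_op (\<lambda>k. - 1 / complex_of_real (weight k)))"
    proof -
      let ?a = "\<lambda>k :: 'n \<Rightarrow> int. - complex_of_real ((norm (freq k))\<^sup>2) / complex_of_real (weight k)"
      let ?b = "\<lambda>j (k :: 'n \<Rightarrow> int). complex_of_real (\<eta> $ j) * (- 2 * complex_of_real (freq k $ j) / complex_of_real (weight k))"
      let ?c = "\<lambda>j (k :: 'n \<Rightarrow> int). complex_of_real ((\<eta> $ j)\<^sup>2) * (- 1 / complex_of_real (weight k))"
      have b: "bounded_fun (?b j)" and c: "bounded_fun (?c j)" for j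
        by (intro bounded_fun_scale bounded_freq_nth bounded_inv_weight)+
      have "lap_op \<eta> = diag_op (\<lambda>k. (?a k + (\<Sum>j\<in>UNIV. ?b j k)) + (\<Sum>j\<in>UNIV. ?c j k))"
        unfolding lap_op_def by (rule arg_cong[where f = diag_op], rule ext) (rule lap_symbol_split)
      also have "\<dots> = diag_op (\<lambda>k. ?a k + (\<Sum>j\<in>UNIV. ?b j k)) + diag_op (\<lambda>k. \<Sum>j\<in>UNIV. ?c j k)"
        by (rule diag_op_add) (intro bounded_fun_add bounded_fun_sum b c bounded_norm_freq)+
      also have "diag_op (\<lambda>k. ?a k + (\<Sum>j\<in>UNIV. ?b j k)) = diag_op ?a + diag_op (\<lambda>k. \<Sum>j\<in>UNIV. ?b j k)"
        by (rule diag_op_add) (intro bounded_fun_sum b bounded_norm_freq)+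
      also have "diag_op (\<lambda>k. \<Sum>j\<in>UNIV. ?b j k) = (\<Sum>j\<in>UNIV. diag_op (?b j))" by (rule diag_op_sum[OF b])
      also have "diag_op (\<lambda>k. \<Sum>j\<in>UNIV. ?c j k) = (\<Sum>j\<in>UNIV. diag_op (?c j))" by (rule diag_op_sum[OF c])
      finally show ?thesis
        by (simp only: diag_op_scaleR[OF bounded_freq_nth] diag_op_scaleR[OF bounded_inv_weight])
    qed
  qed
  note eq = this
  show ?thesis
    unfolding eq power2_eq_square
    by (intro analytic_germ_add analytic_germ_sum analytic_germ_const analytic_germ_scaleR analytic_germ_nth
        analytic_germ_bilinear[OF bounded_bilinear_mult])
qed

subsection \<open>Weighted coordinates\<close>

text \<open>These coordinates identify \<open>H\<^sup>2\<close> with all of \<open>\<ell>\<^sup>2\<close>, see \<open>ex_wcoords\<close> for surjectivity.\<close>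

definition wcoords :: "(real^'n \<Rightarrow> complex) \<Rightarrow> ('n::finite \<Rightarrow> int) ell2" where
  "wcoords u = Abs_ell2 (\<lambda>k. complex_of_real (weight k) * coord (fourier u) k)"

lemma
  fixes u :: "real^'n \<Rightarrow> complex"
  assumes u: "H_per 2 u"
  shows coord_wcoords: "coord (wcoords u) k = complex_of_real (weight k) * coord (fourier u) k"
    and square_integrable_shifted_grad: "square_integrable (\<lambda>y. shifted_grad \<eta> u y $ j)"
    and fourier_shifted_grad: "fourier (\<lambda>y. shifted_grad \<eta> u y $ j) = grad_op j \<eta> (wcoords u)"
    and square_integrable_shifted_lap: "square_integrable (shifted_lap \<eta> u)"
    and fourier_shifted_lap: "fourier (shifted_lap \<eta> u) = lap_op \<eta> (wcoords u)"
proof -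
  note d1 = H_per_2_weak_deriv(1)[OF u] and d2 = H_per_2_weak_deriv(2)[OF u]
  have Lu: "L2_per u" using u by (simp add: H_per_2_iff)
  have L1: "L2_per (weak_deriv j u)" for j using d1[of j] by (simp add: has_weak_deriv_def)
  have L2: "L2_per (weak_deriv l (weak_deriv j u))" for l j using d2[of l j] by (simp add: has_weak_deriv_def)
  note s = L2_per_square_integrable[OF Lu] L2_per_square_integrable[OF L1] L2_per_square_integrable[OF L2]
  have c1: "coord (fourier (weak_deriv j u)) k = \<i> * of_int (k j) * coord (fourier u) k" for j k
    by (rule has_weak_deriv_coeff[OF Lu d1])
  have c2: "coord (fourier (weak_deriv j (weak_deriv j u))) k = - complex_of_real ((freq k $ j)\<^sup>2) * coord (fourier u) k" for j k
    unfolding has_weak_deriv_coeff[OF L1 d2] c1 by (simp add: freq_nth power2_eq_square mult_ac)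
  have nf: "(norm (freq k))\<^sup>2 = (\<Sum>j\<in>UNIV. (freq k $ j)\<^sup>2)" for k :: "'n \<Rightarrow> int"
    by (rule norm_vec_square)
  have fsum: "coord (fourier (\<lambda>y. \<Sum>j\<in>UNIV. f j y)) k = (\<Sum>j\<in>UNIV. coord (fourier (f j)) k)"
    if "\<And>j. square_integrable (f j)" for f :: "'n \<Rightarrow> real^'n \<Rightarrow> complex" and k
    using that by (simp add: coord_fourier square_integrable_sum fourier_coeff_def mean_inner_sum_left square_integrable_wave)
  have lap0: "coord (fourier (\<lambda>y. \<Sum>j\<in>UNIV. weak_deriv j (weak_deriv j u) y)) k
      = - complex_of_real ((norm (freq k))\<^sup>2) * coord (fourier u) k" for k
    by (subst fsum) (auto intro: s simp: c2 nf sum_distrib_right sum_negf)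
  have "(\<lambda>k. (cmod (coord (fourier u) k + (-1) * coord (fourier (\<lambda>y. \<Sum>j\<in>UNIV. weak_deriv j (weak_deriv j u) y)) k))\<^sup>2) summable_on UNIV"
    by (rule square_summable_add[OF coord_summable]) (simp add: coord_summable)
  then have "(\<lambda>k. (cmod (complex_of_real (weight k) * coord (fourier u) k))\<^sup>2) summable_on UNIV"
  proof (rule summable_on_comparison_test)
    fix k :: "'n \<Rightarrow> int"
    have "coord (fourier u) k + (-1) * coord (fourier (\<lambda>y. \<Sum>j\<in>UNIV. weak_deriv j (weak_deriv j u) y)) k
        = complex_of_real (1 + (norm (freq k))\<^sup>2) * coord (fourier u) k"
      unfolding lap0 by (simp add: distrib_right)
    moreover have "cmod (complex_of_real (weight k) * coord (fourier u) k)
        \<le> cmod (complex_of_real (1 + (norm (freq k))\<^sup>2) * coord (fourier u) k)"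
      unfolding norm_mult norm_of_real using weight_ge(4)[of k]
      by (intro mult_right_mono) (auto simp: weight_def)
    ultimately show "(cmod (complex_of_real (weight k) * coord (fourier u) k))\<^sup>2
        \<le> (cmod (coord (fourier u) k + (-1) * coord (fourier (\<lambda>y. \<Sum>j\<in>UNIV. weak_deriv j (weak_deriv j u) y)) k))\<^sup>2"
      by (simp only: power_mono norm_ge_zero)
  qed simp
  then have cw: "coord (wcoords u) k = complex_of_real (weight k) * coord (fourier u) k" for k
    unfolding wcoords_def by (simp add: coord_Abs)
  then show "coord (wcoords u) k = complex_of_real (weight k) * coord (fourier u) k" .
  have w0: "complex_of_real (weight k) \<noteq> 0" for k :: "'n \<Rightarrow> int" using weight_ge(4)[of k] by simp
  have sg: "(\<lambda>y. shifted_grad \<eta> u y $ j) = (\<lambda>y. weak_deriv j u y + (\<i> * complex_of_real (\<eta> $ j)) * u y)"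
    by (simp add: shifted_grad_def)
  show "square_integrable (\<lambda>y. shifted_grad \<eta> u y $ j)"
    unfolding sg by (intro square_integrable_add square_integrable_cmult s)
  show "fourier (\<lambda>y. shifted_grad \<eta> u y $ j) = grad_op j \<eta> (wcoords u)"
    unfolding sg
  proof (rule ell2_eqI)
    fix k
    have "coord (fourier (\<lambda>y. weak_deriv j u y + (\<i> * complex_of_real (\<eta> $ j)) * u y)) k
        = \<i> * of_int (k j) * coord (fourier u) k + (\<i> * complex_of_real (\<eta> $ j)) * coord (fourier u) k"
      by (simp only: fourier_add square_integrable_cmult s coord_simps coord_fourier_cmult c1)
    also have "\<dots> = coord (grad_op j \<eta> (wcoords u)) k"
    proof -
      have "coord (grad_op j \<eta> (wcoords u)) k
          = \<i> * complex_of_real ((freq k + \<eta>) $ j) * coord (fourier u) k"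
        using less_imp_neq[OF weight_ge(4)[of k]]
        by (simp add: grad_op_def coord_diag_op[OF bounded_grad_symbol] cw grad_symbol_def)
      then show ?thesis by (simp add: freq_nth algebra_simps)
    qed
    finally show "coord (fourier (\<lambda>y. weak_deriv j u y + (\<i> * complex_of_real (\<eta> $ j)) * u y)) k
        = coord (grad_op j \<eta> (wcoords u)) k" .
  qed
  define p where "p y = (\<Sum>j\<in>UNIV. weak_deriv j (weak_deriv j u) y)" for y
  define q where "q y = (\<Sum>j\<in>UNIV. complex_of_real (\<eta> $ j) * weak_deriv j u y)" for y
  have sp: "square_integrable p" and sq: "square_integrable q"
    unfolding p_def q_def by (intro square_integrable_sum square_integrable_cmult s)+
  have sl: "shifted_lap \<eta> u = (\<lambda>y. (p y + (2 * \<i>) * q y) + (- complex_of_real ((norm \<eta>)\<^sup>2)) * u y)"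
    by (rule ext) (simp add: shifted_lap_def p_def q_def)
  show "square_integrable (shifted_lap \<eta> u)"
    unfolding sl by (intro square_integrable_add square_integrable_cmult s sp sq)
  have cq: "coord (fourier q) k = \<i> * complex_of_real (\<eta> \<bullet> freq k) * coord (fourier u) k" for k
  proof -
    have "coord (fourier q) k = (\<Sum>j\<in>UNIV. coord (fourier (\<lambda>y. complex_of_real (\<eta> $ j) * weak_deriv j u y)) k)"
      unfolding q_def by (rule fsum) (intro square_integrable_cmult s)
    also have "\<dots> = (\<Sum>j\<in>UNIV. complex_of_real (\<eta> $ j) * (\<i> * of_int (k j) * coord (fourier u) k))"
      by (simp only: coord_fourier_cmult s c1)
    also have "\<dots> = \<i> * complex_of_real (\<eta> \<bullet> freq k) * coord (fourier u) k"
      by (simp add: inner_vec_def freq_nth sum_distrib_left sum_distrib_right mult_ac)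
    finally show ?thesis .
  qed
  have ls: "(norm (freq k + \<eta>))\<^sup>2 = (norm (freq k))\<^sup>2 + 2 * (\<eta> \<bullet> freq k) + (norm \<eta>)\<^sup>2" for k
    by (simp add: power2_norm_eq_inner inner_add_left inner_add_right inner_commute)
  show "fourier (shifted_lap \<eta> u) = lap_op \<eta> (wcoords u)"
  proof (rule ell2_eqI)
    fix k
    have "coord (fourier (shifted_lap \<eta> u)) k
        = coord (fourier p) k + (2 * \<i>) * coord (fourier q) k + (- complex_of_real ((norm \<eta>)\<^sup>2)) * coord (fourier u) k"
      unfolding sl
      by (simp only: fourier_add square_integrable_add square_integrable_cmult s sp sq coord_simps coord_fourier_cmult)
    also have "\<dots> = - complex_of_real ((norm (freq k + \<eta>))\<^sup>2) * coord (fourier u) k"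
      unfolding p_def lap0 cq ls by (simp add: algebra_simps)
    also have "\<dots> = coord (lap_op \<eta> (wcoords u)) k"
      using less_imp_neq[OF weight_ge(4)[of k]]
      by (simp add: lap_op_def coord_diag_op[OF bounded_lap_symbol] cw lap_symbol_def)
    finally show "coord (fourier (shifted_lap \<eta> u)) k = coord (lap_op \<eta> (wcoords u)) k" .
  qed
qed

lemma ex_wcoords:
  fixes c :: "('n::finite \<Rightarrow> int) ell2"
  obtains u :: "real^'n \<Rightarrow> complex" where "H_per 2 u" "wcoords u = c"
proof -
  define u where "u = synth (diag_op (\<lambda>k. 1 / complex_of_real (weight k)) c)"
  define g where "g j = synth (diag_op (\<lambda>k. \<i> * complex_of_real (freq k $ j) / complex_of_real (weight k)) c)" for j
  define h where "h l j = synth (diag_op (\<lambda>k. - complex_of_real (freq k $ l * freq k $ j) / complex_of_real (weight k)) c)" for l j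
  have bh: "bounded_fun (\<lambda>k. - complex_of_real (freq k $ l * freq k $ j) / complex_of_real (weight k))" for l j :: 'n
  proof (rule bounded_fun_div_weight)
    fix k :: "'n \<Rightarrow> int"
    have "\<bar>freq k $ l\<bar> * \<bar>freq k $ j\<bar> \<le> norm (freq k) * norm (freq k)"
      by (intro mult_mono component_le_norm_cart) auto
    then show "cmod (- complex_of_real (freq k $ l * freq k $ j)) \<le> 1 * weight k"
      using weight_ge(2)[of k] by (simp add: norm_mult power2_eq_square)
  qed
  have ug: "has_weak_deriv j u (g j)" for j
    unfolding u_def g_def
    by (rule has_weak_deriv_synth)
      (simp only: coord_diag_op[OF bounded_inv_weight] coord_diag_op[OF bounded_freq_nth], simp add: freq_nth)
  have gh: "has_weak_deriv l (g j) (h l j)" for l j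
    unfolding g_def h_def
    by (rule has_weak_deriv_synth)
      (simp only: coord_diag_op[OF bh] coord_diag_op[OF bounded_freq_nth], simp add: freq_nth mult_ac)
  have "L2_per u" unfolding u_def by (rule L2_per_synth)
  then have H: "H_per 2 u" unfolding H_per_2_iff using ug gh by blast
  moreover have "wcoords u = c"
  proof (rule ell2_eqI)
    fix k :: "'n \<Rightarrow> int"
    have "complex_of_real (weight k) \<noteq> 0" using weight_ge(4)[of k] by simp
    then show "coord (wcoords u) k = coord c k"
      unfolding coord_wcoords[OF H] by (simp add: u_def coord_diag_op[OF bounded_inv_weight])
  qed
  ultimately show ?thesis by (rule that)
qed

lemma fourier_eq_wcoords:
  fixes u :: "real^'n \<Rightarrow> complex"
  shows "H_per 2 u \<Longrightarrow> fourier u = diag_op (\<lambda>k. 1 / complex_of_real (weight k)) (wcoords u)"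
proof (rule ell2_eqI)
  fix k :: "'n \<Rightarrow> int" assume H: "H_per 2 u"
  have "complex_of_real (weight k) \<noteq> 0" using weight_ge(4)[of k] by simp
  then show "coord (fourier u) k = coord (diag_op (\<lambda>k. 1 / complex_of_real (weight k)) (wcoords u)) k"
    by (simp add: coord_diag_op[OF bounded_inv_weight] coord_wcoords[OF H])
qed

text \<open>The function vanishes almost everywhere on the cell, and the translates of the cell by the countably many
periods cover the space.\<close>

lemma wcoords_eq_0:
  assumes H: "H_per 2 u" and zero: "wcoords u = 0"
  shows "AE y in lebesgue. u y = 0"
proof -
  have u: "L2_per u" using H by (simp add: H_per_2_iff)
  have "fourier u = 0" by (simp add: fourier_eq_wcoords[OF H] zero)
  then have "AE y in lebesgue. y \<in> cell \<longrightarrow> u y = 0"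
    using fourier_eq_0[OF L2_per_square_integrable[OF u]] by (simp add: AE_cell)
  then obtain N where N: "N \<in> null_sets lebesgue" "\<And>y. y \<notin> N \<Longrightarrow> y \<in> cell \<Longrightarrow> u y = 0"
    by (auto elim!: AE_E3)
  define vec where "vec k = (2 * pi) *\<^sub>R freq k" for k :: "'a \<Rightarrow> int"
  have freq_int: "freq k \<in> int_vecs" for k :: "'a \<Rightarrow> int" by (auto simp: int_vecs_def freq_def)
  have shifted: "AE y in lebesgue. y + vec k \<notin> N" for k
  proof -
    have "negligible ((\<lambda>y. - vec k + y) ` N)"
      using N(1) by (intro negligible_translation) (simp add: negligible_iff_null_sets)
    then have "AE y in lebesgue. y \<notin> (\<lambda>y. - vec k + y) ` N"
      by (intro AE_not_in) (simp add: negligible_iff_null_sets)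
    then show ?thesis
    proof eventually_elim
      case (elim y)
      show ?case
      proof
        assume "y + vec k \<in> N"
        then have "- vec k + (y + vec k) \<in> (\<lambda>y. - vec k + y) ` N" by (rule imageI)
        then show False using elim by simp
      qed
    qed
  qed
  have "AE y in lebesgue. \<forall>k. u (y + vec k) = u y"
    unfolding AE_all_countable using u freq_int by (auto simp: L2_per_def periodic_ae_def vec_def)
  moreover have "AE y in lebesgue. \<forall>k. y + vec k \<notin> N"
    unfolding AE_all_countable using shifted by blast
  ultimately show ?thesis
  proof eventually_elim
    case (elim y)
    \<comment> \<open>The period that brings \<open>y\<close> into the cell.\<close>
    define k where "k i = - \<lfloor>y $ i / (2 * pi)\<rfloor>" for i
    have "y + vec k \<in> cell"
    proof -
      have "0 \<le> y $ i - 2 * pi * \<lfloor>y $ i / (2 * pi)\<rfloor> \<and> y $ i - 2 * pi * \<lfloor>y $ i / (2 * pi)\<rfloor> < 2 * pi" for i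
      proof -
        have "of_int \<lfloor>y $ i / (2 * pi)\<rfloor> \<le> y $ i / (2 * pi)" "y $ i / (2 * pi) < of_int \<lfloor>y $ i / (2 * pi)\<rfloor> + 1"
          by (auto simp: floor_correct)
        then have "2 * pi * of_int \<lfloor>y $ i / (2 * pi)\<rfloor> \<le> 2 * pi * (y $ i / (2 * pi))"
          "2 * pi * (y $ i / (2 * pi)) < 2 * pi * (of_int \<lfloor>y $ i / (2 * pi)\<rfloor> + 1)"
          using pi_gt_zero by (intro mult_left_mono mult_strict_left_mono; simp)+
        moreover have "2 * pi * (y $ i / (2 * pi)) = y $ i" using pi_gt_zero by simp
        ultimately show ?thesis by (simp only: distrib_left) simp
      qed
      then show ?thesis by (simp add: cell_def vec_def freq_def k_def)
    qed
    then show ?case using N(2)[of "y + vec k"] elim by auto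
  qed
qed

section \<open>The Bloch operators in Fourier coordinates\<close>

lemma ell2_inner_commute: "ell2_inner c d = cnj (ell2_inner d c)"
  by (rule ell2_innerI)
    (use has_sum_cnj_iff[THEN iffD2, OF ell2_inner_has_sum[of d c]] in \<open>simp add: mult.commute\<close>)

lemma ell2_inner_add_left: "ell2_inner (c + c') d = ell2_inner c d + ell2_inner c' d"
  by (subst (1 2 3) ell2_inner_commute) (simp add: ell2_inner_add_right)

lemma ell2_inner_scaleR_left: "ell2_inner (r *\<^sub>R c) d = complex_of_real r * ell2_inner c d"
  by (rule ell2_innerI)
    (use has_sum_cmult_right[OF ell2_inner_has_sum[of c d], of "complex_of_real r"] in
      \<open>simp add: coord_simps scaleR_conv_of_real mult.assoc\<close>)

lemma ell2_inner_zero_left: "ell2_inner 0 d = 0"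
  using ell2_inner_scaleR_left[of 0 0 d] by simp

lemma ell2_inner_sum_left: "ell2_inner (\<Sum>i\<in>I. f i) d = (\<Sum>i\<in>I. ell2_inner (f i) d)"
  by (induction I rule: infinite_finite_induct) (auto simp: ell2_inner_zero_left ell2_inner_add_left)

lemma ell2_inner_eqI: "(\<And>d. ell2_inner c d = ell2_inner c' d) \<Longrightarrow> c = c'"
  by (rule ell2_eqI) (metis ell2_inner_single)

subsection \<open>Multiplication by a bounded function\<close>

definition mult_op :: "(real^'n \<Rightarrow> real) \<Rightarrow> ('n::finite \<Rightarrow> int) ell2 \<Rightarrow>\<^sub>L ('n \<Rightarrow> int) ell2" where
  "mult_op m = Blinfun (\<lambda>c. fourier (\<lambda>y. complex_of_real (m y) * synth c y))"

lemma
  fixes m :: "real^'n \<Rightarrow> real"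
  assumes m: "m \<in> borel_measurable cell_measure" and M: "AE y in cell_measure. \<bar>m y\<bar> \<le> M" "M \<ge> 0"
  shows mult_op_apply: "mult_op m c = fourier (\<lambda>y. complex_of_real (m y) * synth c y)"
    and square_integrable_mult_op: "square_integrable u \<Longrightarrow> square_integrable (\<lambda>y. complex_of_real (m y) * u y)"
    and mult_op_fourier: "square_integrable u \<Longrightarrow> mult_op m (fourier u) = fourier (\<lambda>y. complex_of_real (m y) * u y)"
    and norm_mult_op_le: "norm (mult_op m c) \<le> M * norm c"
    and mult_op_i: "mult_op m (diag_op (\<lambda>_. \<i>) c) = diag_op (\<lambda>_. \<i>) (mult_op m c)"
proof -
  have sq: "square_integrable (\<lambda>y. complex_of_real (m y) * u y)" if "square_integrable u" for u
    by (rule square_integrable_bounded_mult[OF that, of _ M]) (use m M in auto)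
  let ?f = "\<lambda>c. fourier (\<lambda>y. complex_of_real (m y) * synth c y)"
  have cong: "fourier (\<lambda>y. complex_of_real (m y) * u y) = fourier (\<lambda>y. complex_of_real (m y) * v y)"
    if u: "square_integrable u" and v: "square_integrable v" and eq: "fourier u = fourier v" for u v
  proof (rule fourier_cong_AE[OF sq[OF u] sq[OF v]])
    show "AE y in cell_measure. complex_of_real (m y) * u y = complex_of_real (m y) * v y"
      using square_integrable_eq_AE[OF u v eq] by eventually_elim simp
  qed
  have add: "?f (c + d) = ?f c + ?f d" for c d
  proof -
    have "?f (c + d) = fourier (\<lambda>y. complex_of_real (m y) * (synth c y + synth d y))"
      by (rule cong) (simp_all add: square_integrable_add fourier_add)
    also have "\<dots> = ?f c + ?f d"
      unfolding distrib_left by (rule fourier_add) (simp_all add: sq)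
    finally show ?thesis .
  qed
  have cmult: "?f d = fourier (\<lambda>y. z * (complex_of_real (m y) * synth c y))"
    if "\<And>k. coord d k = z * coord c k" for c d z
  proof -
    have "?f d = fourier (\<lambda>y. complex_of_real (m y) * (z * synth c y))"
      by (rule cong) (auto intro!: ell2_eqI simp: square_integrable_cmult coord_fourier_cmult that)
    then show ?thesis by (simp only: mult.left_commute)
  qed
  have norm_le: "norm (?f c) \<le> M * norm c" for c
  proof (rule power2_le_imp_le)
    note [measurable] = square_integrableD(1)[OF square_integrable_synth[of c]] m
    have "(norm (?f c))\<^sup>2 \<le> mean_square (\<lambda>y. complex_of_real (m y) * synth c y)"
      by (rule norm_fourier_le[OF sq]) simp
    also have "\<dots> \<le> M\<^sup>2 * mean_square (synth c)"
    proof -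
      have "integral\<^sup>L cell_measure (\<lambda>y. (cmod (complex_of_real (m y) * synth c y))\<^sup>2)
          \<le> integral\<^sup>L cell_measure (\<lambda>y. M\<^sup>2 * (cmod (synth c y))\<^sup>2)"
      proof (rule integral_mono_AE)
        show "AE y in cell_measure. (cmod (complex_of_real (m y) * synth c y))\<^sup>2 \<le> M\<^sup>2 * (cmod (synth c y))\<^sup>2"
          using M(1)
        proof eventually_elim
          case (elim y)
          have "\<bar>m y\<bar>\<^sup>2 \<le> M\<^sup>2" using elim by (intro power_mono) auto
          then show ?case by (simp add: norm_mult power_mult_distrib mult_right_mono)
        qed
      qed (use square_integrableD(2)[OF sq[OF square_integrable_synth]] square_integrableD(2)[OF square_integrable_synth] in auto)
      then show ?thesis using vol_pos[where 'n = 'n] by (simp add: mean_square_def divide_right_mono)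
    qed
    also have "\<dots> = (M * norm c)\<^sup>2" by (simp add: mean_square_fourier power_mult_distrib)
    finally show "(norm (?f c))\<^sup>2 \<le> (M * norm c)\<^sup>2" .
  qed (use M in simp)
  have "bounded_linear ?f"
  proof
    show "?f (c + d) = ?f c + ?f d" for c d by (rule add)
    show "?f (r *\<^sub>R c) = r *\<^sub>R ?f c" for r c
      by (subst cmult[of "r *\<^sub>R c" "complex_of_real r" c])
        (auto simp: coord_simps scaleR_conv_of_real fourier_scaleR sq)
    show "\<exists>K. \<forall>c. norm (?f c) \<le> norm c * K"
      using norm_le by (intro exI[of _ M]) (simp add: mult.commute)
  qed
  then show ap: "mult_op m c = ?f c" for c
    unfolding mult_op_def by (simp add: bounded_linear_Blinfun_apply)
  show "square_integrable u \<Longrightarrow> square_integrable (\<lambda>y. complex_of_real (m y) * u y)" by (rule sq)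
  show "square_integrable u \<Longrightarrow> mult_op m (fourier u) = fourier (\<lambda>y. complex_of_real (m y) * u y)"
    unfolding ap by (rule cong) auto
  show "norm (mult_op m c) \<le> M * norm c" unfolding ap by (rule norm_le)
  have "bounded_fun (\<lambda>_ :: 'n \<Rightarrow> int. \<i>)" by (rule bounded_funI[of _ 1]) simp
  then show "mult_op m (diag_op (\<lambda>_. \<i>) c) = diag_op (\<lambda>_. \<i>) (mult_op m c)"
    unfolding ap
    by (subst cmult[of _ \<i> c]) (auto intro!: ell2_eqI simp: coord_diag_op coord_fourier_cmult sq)
qed

subsection \<open>The form\<close>

locale elliptic_coefficients =
  fixes A :: "real^'n \<Rightarrow> real^'n^'n" and \<alpha> M :: real
  assumes A_meas: "(\<lambda>y. A y $ i $ j) \<in> borel_measurable lebesgue"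
    and A_bound: "AE y in lebesgue. \<forall>i j. \<bar>A y $ i $ j\<bar> \<le> M"
    and A_sym: "AE y in lebesgue. transpose (A y) = A y"
    and \<alpha>: "\<alpha> > 0" and M: "M \<ge> 0"
    and elliptic: "AE y in lebesgue. \<forall>\<xi>. (A y *v \<xi>) \<bullet> \<xi> \<ge> \<alpha> * (norm \<xi>)\<^sup>2"
begin

lemma A_entry: "(\<lambda>y. A y $ i $ j) \<in> borel_measurable cell_measure"
  "AE y in cell_measure. \<bar>A y $ i $ j\<bar> \<le> M"
proof -
  show "(\<lambda>y. A y $ i $ j) \<in> borel_measurable cell_measure" by (rule measurable_cell[OF A_meas])
  show "AE y in cell_measure. \<bar>A y $ i $ j\<bar> \<le> M"
    unfolding AE_cell using A_bound by eventually_elim auto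
qed

abbreviation coeff_op :: "'n \<Rightarrow> 'n \<Rightarrow> ('n \<Rightarrow> int) ell2 \<Rightarrow>\<^sub>L ('n \<Rightarrow> int) ell2" where
  "coeff_op j k \<equiv> mult_op (\<lambda>y. A y $ j $ k)"

lemmas coeff_op = mult_op_apply[OF A_entry M] mult_op_fourier[OF A_entry M]
lemmas square_integrable_A = square_integrable_mult_op[OF A_entry M]

text \<open>The operator of the form in weighted coordinates. It is a polynomial in \<open>\<eta>\<close> because the symbols are; the
multiplications by the entries of \<open>A\<close> do not depend on \<open>\<eta>\<close>.\<close>

definition bloch_op :: "real \<Rightarrow> real^'n \<Rightarrow> ('n \<Rightarrow> int) ell2 \<Rightarrow>\<^sub>L ('n \<Rightarrow> int) ell2" where
  "bloch_op \<rho> \<eta> = (\<Sum>j\<in>UNIV. \<Sum>k\<in>UNIV. grad_adj j \<eta> o\<^sub>L (coeff_op j k o\<^sub>L grad_op k \<eta>))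
     + \<rho>\<^sup>2 *\<^sub>R (lap_op \<eta> o\<^sub>L lap_op \<eta>)"

lemma bloch_op_apply:
  "bloch_op \<rho> \<eta> c = (\<Sum>j\<in>UNIV. \<Sum>k\<in>UNIV. grad_adj j \<eta> (coeff_op j k (grad_op k \<eta> c)))
     + \<rho>\<^sup>2 *\<^sub>R lap_op \<eta> (lap_op \<eta> c)"
  by (simp add: bloch_op_def blinfun.add_left blinfun.sum_left blinfun.scaleR_left)

lemma ell2_inner_grad_adj: "ell2_inner (grad_adj j \<eta> c) d = ell2_inner c (grad_op j \<eta> d)"
  unfolding grad_adj_def grad_op_def
  by (subst ell2_inner_diag_op[OF bounded_fun_cnj[OF bounded_grad_symbol]]) simp

lemma lap_symbol_real: "cnj (lap_symbol \<eta> k) = lap_symbol \<eta> k"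
  by (simp add: lap_symbol_def)

lemma ell2_inner_lap_op: "ell2_inner (lap_op \<eta> c) d = ell2_inner c (lap_op \<eta> d)"
  unfolding lap_op_def by (subst ell2_inner_diag_op[OF bounded_lap_symbol]) (simp add: lap_symbol_real)

lemma ell2_inner_bloch_op:
  "ell2_inner (bloch_op \<rho> \<eta> c) d =
     (\<Sum>j\<in>UNIV. \<Sum>k\<in>UNIV. ell2_inner (coeff_op j k (grad_op k \<eta> c)) (grad_op j \<eta> d))
     + complex_of_real (\<rho>\<^sup>2) * ell2_inner (lap_op \<eta> c) (lap_op \<eta> d)"
  by (simp only: bloch_op_apply ell2_inner_add_left ell2_inner_sum_left ell2_inner_scaleR_left
      ell2_inner_grad_adj ell2_inner_lap_op[of \<eta> "lap_op \<eta> c"])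

lemma bloch_form_eq:
  assumes u: "H_per 2 u" and v: "H_per 2 v"
  shows "bloch_form A \<rho> \<eta> u v = complex_of_real (vol TYPE('n)) * ell2_inner (bloch_op \<rho> \<eta> (wcoords u)) (wcoords v)"
proof -
  have V: "complex_of_real (vol TYPE('n)) \<noteq> 0" using vol_pos[where 'n = 'n] by simp
  have int: "integral\<^sup>L cell_measure (\<lambda>y. f y * cnj (g y)) = complex_of_real (vol TYPE('n)) * ell2_inner (fourier f) (fourier g)"
    if "square_integrable f" "square_integrable g" for f g :: "real^'n \<Rightarrow> complex"
    unfolding parseval[OF that, symmetric] mean_inner_def using V by simp
  note su = square_integrable_shifted_grad[OF u] square_integrable_shifted_lap[OF u]
  note sv = square_integrable_shifted_grad[OF v] square_integrable_shifted_lap[OF v]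
  have 1: "integral\<^sup>L cell_measure (\<lambda>y. complex_of_real (A y $ j $ k) * shifted_grad \<eta> u y $ k * cnj (shifted_grad \<eta> v y $ j))
      = complex_of_real (vol TYPE('n)) * ell2_inner (coeff_op j k (grad_op k \<eta> (wcoords u))) (grad_op j \<eta> (wcoords v))" for j k
    unfolding int[OF square_integrable_A[OF su(1)] sv(1)] fourier_shifted_grad[OF u, symmetric]
      fourier_shifted_grad[OF v, symmetric] coeff_op(2)[OF su(1)] ..
  have 2: "integral\<^sup>L cell_measure (\<lambda>y. shifted_lap \<eta> u y * cnj (shifted_lap \<eta> v y))
      = complex_of_real (vol TYPE('n)) * ell2_inner (lap_op \<eta> (wcoords u)) (lap_op \<eta> (wcoords v))"
    unfolding int[OF su(2) sv(2)] fourier_shifted_lap[OF u] fourier_shifted_lap[OF v] ..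
  have i1: "integrable cell_measure (\<lambda>y. complex_of_real (A y $ j $ k) * shifted_grad \<eta> u y $ k * cnj (shifted_grad \<eta> v y $ j))" for j k
    by (rule integrable_mult_cnj[OF square_integrable_A[OF su(1)] sv(1)])
  have "integral\<^sup>L cell_measure (\<lambda>y. \<Sum>j\<in>UNIV. \<Sum>k\<in>UNIV.
        complex_of_real (A y $ j $ k) * shifted_grad \<eta> u y $ k * cnj (shifted_grad \<eta> v y $ j))
      = (\<Sum>j\<in>UNIV. \<Sum>k\<in>UNIV. complex_of_real (vol TYPE('n)) * ell2_inner (coeff_op j k (grad_op k \<eta> (wcoords u))) (grad_op j \<eta> (wcoords v)))"
    by (subst Bochner_Integration.integral_sum, intro Bochner_Integration.integrable_sum i1,
        subst Bochner_Integration.integral_sum, intro i1, simp only: 1)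
  then show ?thesis
    unfolding bloch_form_def set_integral_cell 2 ell2_inner_bloch_op
    by (simp add: sum_distrib_left distrib_left mult.left_commute)
qed

abbreviation mass_op :: "('n \<Rightarrow> int) ell2 \<Rightarrow>\<^sub>L ('n \<Rightarrow> int) ell2" where
  "mass_op \<equiv> diag_op (\<lambda>k. 1 / complex_of_real (weight k)) o\<^sub>L diag_op (\<lambda>k. 1 / complex_of_real (weight k))"

lemma L2_inner_eq:
  assumes u: "H_per 2 u" and v: "H_per 2 v"
  shows "L2_inner (\<lambda>y. complex_of_real \<mu> * u y) v
     = complex_of_real (vol TYPE('n)) * ell2_inner (\<mu> *\<^sub>R mass_op (wcoords u)) (wcoords v)"
proof -
  have V: "complex_of_real (vol TYPE('n)) \<noteq> 0" using vol_pos[where 'n = 'n] by simp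
  have sq: "square_integrable u" "square_integrable v"
    using u v by (auto simp: H_per_2_iff intro: L2_per_square_integrable)
  have "L2_inner (\<lambda>y. complex_of_real \<mu> * u y) v = complex_of_real (vol TYPE('n)) * mean_inner (\<lambda>y. complex_of_real \<mu> * u y) v"
    unfolding L2_inner_def set_integral_cell mean_inner_def using V by simp
  also have "mean_inner (\<lambda>y. complex_of_real \<mu> * u y) v = complex_of_real \<mu> * ell2_inner (fourier u) (fourier v)"
    unfolding mean_inner_cmult_left parseval[OF sq] ..
  also have "ell2_inner (fourier u) (fourier v) = ell2_inner (mass_op (wcoords u)) (wcoords v)"
    unfolding fourier_eq_wcoords[OF u] fourier_eq_wcoords[OF v] blinfun_apply_blinfun_compose
    by (subst (2) ell2_inner_diag_op[OF bounded_inv_weight]) simp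
  finally show ?thesis by (simp add: ell2_inner_scaleR_left)
qed

text \<open>Test functions \<open>v\<close> in \<open>H\<^sup>2\<close> correspond to arbitrary elements of \<open>\<ell>\<^sup>2\<close>, so the weak eigenvalue equation is an
equation between two elements of \<open>\<ell>\<^sup>2\<close>.\<close>

theorem ex_bloch_eigenfunction_iff:
  "(\<exists>u. bloch_eigenfunction A \<rho> \<eta> \<mu> u) \<longleftrightarrow> (\<exists>c. c \<noteq> 0 \<and> bloch_op \<rho> \<eta> c = \<mu> *\<^sub>R mass_op c)"
proof
  have V: "complex_of_real (vol TYPE('n)) \<noteq> 0" using vol_pos[where 'n = 'n] by simp
  show "\<exists>c. c \<noteq> 0 \<and> bloch_op \<rho> \<eta> c = \<mu> *\<^sub>R mass_op c" if ex: "\<exists>u. bloch_eigenfunction A \<rho> \<eta> \<mu> u"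
  proof -
    obtain u where nz: "\<not> (AE y in lebesgue. u y = 0)" and op: "bloch_operator A \<rho> \<eta> u (\<lambda>y. complex_of_real \<mu> * u y)"
      using ex by (auto simp: bloch_eigenfunction_def)
    have u: "H_per 2 u" and eq: "\<And>v. H_per 2 v \<Longrightarrow> bloch_form A \<rho> \<eta> u v = L2_inner (\<lambda>y. complex_of_real \<mu> * u y) v"
      using op by (auto simp: bloch_operator_def)
    have "bloch_op \<rho> \<eta> (wcoords u) = \<mu> *\<^sub>R mass_op (wcoords u)"
    proof (rule ell2_inner_eqI)
      fix d :: "('n \<Rightarrow> int) ell2"
      obtain v where v: "H_per 2 v" "wcoords v = d" using ex_wcoords[of d] by metis
      show "ell2_inner (bloch_op \<rho> \<eta> (wcoords u)) d = ell2_inner (\<mu> *\<^sub>R mass_op (wcoords u)) d"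
        using eq[OF v(1)] V unfolding bloch_form_eq[OF u v(1)] L2_inner_eq[OF u v(1)] v(2) mult_cancel_left by blast
    qed
    moreover have "wcoords u \<noteq> 0" using wcoords_eq_0[OF u] nz by blast
    ultimately show ?thesis by blast
  qed
  show "\<exists>u. bloch_eigenfunction A \<rho> \<eta> \<mu> u" if ex: "\<exists>c. c \<noteq> 0 \<and> bloch_op \<rho> \<eta> c = \<mu> *\<^sub>R mass_op c"
  proof -
    obtain c where c: "c \<noteq> 0" "bloch_op \<rho> \<eta> c = \<mu> *\<^sub>R mass_op c" using ex by blast
    obtain u where u: "H_per 2 u" "wcoords u = c" using ex_wcoords[of c] by metis
    have L: "L2_per u" using u(1) by (simp add: H_per_2_iff)
    have "\<not> (AE y in lebesgue. u y = 0)"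
    proof
      assume "AE y in lebesgue. u y = 0"
      then have ae: "AE y in cell_measure. u y = 0" unfolding AE_cell by eventually_elim simp
      have "fourier u = fourier (\<lambda>_. 0)"
        by (rule fourier_cong_AE[OF L2_per_square_integrable[OF L] square_integrable_zero ae])
      also have "\<dots> = 0"
        by (rule ell2_eqI) (simp add: coord_fourier square_integrable_zero fourier_coeff_def mean_inner_def coord_simps)
      finally have "wcoords u = 0"
        by (intro ell2_eqI) (simp add: coord_wcoords[OF u(1)] coord_simps)
      then show False using u c by simp
    qed
    moreover have "L2_per (\<lambda>y. complex_of_real \<mu> * u y)"
    proof -
      have "periodic_ae (\<lambda>y. complex_of_real \<mu> * u y)"
        unfolding periodic_ae_def
      proof
        fix p :: "real^'n" assume "p \<in> int_vecs"
        then have "AE y in lebesgue. u (y + (2 * pi) *\<^sub>R p) = u y"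
          using L by (auto simp: L2_per_def periodic_ae_def)
        then show "AE y in lebesgue. complex_of_real \<mu> * u (y + (2 * pi) *\<^sub>R p) = complex_of_real \<mu> * u y"
          by eventually_elim simp
      qed
      moreover have "(\<lambda>y. complex_of_real \<mu> * u y) \<in> borel_measurable lebesgue"
        using L by (auto simp: L2_per_def)
      ultimately show ?thesis
        using square_integrable_cmult[OF L2_per_square_integrable[OF L], of "complex_of_real \<mu>"]
        by (simp add: L2_per_def set_integrable_cell square_integrable_def)
    qed
    moreover have "bloch_form A \<rho> \<eta> u v = L2_inner (\<lambda>y. complex_of_real \<mu> * u y) v" if "H_per 2 v" for v
      unfolding bloch_form_eq[OF u(1) that] L2_inner_eq[OF u(1) that] u(2) c(2) ..
    ultimately have "bloch_eigenfunction A \<rho> \<eta> \<mu> u"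
      using u(1) by (simp add: bloch_eigenfunction_def bloch_operator_def)
    then show ?thesis by blast
  qed
qed

subsection \<open>Symmetry and bounds\<close>

lemma ell2_inner_coeff_op:
  "ell2_inner (coeff_op j k c) d = mean_inner (\<lambda>y. complex_of_real (A y $ j $ k) * synth c y) (synth d)"
  unfolding coeff_op(1) parseval[OF square_integrable_A[OF square_integrable_synth] square_integrable_synth]
  by simp

lemma coeff_op_sym: "ell2_inner (coeff_op j k c) d = cnj (ell2_inner (coeff_op k j d) c)"
proof -
  have ae: "AE y in cell_measure. complex_of_real (A y $ k $ j) * synth d y = complex_of_real (A y $ j $ k) * synth d y"
    unfolding AE_cell using A_sym
  proof eventually_elim
    case (elim y)
    have "transpose (A y) $ k $ j = A y $ j $ k" by (simp add: transpose_def)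
    then have "A y $ k $ j = A y $ j $ k" by (simp only: elim)
    then show ?case by simp
  qed
  have "ell2_inner (coeff_op k j d) c = mean_inner (\<lambda>y. complex_of_real (A y $ j $ k) * synth d y) (synth c)"
    unfolding ell2_inner_coeff_op
    by (rule mean_inner_cong_AE[OF _ _ _ ae]) (simp_all add: square_integrable_A)
  moreover have "mean_inner (\<lambda>y. complex_of_real (A y $ j $ k) * synth c y) (synth d)
      = cnj (mean_inner (\<lambda>y. complex_of_real (A y $ j $ k) * synth d y) (synth c))"
    by (subst mean_inner_cnj) (simp add: mean_inner_def mult_ac)
  ultimately show ?thesis by (simp only: ell2_inner_coeff_op)
qed

lemma bloch_op_sym: "bloch_op \<rho> \<eta> c \<bullet> d = c \<bullet> bloch_op \<rho> \<eta> d"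
proof -
  have "ell2_inner (bloch_op \<rho> \<eta> c) d = cnj (ell2_inner (bloch_op \<rho> \<eta> d) c)"
  proof -
    have "(\<Sum>j\<in>UNIV. \<Sum>k\<in>UNIV. ell2_inner (coeff_op j k (grad_op k \<eta> c)) (grad_op j \<eta> d))
        = (\<Sum>j\<in>UNIV. \<Sum>k\<in>UNIV. cnj (ell2_inner (coeff_op k j (grad_op j \<eta> d)) (grad_op k \<eta> c)))"
      by (subst coeff_op_sym) (rule refl)
    also have "\<dots> = (\<Sum>k\<in>UNIV. \<Sum>j\<in>UNIV. cnj (ell2_inner (coeff_op k j (grad_op j \<eta> d)) (grad_op k \<eta> c)))"
      by (rule sum.swap)
    finally show ?thesis
      unfolding ell2_inner_bloch_op
      by (subst ell2_inner_commute[of "lap_op \<eta> c"]) simp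
  qed
  also have "\<dots> = ell2_inner c (bloch_op \<rho> \<eta> d)" by (rule ell2_inner_commute[symmetric])
  finally show ?thesis by (simp only: inner_ell2_def)
qed

text \<open>Ellipticity is assumed for real vectors. For a complex vector field the real part of the quadratic form is the
sum of the forms of the real and of the imaginary part, since \<open>A\<close> is real.\<close>

lemma bloch_op_lower:
  "\<alpha> * (\<Sum>j\<in>UNIV. (norm (grad_op j \<eta> c))\<^sup>2) + \<rho>\<^sup>2 * (norm (lap_op \<eta> c))\<^sup>2 \<le> bloch_op \<rho> \<eta> c \<bullet> c"
proof -
  define s where "s j = synth (grad_op j \<eta> c)" for j
  have sq: "square_integrable (s j)" for j by (simp add: s_def)
  have V: "vol TYPE('n) > 0" by (rule vol_pos)
  have i: "integrable cell_measure (\<lambda>y. complex_of_real (A y $ j $ k) * s k y * cnj (s j y))" for j k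
    by (rule integrable_mult_cnj[OF square_integrable_A[OF sq] sq])
  have pointwise: "AE y in cell_measure. \<alpha> * (\<Sum>j\<in>UNIV. (cmod (s j y))\<^sup>2)
      \<le> (\<Sum>j\<in>UNIV. \<Sum>k\<in>UNIV. Re (complex_of_real (A y $ j $ k) * s k y * cnj (s j y)))"
    unfolding AE_cell using elliptic
  proof eventually_elim
    case (elim y)
    define a b :: "real^'n" where "a = (\<chi> j. Re (s j y))" and "b = (\<chi> j. Im (s j y))"
    have "(\<Sum>j\<in>UNIV. (cmod (s j y))\<^sup>2) = (norm a)\<^sup>2 + (norm b)\<^sup>2"
      unfolding norm_vec_square by (simp add: a_def b_def cmod_power2 sum.distrib)
    moreover have "(\<Sum>j\<in>UNIV. \<Sum>k\<in>UNIV. Re (complex_of_real (A y $ j $ k) * s k y * cnj (s j y)))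
        = (A y *v a) \<bullet> a + (A y *v b) \<bullet> b"
      by (simp add: a_def b_def inner_vec_def matrix_vector_mult_def sum_distrib_left sum.distrib algebra_simps)
    ultimately show ?case using elim[rule_format, of a] elim[rule_format, of b] by (simp add: distrib_left)
  qed
  have n: "(norm (grad_op j \<eta> c))\<^sup>2 = mean_square (s j)" for j
    by (simp add: s_def mean_square_fourier)
  have "\<alpha> * (\<Sum>j\<in>UNIV. (norm (grad_op j \<eta> c))\<^sup>2)
      = integral\<^sup>L cell_measure (\<lambda>y. \<alpha> * (\<Sum>j\<in>UNIV. (cmod (s j y))\<^sup>2)) / vol TYPE('n)"
    unfolding n mean_square_def sum_divide_distrib[symmetric] integral_mult_right_zero
    by (subst Bochner_Integration.integral_sum) (auto intro: square_integrableD(2)[OF sq])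
  also have "\<dots> \<le> integral\<^sup>L cell_measure (\<lambda>y. \<Sum>j\<in>UNIV. \<Sum>k\<in>UNIV.
      Re (complex_of_real (A y $ j $ k) * s k y * cnj (s j y))) / vol TYPE('n)"
  proof (intro divide_right_mono integral_mono_AE pointwise)
    show "integrable cell_measure (\<lambda>y. \<alpha> * (\<Sum>j\<in>UNIV. (cmod (s j y))\<^sup>2))"
      by (intro Bochner_Integration.integrable_mult_right impI Bochner_Integration.integrable_sum square_integrableD(2)[OF sq])
    show "integrable cell_measure (\<lambda>y. \<Sum>j\<in>UNIV. \<Sum>k\<in>UNIV. Re (complex_of_real (A y $ j $ k) * s k y * cnj (s j y)))"
      by (intro Bochner_Integration.integrable_sum integrable_Re i)
  qed (use V in simp)
  also have "\<dots> = (\<Sum>j\<in>UNIV. \<Sum>k\<in>UNIV. Re (ell2_inner (coeff_op j k (grad_op k \<eta> c)) (grad_op j \<eta> c)))"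
  proof -
    have "integral\<^sup>L cell_measure (\<lambda>y. \<Sum>j\<in>UNIV. \<Sum>k\<in>UNIV. Re (complex_of_real (A y $ j $ k) * s k y * cnj (s j y)))
        = (\<Sum>j\<in>UNIV. \<Sum>k\<in>UNIV. integral\<^sup>L cell_measure (\<lambda>y. Re (complex_of_real (A y $ j $ k) * s k y * cnj (s j y))))"
      by (subst Bochner_Integration.integral_sum, intro Bochner_Integration.integrable_sum integrable_Re i,
          subst Bochner_Integration.integral_sum, intro integrable_Re i, rule refl)
    also have "\<dots> = (\<Sum>j\<in>UNIV. \<Sum>k\<in>UNIV. Re (integral\<^sup>L cell_measure (\<lambda>y. complex_of_real (A y $ j $ k) * s k y * cnj (s j y))))"
      by (simp only: integral_Re[OF i])
    finally show ?thesis
      unfolding ell2_inner_coeff_op mean_inner_def s_def by (simp add: sum_divide_distrib)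
  qed
  finally have "\<alpha> * (\<Sum>j\<in>UNIV. (norm (grad_op j \<eta> c))\<^sup>2)
      \<le> (\<Sum>j\<in>UNIV. \<Sum>k\<in>UNIV. Re (ell2_inner (coeff_op j k (grad_op k \<eta> c)) (grad_op j \<eta> c)))" .
  moreover have "Re (ell2_inner (lap_op \<eta> c) (lap_op \<eta> c)) = (norm (lap_op \<eta> c))\<^sup>2"
    by (simp add: ell2_inner_self norm_ell2_square)
  ultimately show ?thesis
    unfolding inner_ell2_def ell2_inner_bloch_op by simp
qed

lemma analytic_bloch_op: "analytic_germ (bloch_op \<rho>) \<eta>"
  unfolding bloch_op_def[abs_def]
  by (intro analytic_germ_add analytic_germ_sum analytic_germ_scaleR analytic_germ_const analytic_lap_op
      analytic_germ_bilinear[OF bounded_bilinear_blinfun_compose] analytic_grad_op analytic_grad_adj)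

lemma bounded_i: "bounded_fun (\<lambda>_. \<i>)"
  by (rule bounded_funI[of _ 1]) simp

lemma diag_op_commute:
  "bounded_fun a \<Longrightarrow> bounded_fun b \<Longrightarrow> diag_op a (diag_op b c) = diag_op b (diag_op a c)"
  by (rule ell2_eqI) (simp add: coord_diag_op)

lemma bloch_op_i: "bloch_op \<rho> \<eta> (diag_op (\<lambda>_. \<i>) c) = diag_op (\<lambda>_. \<i>) (bloch_op \<rho> \<eta> c)"
proof -
  have g: "grad_op j \<eta> (diag_op (\<lambda>_. \<i>) c) = diag_op (\<lambda>_. \<i>) (grad_op j \<eta> c)" for j c
    unfolding grad_op_def by (rule diag_op_commute[OF bounded_grad_symbol bounded_i])
  have g': "grad_adj j \<eta> (diag_op (\<lambda>_. \<i>) c) = diag_op (\<lambda>_. \<i>) (grad_adj j \<eta> c)" for j c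
    unfolding grad_adj_def by (rule diag_op_commute[OF bounded_fun_cnj[OF bounded_grad_symbol] bounded_i])
  have l: "lap_op \<eta> (diag_op (\<lambda>_. \<i>) c) = diag_op (\<lambda>_. \<i>) (lap_op \<eta> c)" for c
    unfolding lap_op_def by (rule diag_op_commute[OF bounded_lap_symbol bounded_i])
  show ?thesis
    by (simp only: bloch_op_apply g g' l mult_op_i[OF A_entry M] blinfun.add_right blinfun.sum_right blinfun.scaleR_right)
qed

lemma has_sum_sum:
  fixes f :: "'i \<Rightarrow> 'k \<Rightarrow> 'b::topological_comm_monoid_add"
  shows "(\<And>i. i \<in> I \<Longrightarrow> (f i has_sum s i) S) \<Longrightarrow> ((\<lambda>k. \<Sum>i\<in>I. f i k) has_sum (\<Sum>i\<in>I. s i)) S"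
  by (induction I rule: infinite_finite_induct) (auto intro: has_sum_add)

lemma grad_lap_square_sum:
  "((\<lambda>k. (\<alpha> * (norm (freq k + \<eta>))\<^sup>2 + \<rho>\<^sup>2 * (norm (freq k + \<eta>)) ^ 4) * (cmod (coord c k))\<^sup>2 / (weight k)\<^sup>2) has_sum
     (\<alpha> * (\<Sum>j\<in>UNIV. (norm (grad_op j \<eta> c))\<^sup>2) + \<rho>\<^sup>2 * (norm (lap_op \<eta> c))\<^sup>2)) UNIV"
proof -
  have "((\<lambda>k. \<alpha> * (\<Sum>j\<in>UNIV. (cmod (coord (grad_op j \<eta> c) k))\<^sup>2) + \<rho>\<^sup>2 * (cmod (coord (lap_op \<eta> c) k))\<^sup>2) has_sum
     (\<alpha> * (\<Sum>j\<in>UNIV. (norm (grad_op j \<eta> c))\<^sup>2) + \<rho>\<^sup>2 * (norm (lap_op \<eta> c))\<^sup>2)) UNIV"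
    by (intro has_sum_add has_sum_cmult_right has_sum_sum norm_ell2_has_sum)
  moreover have "\<alpha> * (\<Sum>j\<in>UNIV. (cmod (coord (grad_op j \<eta> c) k))\<^sup>2) + \<rho>\<^sup>2 * (cmod (coord (lap_op \<eta> c) k))\<^sup>2
      = (\<alpha> * (norm (freq k + \<eta>))\<^sup>2 + \<rho>\<^sup>2 * (norm (freq k + \<eta>)) ^ 4) * (cmod (coord c k))\<^sup>2 / (weight k)\<^sup>2" for k
  proof -
    have g: "(cmod (coord (grad_op j \<eta> c) k))\<^sup>2 = ((freq k + \<eta>) $ j)\<^sup>2 * ((cmod (coord c k))\<^sup>2 / (weight k)\<^sup>2)" for j
      unfolding grad_op_def coord_diag_op[OF bounded_grad_symbol] grad_symbol_def
      by (simp add: norm_mult norm_divide power_mult_distrib power_divide del: vector_add_component)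
    have l: "(cmod (coord (lap_op \<eta> c) k))\<^sup>2 = norm (freq k + \<eta>) ^ 4 * ((cmod (coord c k))\<^sup>2 / (weight k)\<^sup>2)"
      unfolding lap_op_def coord_diag_op[OF bounded_lap_symbol] lap_symbol_def
      by (simp add: norm_mult norm_divide norm_power power_mult_distrib power_divide)
    show ?thesis
      unfolding g l sum_distrib_right[symmetric] norm_vec_square[symmetric] by (simp add: algebra_simps add_divide_distrib)
  qed
  ultimately show ?thesis by simp
qed

lemma mass_op_square_sum:
  "((\<lambda>k. (cmod (coord c k))\<^sup>2 / (weight k)\<^sup>2) has_sum (mass_op c \<bullet> c)) UNIV"
proof -
  let ?d = "diag_op (\<lambda>k. 1 / complex_of_real (weight k)) c"
  have "mass_op c \<bullet> c = ?d \<bullet> ?d"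
    unfolding inner_ell2_def blinfun_apply_blinfun_compose
    by (subst ell2_inner_diag_op[OF bounded_inv_weight]) simp
  then have "mass_op c \<bullet> c = (norm ?d)\<^sup>2" by (simp add: power2_norm_eq_inner)
  moreover have "(cmod (coord ?d k))\<^sup>2 = (cmod (coord c k))\<^sup>2 / (weight k)\<^sup>2" for k
    by (simp add: coord_diag_op[OF bounded_inv_weight] norm_divide power_divide)
  ultimately show ?thesis using norm_ell2_has_sum[of ?d] by simp
qed

text \<open>Termwise comparison. For \<open>k \<noteq> 0\<close> one has \<open>\<bar>k + \<eta>\<bar> \<ge> 2\<bar>k\<bar>/3\<close> and \<open>(2/3)\<^sup>4 = 16/81\<close>. Half of the fourth order term,
\<open>8/81\<close>, goes into the gap above the mass operator, where it outweighs the term \<open>\<rho>\<^sup>2 \<bar>\<eta>\<bar>\<^sup>4\<close> of the constant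
function; the other half is coercive in the \<open>H\<^sup>2\<close> norm.\<close>

lemma bloch_op_gap:
  assumes \<eta>: "norm \<eta> \<le> 1/3" and c0: "coord c (\<lambda>_. 0) = 0"
  shows "(\<alpha> * (4/9) + \<rho>\<^sup>2 * (8/81)) * (mass_op c \<bullet> c) + \<rho>\<^sup>2 * (8/81) * (c \<bullet> c) \<le> bloch_op \<rho> \<eta> c \<bullet> c"
proof -
  have "(\<alpha> * (4/9) + \<rho>\<^sup>2 * (8/81)) * (mass_op c \<bullet> c) + \<rho>\<^sup>2 * (8/81) * (norm c)\<^sup>2
      \<le> \<alpha> * (\<Sum>j\<in>UNIV. (norm (grad_op j \<eta> c))\<^sup>2) + \<rho>\<^sup>2 * (norm (lap_op \<eta> c))\<^sup>2"
  proof (rule has_sum_mono[OF _ grad_lap_square_sum])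
    show "((\<lambda>k. (\<alpha> * (4/9) + \<rho>\<^sup>2 * (8/81)) * ((cmod (coord c k))\<^sup>2 / (weight k)\<^sup>2) + \<rho>\<^sup>2 * (8/81) * (cmod (coord c k))\<^sup>2) has_sum
        ((\<alpha> * (4/9) + \<rho>\<^sup>2 * (8/81)) * (mass_op c \<bullet> c) + \<rho>\<^sup>2 * (8/81) * (norm c)\<^sup>2)) UNIV"
      by (intro has_sum_add has_sum_cmult_right mass_op_square_sum norm_ell2_has_sum)
    fix k :: "'n \<Rightarrow> int"
    show "(\<alpha> * (4/9) + \<rho>\<^sup>2 * (8/81)) * ((cmod (coord c k))\<^sup>2 / (weight k)\<^sup>2) + \<rho>\<^sup>2 * (8/81) * (cmod (coord c k))\<^sup>2
        \<le> (\<alpha> * (norm (freq k + \<eta>))\<^sup>2 + \<rho>\<^sup>2 * (norm (freq k + \<eta>)) ^ 4) * (cmod (coord c k))\<^sup>2 / (weight k)\<^sup>2"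
    proof (cases "k = (\<lambda>_. 0)")
      case False
      define t where "t = norm (freq k)"
      have t: "t \<ge> 1" unfolding t_def by (rule norm_freq_ge_1[OF False])
      have w: "weight k = t\<^sup>2" using one_le_power[OF t, of 2] by (simp add: weight_def t_def)
      have s: "norm (freq k + \<eta>) \<ge> 2/3 * t"
        using norm_triangle_ineq2[of "freq k" "- \<eta>"] \<eta> t by (simp add: t_def)
      have s2: "(norm (freq k + \<eta>))\<^sup>2 \<ge> 4/9 * t\<^sup>2"
        using power_mono[OF s, of 2] t by (simp add: power_mult_distrib power2_eq_square)
      have s4: "norm (freq k + \<eta>) ^ 4 \<ge> 16/81 * t ^ 4"
        using power_mono[OF s, of 4] t by (simp add: power_mult_distrib power_divide)
      have t2: "t\<^sup>2 \<ge> 1" "t ^ 4 \<ge> 1" using t by (auto intro: one_le_power)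
      have "\<alpha> * (4/9) + \<rho>\<^sup>2 * (8/81) + \<rho>\<^sup>2 * (8/81) * t ^ 4
          \<le> \<alpha> * (norm (freq k + \<eta>))\<^sup>2 + \<rho>\<^sup>2 * norm (freq k + \<eta>) ^ 4"
      proof -
        have "\<alpha> * (4/9) \<le> \<alpha> * (norm (freq k + \<eta>))\<^sup>2" using s2 t2 \<alpha> by (intro mult_left_mono) auto
        moreover have "\<rho>\<^sup>2 * (8/81 + 8/81 * t ^ 4) \<le> \<rho>\<^sup>2 * norm (freq k + \<eta>) ^ 4"
          using s4 t2 by (intro mult_left_mono) auto
        ultimately show ?thesis by (simp add: algebra_simps)
      qed
      then have "(\<alpha> * (4/9) + \<rho>\<^sup>2 * (8/81) + \<rho>\<^sup>2 * (8/81) * t ^ 4) * ((cmod (coord c k))\<^sup>2 / (weight k)\<^sup>2)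
          \<le> (\<alpha> * (norm (freq k + \<eta>))\<^sup>2 + \<rho>\<^sup>2 * norm (freq k + \<eta>) ^ 4) * ((cmod (coord c k))\<^sup>2 / (weight k)\<^sup>2)"
        by (rule mult_right_mono) simp
      moreover have "t ^ 4 * ((cmod (coord c k))\<^sup>2 / (weight k)\<^sup>2) = (cmod (coord c k))\<^sup>2"
      proof -
        have "(weight k)\<^sup>2 = t ^ 4" by (simp add: w)
        then show ?thesis using t by simp
      qed
      ultimately have "(\<alpha> * (4/9) + \<rho>\<^sup>2 * (8/81)) * ((cmod (coord c k))\<^sup>2 / (weight k)\<^sup>2) + \<rho>\<^sup>2 * (8/81) * (cmod (coord c k))\<^sup>2
          \<le> (\<alpha> * (norm (freq k + \<eta>))\<^sup>2 + \<rho>\<^sup>2 * (norm (freq k + \<eta>)) ^ 4) * ((cmod (coord c k))\<^sup>2 / (weight k)\<^sup>2)"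
        by (simp only: distrib_right mult.assoc)
      then show ?thesis by (simp only: times_divide_eq_right)
    qed (simp add: c0)
  qed
  then show ?thesis using bloch_op_lower[of \<eta> c \<rho>] by (simp add: power2_norm_eq_inner)
qed

lemma weight_0: "weight (\<lambda>_ :: 'n. 0) = 1"
proof -
  have "freq (\<lambda>_. 0) = (0 :: real^'n)" by (simp add: freq_def vec_eq_iff)
  then show ?thesis by (simp add: weight_def)
qed

abbreviation e0 :: "('n \<Rightarrow> int) ell2" where "e0 \<equiv> ell2_single (\<lambda>_. 0)"

lemma norm_e0: "norm e0 = 1"
proof -
  have "ell2_inner e0 e0 = 1" by (simp add: ell2_inner_single coord_single)
  then show ?thesis by (simp add: norm_eq_sqrt_inner inner_ell2_def)
qed

text \<open>On the constant function only the terms with \<open>\<eta>\<close> remain: \<open>(\<nabla> + i\<eta>) 1 = i\<eta>\<close> and \<open>(\<nabla> + i\<eta>)\<^sup>2 1 = -\<bar>\<eta>\<bar>\<^sup>2\<close>.\<close>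

lemma bloch_op_e0:
  "bloch_op \<rho> \<eta> e0 \<bullet> e0 \<le> M * (real CARD('n))\<^sup>2 * (norm \<eta>)\<^sup>2 + \<rho>\<^sup>2 * norm \<eta> ^ 4"
proof -
  have f0: "freq (\<lambda>_. 0) = (0 :: real^'n)" by (simp add: freq_def vec_eq_iff)
  have ng: "norm (grad_op j \<eta> e0) \<le> norm \<eta>" for j
  proof -
    have "(norm (grad_op j \<eta> e0))\<^sup>2 = (\<bar>\<eta> $ j\<bar>)\<^sup>2"
    proof (rule has_sum_unique[OF norm_ell2_has_sum])
      show "((\<lambda>k. (cmod (coord (grad_op j \<eta> e0) k))\<^sup>2) has_sum \<bar>\<eta> $ j\<bar>\<^sup>2) UNIV"
        by (rule has_sum_finite_neutralI[where B = "{\<lambda>_. 0}"])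
          (auto simp: grad_op_def coord_diag_op[OF bounded_grad_symbol] coord_single grad_symbol_def weight_0 f0 norm_mult)
    qed
    then have "norm (grad_op j \<eta> e0) = \<bar>\<eta> $ j\<bar>" by (rule power2_eq_imp_eq) auto
    then show ?thesis using component_le_norm_cart[of \<eta> j] by simp
  qed
  have nl: "(norm (lap_op \<eta> e0))\<^sup>2 = norm \<eta> ^ 4"
  proof (rule has_sum_unique[OF norm_ell2_has_sum])
    show "((\<lambda>k. (cmod (coord (lap_op \<eta> e0) k))\<^sup>2) has_sum norm \<eta> ^ 4) UNIV"
      by (rule has_sum_finite_neutralI[where B = "{\<lambda>_. 0}"])
        (auto simp: lap_op_def coord_diag_op[OF bounded_lap_symbol] coord_single lap_symbol_def weight_0 f0 norm_power)
  qed
  have t: "coeff_op j k (grad_op k \<eta> e0) \<bullet> grad_op j \<eta> e0 \<le> M * (norm \<eta>)\<^sup>2" for j k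
  proof -
    have "coeff_op j k (grad_op k \<eta> e0) \<bullet> grad_op j \<eta> e0 \<le> norm (coeff_op j k (grad_op k \<eta> e0)) * norm (grad_op j \<eta> e0)"
      by (rule norm_cauchy_schwarz)
    also have "\<dots> \<le> (M * norm \<eta>) * norm \<eta>"
      using M by (intro mult_mono order_trans[OF norm_mult_op_le[OF A_entry M]] mult_left_mono ng) auto
    finally show ?thesis by (simp add: power2_eq_square)
  qed
  have "bloch_op \<rho> \<eta> e0 \<bullet> e0 = (\<Sum>j\<in>UNIV. \<Sum>k\<in>UNIV. coeff_op j k (grad_op k \<eta> e0) \<bullet> grad_op j \<eta> e0)
      + \<rho>\<^sup>2 * (norm (lap_op \<eta> e0))\<^sup>2"
    unfolding inner_ell2_def ell2_inner_bloch_op by (simp add: ell2_inner_self norm_ell2_square)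
  also have "\<dots> \<le> (\<Sum>j\<in>(UNIV :: 'n set). \<Sum>k\<in>(UNIV :: 'n set). M * (norm \<eta>)\<^sup>2) + \<rho>\<^sup>2 * norm \<eta> ^ 4"
    unfolding nl by (intro add_mono sum_mono t) simp
  also have "\<dots> = M * (real CARD('n))\<^sup>2 * (norm \<eta>)\<^sup>2 + \<rho>\<^sup>2 * norm \<eta> ^ 4"
    by (simp add: power2_eq_square)
  finally show ?thesis .
qed

text \<open>The two smallness conditions on \<open>\<delta>\<close> put the constant function below the gap. The term \<open>\<rho>\<^sup>2 \<bar>\<eta>\<bar>\<^sup>4 \<le> \<rho>\<^sup>2/81\<close> is absorbed by
the part \<open>8\<rho>\<^sup>2/81\<close> of the gap, so neither condition involves \<open>\<rho>\<close>.\<close>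

lemma simple_low_eigenvalue_bloch:
  assumes \<delta>: "\<delta> \<le> 1/3" "M * (real CARD('n))\<^sup>2 * \<delta>\<^sup>2 < \<alpha> * (4/9)" and \<rho>: "\<rho> > 0"
  shows "simple_low_eigenvalue (bloch_op \<rho>) mass_op (diag_op (\<lambda>_. \<i>)) e0 (ball 0 \<delta>)
    (\<alpha> * (4/9) + \<rho>\<^sup>2 * (8/81)) (\<rho>\<^sup>2 * (8/81))"
proof
  let ?J = "diag_op (\<lambda>_. \<i>)" and ?D = "diag_op (\<lambda>k :: 'n \<Rightarrow> int. 1 / complex_of_real (weight k))"
  have D: "ell2_inner (?D c) d = ell2_inner c (?D d)" for c d
    by (subst ell2_inner_diag_op[OF bounded_inv_weight]) simp
  have J_inner: "ell2_inner (?J c) d = \<i> * ell2_inner c d" for c d :: "('n \<Rightarrow> int) ell2"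
    by (rule ell2_innerI)
      (use has_sum_cmult_right[OF ell2_inner_has_sum[of c d], of \<i>] in \<open>simp add: coord_diag_op[OF bounded_i] mult.assoc\<close>)
  show "open (ball (0::real^'n) \<delta>)" by simp
  show "analytic_germ (bloch_op \<rho>) \<eta>" for \<eta> by (rule analytic_bloch_op)
  show "bloch_op \<rho> \<eta> x \<bullet> y = x \<bullet> bloch_op \<rho> \<eta> y" for \<eta> x y by (rule bloch_op_sym)
  show "0 \<le> bloch_op \<rho> \<eta> x \<bullet> x" for \<eta> x
    by (rule order_trans[OF _ bloch_op_lower]) (use \<alpha> in \<open>auto intro!: add_nonneg_nonneg mult_nonneg_nonneg sum_nonneg\<close>)
  show "bloch_op \<rho> \<eta> (?J x) = ?J (bloch_op \<rho> \<eta> x)" for \<eta> x by (rule bloch_op_i)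
  show "mass_op x \<bullet> y = x \<bullet> mass_op y" for x y
    by (simp add: inner_ell2_def D)
  show "0 \<le> mass_op x \<bullet> x" for x
    by (rule has_sum_nonneg[OF mass_op_square_sum]) simp
  show "mass_op (?J x) = ?J (mass_op x)" for x
    by (simp add: diag_op_commute[OF bounded_inv_weight bounded_i])
  show "?J (?J x) = - x" for x :: "('n \<Rightarrow> int) ell2"
    by (rule ell2_eqI) (simp add: coord_diag_op[OF bounded_i] coord_simps)
  show "?J x \<bullet> ?J y = x \<bullet> y" for x y :: "('n \<Rightarrow> int) ell2"
  proof -
    have "ell2_inner (?J x) (?J y) = ell2_inner x y"
      by (rule ell2_innerI)
        (use ell2_inner_has_sum[of x y] in \<open>simp add: coord_diag_op[OF bounded_i] algebra_simps\<close>)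
    then show ?thesis by (simp add: inner_ell2_def)
  qed
  show "mass_op e0 = e0"
    by (rule ell2_eqI) (simp add: coord_diag_op[OF bounded_inv_weight] coord_single weight_0)
  show "e0 \<bullet> e0 = 1" using norm_e0 by (simp add: norm_eq_1)
  show "\<rho>\<^sup>2 * (8/81) > 0" using \<rho> by simp
  show "(\<alpha> * (4/9) + \<rho>\<^sup>2 * (8/81)) * (mass_op w \<bullet> w) + \<rho>\<^sup>2 * (8/81) * (w \<bullet> w) \<le> bloch_op \<rho> \<eta> w \<bullet> w"
    if "\<eta> \<in> ball 0 \<delta>" "w \<bullet> e0 = 0" "w \<bullet> ?J e0 = 0" for \<eta> w
  proof (rule bloch_op_gap)
    show "norm \<eta> \<le> 1/3" using that(1) \<delta>(1) by simp
    have "ell2_inner w (?J e0) = - \<i> * coord w (\<lambda>_. 0)"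
      by (subst ell2_inner_commute) (simp add: J_inner, metis complex_cnj_cnj ell2_inner_commute ell2_inner_single)
    then show "coord w (\<lambda>_. 0) = 0"
      using that(2,3) by (simp add: inner_ell2_def ell2_inner_single complex_eq_iff)
  qed
  show "bloch_op \<rho> \<eta> e0 \<bullet> e0 < \<alpha> * (4/9) + \<rho>\<^sup>2 * (8/81)" if "\<eta> \<in> ball 0 \<delta>" for \<eta>
  proof -
    have n: "norm \<eta> \<le> \<delta>" using that by simp
    have "M * (real CARD('n))\<^sup>2 * (norm \<eta>)\<^sup>2 \<le> M * (real CARD('n))\<^sup>2 * \<delta>\<^sup>2"
      using n M by (intro mult_left_mono power_mono) auto
    moreover have "\<rho>\<^sup>2 * norm \<eta> ^ 4 \<le> \<rho>\<^sup>2 * (8/81)"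
    proof (rule mult_left_mono)
      have "norm \<eta> ^ 4 \<le> (1/3) ^ 4" using n \<delta>(1) by (intro power_mono) auto
      then show "norm \<eta> ^ 4 \<le> 8/81" by (simp add: power_divide)
    qed simp
    ultimately show ?thesis using bloch_op_e0[of \<rho> \<eta>] \<delta>(2) by linarith
  qed
qed

theorem bloch_eigenvalue_analytic:
  assumes "\<delta> \<le> 1/3" "M * (real CARD('n))\<^sup>2 * \<delta>\<^sup>2 < \<alpha> * (4/9)" "\<rho> > 0" "norm \<eta> < \<delta>"
  shows "real_analytic_at (bloch_eigenvalue A \<rho> 1) \<eta>"
proof (rule real_analytic_at_if_germ)
  interpret E: simple_low_eigenvalue "bloch_op \<rho>" mass_op "diag_op (\<lambda>_. \<i>)" e0 "ball 0 \<delta>"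
    "\<alpha> * (4/9) + \<rho>\<^sup>2 * (8/81)" "\<rho>\<^sup>2 * (8/81)"
    by (rule simple_low_eigenvalue_bloch[OF assms(1-3)])
  have "bloch_eigenvalue A \<rho> 1 = (\<lambda>\<eta>. LEAST \<mu>. \<exists>u. E.eigen \<eta> \<mu> u)"
    by (rule ext) (simp only: bloch_eigenvalue_1 ex_bloch_eigenfunction_iff E.eigen_def)
  then show "analytic_germ (bloch_eigenvalue A \<rho> 1) \<eta>"
    using E.Least_eigen_analytic[of \<eta>] assms(4) by simp
qed

end

theorem theorem4p5:
  fixes A :: "real^'n \<Rightarrow> real^'n^'n" and \<alpha> :: real
  assumes measurable: "\<And>i j. (\<lambda>y. A y $ i $ j) \<in> borel_measurable lebesgue"
    and bounded: "\<exists>M. AE y in lebesgue. \<forall>i j. \<bar>A y $ i $ j\<bar> \<le> M"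
    and symmetric: "AE y in lebesgue. transpose (A y) = A y"
    and periodic: "periodic_ae A"
    and "\<alpha> > 0"
    and elliptic: "AE y in lebesgue. \<forall>\<xi>. (A y *v \<xi>) \<bullet> \<xi> \<ge> \<alpha> * (norm \<xi>)\<^sup>2"
  shows "\<exists>\<delta>>0. \<forall>\<rho>>0.
    real_analytic_on (bloch_eigenvalue A \<rho> 1) {\<eta> \<in> dual_cell. norm \<eta> < \<delta>}"
proof -
  obtain M0 where M0: "AE y in lebesgue. \<forall>i j. \<bar>A y $ i $ j\<bar> \<le> M0" using bounded by blast
  define M where "M = max M0 0"
  interpret elliptic_coefficients A \<alpha> M
  proof
    show "AE y in lebesgue. \<forall>i j. \<bar>A y $ i $ j\<bar> \<le> M"
      using M0 by eventually_elim (auto simp: M_def le_max_iff_disj)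
  qed (use assms in \<open>auto simp: M_def\<close>)
  define K where "K = M * (real CARD('n))\<^sup>2"
  have K: "K \<ge> 0" using M by (simp add: K_def)
  \<comment> \<open>With \<open>\<delta> \<le> 1/3\<close> the quadratic condition \<open>K \<delta>\<^sup>2 < 4\<alpha>/9\<close> follows from the linear one \<open>K \<delta> \<le> \<alpha>/3\<close>.\<close>
  define \<delta> where "\<delta> = min (1/3) (\<alpha> / (3 * (K + 1)))"
  have "\<delta> \<le> 1/3" unfolding \<delta>_def by (rule min.cobounded1)
  moreover have "\<delta> > 0" using \<open>\<alpha> > 0\<close> K by (simp add: \<delta>_def)
  ultimately have \<delta>: "\<delta> > 0" "\<delta> \<le> 1/3" by auto
  have "K * \<delta>\<^sup>2 < \<alpha> * (4/9)"
  proof -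
    have "(K + 1) * \<delta> \<le> \<alpha> / 3"
    proof -
      have "(K + 1) * \<delta> \<le> (K + 1) * (\<alpha> / (3 * (K + 1)))"
        using K by (intro mult_left_mono) (auto simp: \<delta>_def)
      moreover have "c * (\<alpha> / (3 * c)) = \<alpha> / 3" if "c > 0" for c :: real using that by simp
      ultimately show ?thesis using K by (metis add_nonneg_pos zero_less_one)
    qed
    moreover have "K * \<delta> \<le> (K + 1) * \<delta>" using \<delta> by (simp add: mult_right_mono)
    ultimately have "K * \<delta> \<le> \<alpha> / 3" by linarith
    then have "K * \<delta> * \<delta> \<le> \<alpha> / 3 * (1/3)" using \<delta> \<open>\<alpha> > 0\<close> K by (intro mult_mono) auto
    then show ?thesis using \<open>\<alpha> > 0\<close> by (simp add: power2_eq_square mult.assoc)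
  qed
  then show ?thesis
    using \<delta> bloch_eigenvalue_analytic[OF \<delta>(2)]
    by (auto simp: real_analytic_on_def K_def intro!: exI[of _ \<delta>])
qed

end
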